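(* Let $1\to H\to G\to K\to 1$ be a short exact sequence of Polish groups such that the universal minimal flows $\mathrm{M}(H)$ and $\mathrm{M}(K)$ are metrizable. If both $H$ and $K$ are uniquely ergodic, then $G$ is also uniquely ergodic.
   Context: Short exact sequence of Polish groups: $G$ is a Polish group, $H\subseteq G$ is a closed normal subgroup, and $K=G/H$ with the quotient topology. For a topological group $G$, a $G$-flow is a continuous right action $X\times G\to X$ on a compact Hausdorff space $X$. A $G$-map between $G$-flows is a continuous $G$-equivariant map. A $G$-flow is minimal if every orbit is dense. The universal minimal flow $\mathrm{M}(G)$ is the minimal $G$-flow, unique up to isomorphism, that admits a $G$-map onto every minimal $G$-flow. A topological group $G$ is uniquely ergodic if $\mathrm{M}(G)$ admits exactly one $G$-invariant (regular Borel probability) measure. *)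

theory Defs
  imports "HOL-Analysis.Analysis" "HOL-Algebra.Coset" "HOL-Probability.Probability_Measure"
begin

(* clashes with the infix closure_of of Abstract_Topology *)
no_notation eq_closure_of (\<open>closure'_of\<index>\<close>)

section \<open>Polish groups\<close>

definition topological_group :: "('g, 'm) monoid_scheme \<Rightarrow> 'g topology \<Rightarrow> bool" where
  "topological_group G T \<longleftrightarrow>
     group G \<and> topspace T = carrier G \<and>
     continuous_map (prod_topology T T) T (\<lambda>(x, y). x \<otimes>\<^bsub>G\<^esub> y) \<and>
     continuous_map T T (\<lambda>x. inv\<^bsub>G\<^esub> x)"

definition polish_group :: "('g, 'm) monoid_scheme \<Rightarrow> 'g topology \<Rightarrow> bool" where
  "polish_group G T \<longleftrightarrow>
     topological_group G T \<and> separable_space T \<and> completely_metrizable_space T"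

definition coset_topology :: "('g, 'm) monoid_scheme \<Rightarrow> 'g topology \<Rightarrow> 'g set \<Rightarrow> 'g set topology" where
  "coset_topology G T H =
     topology (\<lambda>U. U \<subseteq> carrier (G Mod H) \<and> openin T {x \<in> topspace T. H #>\<^bsub>G\<^esub> x \<in> U})"

lemma openin_coset_topology:
  "openin (coset_topology G T H) U \<longleftrightarrow>
     U \<subseteq> carrier (G Mod H) \<and> openin T {x \<in> topspace T. H #>\<^bsub>G\<^esub> x \<in> U}"
proof -
  have "istopology (\<lambda>U. U \<subseteq> carrier (G Mod H) \<and> openin T {x \<in> topspace T. H #>\<^bsub>G\<^esub> x \<in> U})"
    unfolding istopology_def
  proof (intro conjI allI impI)
    fix U V
    assume "U \<subseteq> carrier (G Mod H) \<and> openin T {x \<in> topspace T. H #>\<^bsub>G\<^esub> x \<in> U}"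
      and "V \<subseteq> carrier (G Mod H) \<and> openin T {x \<in> topspace T. H #>\<^bsub>G\<^esub> x \<in> V}"
    moreover have "{x \<in> topspace T. H #>\<^bsub>G\<^esub> x \<in> U \<inter> V} =
        {x \<in> topspace T. H #>\<^bsub>G\<^esub> x \<in> U} \<inter> {x \<in> topspace T. H #>\<^bsub>G\<^esub> x \<in> V}"
      by auto
    ultimately show "U \<inter> V \<subseteq> carrier (G Mod H)"
      and "openin T {x \<in> topspace T. H #>\<^bsub>G\<^esub> x \<in> U \<inter> V}"
      by (auto simp: openin_Int)
  next
    fix \<U>
    assume *: "\<forall>U\<in>\<U>. U \<subseteq> carrier (G Mod H) \<and> openin T {x \<in> topspace T. H #>\<^bsub>G\<^esub> x \<in> U}"
    then show "\<Union>\<U> \<subseteq> carrier (G Mod H)"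
      by auto
    have "{x \<in> topspace T. H #>\<^bsub>G\<^esub> x \<in> \<Union>\<U>} = (\<Union>U\<in>\<U>. {x \<in> topspace T. H #>\<^bsub>G\<^esub> x \<in> U})"
      by auto
    then show "openin T {x \<in> topspace T. H #>\<^bsub>G\<^esub> x \<in> \<Union>\<U>}"
      using * by auto
  qed
  then show ?thesis
    by (simp add: coset_topology_def topology_inverse')
qed

lemma quotient_map_coset_topology:
  assumes "topspace T = carrier G"
  shows "quotient_map T (coset_topology G T H) (\<lambda>x. H #>\<^bsub>G\<^esub> x)"
proof -
  have "openin (coset_topology G T H) (carrier (G Mod H))"
  proof -
    have "{x \<in> topspace T. H #>\<^bsub>G\<^esub> x \<in> carrier (G Mod H)} = topspace T"
      by (auto simp: assms carrier_FactGroup)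
    then show ?thesis
      by (simp add: openin_coset_topology)
  qed
  then have "topspace (coset_topology G T H) = carrier (G Mod H)"
    by (metis openin_coset_topology openin_subset openin_topspace subset_antisym)
  then show ?thesis
    by (auto simp: quotient_map_def openin_coset_topology assms carrier_FactGroup)
qed


section \<open>Flows\<close>

text \<open>The underlying space of a flow is nonempty, as usual in topological dynamics. Otherwise the
  empty flow would be minimal and, since no nonempty flow maps to it, no universal minimal flow
  would exist.\<close>

definition flow ::
  "('g, 'm) monoid_scheme \<Rightarrow> 'g topology \<Rightarrow> 'x topology \<Rightarrow> ('x \<Rightarrow> 'g \<Rightarrow> 'x) \<Rightarrow> bool" where
  "flow G T X a \<longleftrightarrow>
     compact_space X \<and> Hausdorff_space X \<and> topspace X \<noteq> {} \<and>
     continuous_map (prod_topology X T) X (\<lambda>(x, g). a x g) \<and>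
     (\<forall>x\<in>topspace X. a x \<one>\<^bsub>G\<^esub> = x) \<and>
     (\<forall>x\<in>topspace X. \<forall>g\<in>carrier G. \<forall>h\<in>carrier G. a (a x g) h = a x (g \<otimes>\<^bsub>G\<^esub> h))"

definition flow_map ::
  "('g, 'm) monoid_scheme \<Rightarrow> 'x topology \<Rightarrow> ('x \<Rightarrow> 'g \<Rightarrow> 'x) \<Rightarrow>
   'y topology \<Rightarrow> ('y \<Rightarrow> 'g \<Rightarrow> 'y) \<Rightarrow> ('x \<Rightarrow> 'y) \<Rightarrow> bool" where
  "flow_map G X a Y b f \<longleftrightarrow>
     continuous_map X Y f \<and> (\<forall>x\<in>topspace X. \<forall>g\<in>carrier G. f (a x g) = b (f x) g)"

definition minimal_flow ::
  "('g, 'm) monoid_scheme \<Rightarrow> 'g topology \<Rightarrow> 'x topology \<Rightarrow> ('x \<Rightarrow> 'g \<Rightarrow> 'x) \<Rightarrow> bool" where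
  "minimal_flow G T X a \<longleftrightarrow>
     flow G T X a \<and> (\<forall>x\<in>topspace X. X closure_of (a x ` carrier G) = topspace X)"

text \<open>HOL cannot quantify over minimal flows on all types. A Hausdorff space with a dense subset of
  cardinality at most \<open>\<kappa>\<close> has at most \<open>2 ^ 2 ^ \<kappa>\<close> points, so every minimal flow of a group with
  elements of type \<open>'g\<close> is isomorphic to one with points of type \<open>'g set set\<close>, and it suffices to
  test universality on these: see \<open>minimal_flow_small_copy\<close> and \<open>universal_minimal_flow_onto\<close>.\<close>

definition is_universal_minimal_flow ::
  "('g, 'm) monoid_scheme \<Rightarrow> 'g topology \<Rightarrow> 'x topology \<Rightarrow> ('x \<Rightarrow> 'g \<Rightarrow> 'x) \<Rightarrow> bool" where
  "is_universal_minimal_flow G T X a \<longleftrightarrow>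
     minimal_flow G T X a \<and>
     (\<forall>(Y :: 'g set set topology) b. minimal_flow G T Y b \<longrightarrow>
        (\<exists>f. flow_map G X a Y b f \<and> f ` topspace X = topspace Y))"

text \<open>The universal minimal flow is determined up to isomorphism only; we choose one. It exists by
  \<open>is_universal_minimal_flow_UMF\<close>.\<close>

definition UMF ::
  "('g, 'm) monoid_scheme \<Rightarrow> 'g topology \<Rightarrow>
   'g set set topology \<times> ('g set set \<Rightarrow> 'g \<Rightarrow> 'g set set)" where
  "UMF G T = (SOME F. is_universal_minimal_flow G T (fst F) (snd F))"


section \<open>Unique ergodicity\<close>

definition borel_of :: "'x topology \<Rightarrow> 'x measure" where
  "borel_of X = sigma (topspace X) {U. openin X U}"

definition regular_borel_prob :: "'x topology \<Rightarrow> 'x measure \<Rightarrow> bool" where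
  "regular_borel_prob X \<mu> \<longleftrightarrow>
     prob_space \<mu> \<and> sets \<mu> = sets (borel_of X) \<and>
     (\<forall>B\<in>sets \<mu>. emeasure \<mu> B = (SUP C\<in>{C. compactin X C \<and> C \<subseteq> B}. emeasure \<mu> C)) \<and>
     (\<forall>B\<in>sets \<mu>. emeasure \<mu> B = (INF U\<in>{U. openin X U \<and> B \<subseteq> U}. emeasure \<mu> U))"

definition invariant_measure ::
  "('g, 'm) monoid_scheme \<Rightarrow> 'x topology \<Rightarrow> ('x \<Rightarrow> 'g \<Rightarrow> 'x) \<Rightarrow> 'x measure \<Rightarrow> bool" where
  "invariant_measure G X a \<mu> \<longleftrightarrow>
     regular_borel_prob X \<mu> \<and> (\<forall>g\<in>carrier G. distr \<mu> \<mu> (\<lambda>x. a x g) = \<mu>)"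

definition uniquely_ergodic :: "('g, 'm) monoid_scheme \<Rightarrow> 'g topology \<Rightarrow> bool" where
  "uniquely_ergodic G T \<longleftrightarrow>
     (\<exists>!\<mu>. invariant_measure G (fst (UMF G T)) (snd (UMF G T)) \<mu>)"


section \<open>Existence and universality of the universal minimal flow\<close>

lemma flow_act_in:
  assumes "flow G T X a" "topspace T = carrier G" "x \<in> topspace X" "g \<in> carrier G"
  shows "a x g \<in> topspace X"
proof -
  have "continuous_map (prod_topology X T) X (\<lambda>(x, g). a x g)"
    using assms(1) by (simp add: flow_def)
  then have "(\<lambda>(x, g). a x g) (x, g) \<in> topspace X"
    using assms continuous_map_image_subset_topspace by fastforce
  then show ?thesis by simp
qed

lemma flow_act_continuous:
  assumes "flow G T X a" "topspace T = carrier G" "g \<in> carrier G"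
  shows "continuous_map X X (\<lambda>x. a x g)"
proof -
  have 1: "continuous_map (prod_topology X T) X (\<lambda>(x, g). a x g)"
    using assms(1) by (simp add: flow_def)
  have 2: "continuous_map X (prod_topology X T) (\<lambda>x. (x, g))"
    using assms by (simp add: continuous_map_pairwise o_def)
  show ?thesis
    using continuous_map_compose[OF 2 1] by (simp add: o_def)
qed

lemma flow_map_onto_minimal:
  assumes G: "group G" "topspace T = carrier G"
    and X: "flow G T X a" and Y: "minimal_flow G T Y b" and f: "flow_map G X a Y b f"
  shows "f ` topspace X = topspace Y"
proof
  have c: "continuous_map X Y f"
    using f by (simp add: flow_map_def)
  then show sub: "f ` topspace X \<subseteq> topspace Y"
    by (rule continuous_map_image_subset_topspace)
  obtain x where x: "x \<in> topspace X"
    using X unfolding flow_def by blast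
  have "compactin Y (f ` topspace X)"
    using X c by (metis compact_space_def flow_def image_compactin)
  then have cl: "closedin Y (f ` topspace X)"
    using Y by (simp add: compactin_imp_closedin minimal_flow_def flow_def)
  have "b (f x) g \<in> f ` topspace X" if "g \<in> carrier G" for g
    using that x f flow_act_in[OF X G(2) x that]
    unfolding flow_map_def by (metis imageI)
  then have "b (f x) ` carrier G \<subseteq> f ` topspace X"
    by blast
  then have "Y closure_of (b (f x) ` carrier G) \<subseteq> f ` topspace X"
    by (rule closure_of_minimal[OF _ cl])
  moreover have "Y closure_of (b (f x) ` carrier G) = topspace Y"
    using Y sub x by (auto simp: minimal_flow_def)
  ultimately show "topspace Y \<subseteq> f ` topspace X"
    by simp
qed

lemma minimal_flow_transport:
  assumes G: "topspace T = carrier G"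
    and X: "minimal_flow G T X a" and h: "homeomorphic_maps X Y f f'"
  defines "b \<equiv> \<lambda>y g. f (a (f' y) g)"
  shows "minimal_flow G T Y b \<and> flow_map G X a Y b f \<and> flow_map G Y b X a f'"
proof -
  have fl: "flow G T X a"
    using X by (simp add: minimal_flow_def)
  have f: "continuous_map X Y f" and f': "continuous_map Y X f'"
    and ff': "\<And>x. x \<in> topspace X \<Longrightarrow> f' (f x) = x" "\<And>y. y \<in> topspace Y \<Longrightarrow> f (f' y) = y"
    using h by (auto simp: homeomorphic_maps_def)
  have hom: "X homeomorphic_space Y"
    using h by (auto simp: homeomorphic_space_def)
  have fin: "\<And>x. x \<in> topspace X \<Longrightarrow> f x \<in> topspace Y"
    and f'in: "\<And>y. y \<in> topspace Y \<Longrightarrow> f' y \<in> topspace X"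
    using f f' continuous_map_image_subset_topspace by blast+
  have ain: "\<And>x g. x \<in> topspace X \<Longrightarrow> g \<in> carrier G \<Longrightarrow> a x g \<in> topspace X"
    using flow_act_in[OF fl G] .
  have comp: "compact_space Y"
    using fl hom homeomorphic_compact_space by (auto simp: flow_def)
  have haus: "Hausdorff_space Y"
    using fl hom homeomorphic_Hausdorff_space by (auto simp: flow_def)
  have ne: "topspace Y \<noteq> {}"
    using fl fin unfolding flow_def by blast
  have cont: "continuous_map (prod_topology Y T) Y (\<lambda>(y, g). b y g)"
  proof -
    have 1: "continuous_map (prod_topology Y T) (prod_topology X T) (\<lambda>z. (f' (fst z), snd z))"
      using continuous_map_compose[OF continuous_map_fst f']
      by (simp add: continuous_map_pairwise continuous_map_snd o_def)
    have 2: "continuous_map (prod_topology X T) X (\<lambda>(x, g). a x g)"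
      using fl by (simp add: flow_def)
    show ?thesis
      using continuous_map_compose[OF continuous_map_compose[OF 1 2] f]
      by (simp add: o_def b_def case_prod_unfold)
  qed
  have one: "\<forall>y\<in>topspace Y. b y \<one>\<^bsub>G\<^esub> = y"
    using fl ff' f'in by (auto simp: b_def flow_def)
  have mult: "\<forall>y\<in>topspace Y. \<forall>g\<in>carrier G. \<forall>k\<in>carrier G. b (b y g) k = b y (g \<otimes>\<^bsub>G\<^esub> k)"
    using fl ff' f'in ain by (auto simp: b_def flow_def)
  have dense: "Y closure_of (b y ` carrier G) = topspace Y" if y: "y \<in> topspace Y" for y
  proof -
    have hm: "homeomorphic_map X Y f"
      using h homeomorphic_map_maps by blast
    have sub: "a (f' y) ` carrier G \<subseteq> topspace X"
      using ain f'in[OF y] by auto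
    have "b y ` carrier G = f ` (a (f' y) ` carrier G)"
      by (auto simp: b_def)
    then have "Y closure_of (b y ` carrier G) = f ` (X closure_of (a (f' y) ` carrier G))"
      using homeomorphic_map_closure_of[OF hm sub] by simp
    also have "X closure_of (a (f' y) ` carrier G) = topspace X"
      using X f'in[OF y] by (simp add: minimal_flow_def)
    also have "f ` topspace X = topspace Y"
      using hm homeomorphic_imp_surjective_map by blast
    finally show ?thesis .
  qed
  show ?thesis
    using comp haus ne cont one mult dense f f' ff' f'in fin ain
    by (auto simp: minimal_flow_def flow_def flow_map_def b_def)
qed

lemma minimal_flow_small_copy:
  fixes G :: "('g, 'm) monoid_scheme" and T :: "'g topology"
  assumes G: "topspace T = carrier G" and X: "minimal_flow G T X a"
  shows "\<exists>(Y :: 'g set set topology) b f f'. minimal_flow G T Y b \<and> homeomorphic_maps X Y f f' \<and>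
           flow_map G X a Y b f \<and> flow_map G Y b X a f'"
proof -
  obtain x where x: "x \<in> topspace X"
    using X unfolding minimal_flow_def flow_def by blast
  have haus: "Hausdorff_space X"
    using X by (simp add: minimal_flow_def flow_def)
  have dense: "X closure_of (a x ` carrier G) = topspace X"
    using X x by (simp add: minimal_flow_def)
  define f :: "_ \<Rightarrow> 'g set set" where
    "f = (\<lambda>z. {A. A \<subseteq> carrier G \<and> z \<in> X closure_of (a x ` A)})"
  have inj: "inj_on f (topspace X)"
  proof (rule inj_onI, rule ccontr)
    fix z w assume zw: "z \<in> topspace X" "w \<in> topspace X" "f z = f w" "z \<noteq> w"
    then obtain U V where UV: "openin X U" "openin X V" "z \<in> U" "w \<in> V" "disjnt U V"
      using haus unfolding Hausdorff_space_def by metis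
    define A where "A = {g \<in> carrier G. a x g \<in> U}"
    have "z \<in> X closure_of (a x ` A)"
      unfolding in_closure_of
    proof (intro conjI allI impI)
      show "z \<in> topspace X" by fact
      fix W assume "z \<in> W \<and> openin X W"
      then have "openin X (U \<inter> W)" "z \<in> U \<inter> W"
        using UV by auto
      moreover have "z \<in> X closure_of (a x ` carrier G)"
        using dense zw by simp
      ultimately obtain y where "y \<in> a x ` carrier G" "y \<in> U \<inter> W"
        unfolding in_closure_of by blast
      then show "\<exists>y. y \<in> a x ` A \<and> y \<in> W"
        by (auto simp: A_def)
    qed
    moreover have "w \<notin> X closure_of (a x ` A)"
      using UV by (auto simp: in_closure_of A_def disjnt_iff)
    ultimately have "A \<in> f z" "A \<notin> f w"
      by (auto simp: f_def A_def)
    then show False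
      using zw by simp
  qed
  define f' where "f' = inv_into (topspace X) f"
  define Y where "Y = pullback_topology (f ` topspace X) f' X"
  have f'f: "\<And>z. z \<in> topspace X \<Longrightarrow> f' (f z) = z"
    using inj by (simp add: f'_def)
  have tY: "topspace Y = f ` topspace X"
    using f'f by (auto simp: Y_def topspace_pullback_topology)
  have "homeomorphic_maps X Y f f'"
    unfolding homeomorphic_maps_def
  proof (intro conjI ballI)
    show "continuous_map X Y f"
      unfolding Y_def
    proof (rule continuous_map_pullback')
      show "continuous_map X X (f' \<circ> f)"
        by (rule continuous_map_eq[OF continuous_map_id]) (simp add: f'f)
    qed auto
    show "continuous_map Y X f'"
      unfolding Y_def using continuous_map_pullback[OF continuous_map_id] by fastforce
  qed (use f'f tY in auto)
  then show ?thesis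
    using minimal_flow_transport[OF G X] by blast
qed

lemma universal_minimal_flow_onto:
  fixes G :: "('g, 'm) monoid_scheme" and T :: "'g topology"
  assumes G: "topological_group G T" and X: "is_universal_minimal_flow G T X a"
    and Y: "minimal_flow G T Y b"
  shows "\<exists>f. flow_map G X a Y b f \<and> f ` topspace X = topspace Y"
proof -
  have G': "group G" "topspace T = carrier G"
    using G by (auto simp: topological_group_def)
  obtain Z c f f' where Z: "minimal_flow G T (Z :: 'g set set topology) c" "flow_map G Z c Y b f'"
    using minimal_flow_small_copy[OF G'(2) Y] by blast
  then obtain h where h: "flow_map G X a Z c h"
    using X unfolding is_universal_minimal_flow_def by blast
  have "h ` topspace X \<subseteq> topspace Z"
    using h continuous_map_image_subset_topspace unfolding flow_map_def by blast
  then have "flow_map G X a Y b (f' \<circ> h)"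
    using h Z(2) by (auto simp: flow_map_def intro: continuous_map_compose)
  moreover have "flow G T X a"
    using X by (simp add: is_universal_minimal_flow_def minimal_flow_def)
  ultimately show ?thesis
    using flow_map_onto_minimal[OF G' _ Y] by blast
qed

lemma minimal_subflow_exists:
  assumes G: "topological_group G T" and X: "flow G T X a"
  shows "\<exists>Z. Z \<subseteq> topspace X \<and> minimal_flow G T (subtopology X Z) a"
proof -
  have G': "group G" "topspace T = carrier G"
    using G by (auto simp: topological_group_def)
  interpret group G by fact
  have comp: "compact_space X" and haus: "Hausdorff_space X" and ne: "topspace X \<noteq> {}"
    and cont: "continuous_map (prod_topology X T) X (\<lambda>(x, g). a x g)"
    and one: "\<And>x. x \<in> topspace X \<Longrightarrow> a x \<one>\<^bsub>G\<^esub> = x"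
    and mult: "\<And>x g h. x \<in> topspace X \<Longrightarrow> g \<in> carrier G \<Longrightarrow> h \<in> carrier G \<Longrightarrow>
                a (a x g) h = a x (g \<otimes>\<^bsub>G\<^esub> h)"
    using X by (auto simp: flow_def)
  have ain: "\<And>x g. x \<in> topspace X \<Longrightarrow> g \<in> carrier G \<Longrightarrow> a x g \<in> topspace X"
    using flow_act_in[OF X G'(2)] .
  define \<A> where "\<A> = {C. closedin X C \<and> C \<noteq> {} \<and> (\<forall>x\<in>C. \<forall>g\<in>carrier G. a x g \<in> C)}"
  have A0: "topspace X \<in> \<A>"
    using ne ain by (auto simp: \<A>_def)
  have "\<exists>Z\<in>\<A>. \<forall>W\<in>\<A>. W \<subseteq> Z \<longrightarrow> W = Z"
  proof -
    have "\<exists>M\<in>uminus ` \<A>. \<forall>N\<in>uminus ` \<A>. M \<subseteq> N \<longrightarrow> N = M"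
    proof (rule subset_Zorn_nonempty)
      show "uminus ` \<A> \<noteq> {}"
        using A0 by auto
      fix \<C> assume \<C>: "\<C> \<noteq> {}" "subset.chain (uminus ` \<A>) \<C>"
      define \<D> where "\<D> = uminus ` \<C>"
      have C\<A>: "\<C> \<subseteq> uminus ` \<A>" and Clin: "\<forall>C\<in>\<C>. \<forall>D\<in>\<C>. C \<subseteq> D \<or> D \<subseteq> C"
        using \<C>(2) by (simp_all add: subset_chain_def)
      have D: "\<D> \<subseteq> \<A>" "\<D> \<noteq> {}"
        using C\<A> \<C>(1) by (auto simp: \<D>_def)
      have DC: "\<Union>\<C> = - \<Inter>\<D>"
        by (auto simp: \<D>_def)
      have lin: "C \<subseteq> D \<or> D \<subseteq> C" if "C \<in> \<D>" "D \<in> \<D>" for C D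
        using Clin that by (auto simp: \<D>_def)
      have fip: "\<Inter>\<F> \<noteq> {}" if "finite \<F>" "\<F> \<subseteq> \<D>" for \<F>
      proof (cases "\<F> = {}")
        case False
        have "\<Inter>\<F> \<in> \<F>"
          using that(1) False that(2)
        proof (induction rule: finite_ne_induct)
          case (insert C F)
          then have "C \<subseteq> \<Inter>F \<or> \<Inter>F \<subseteq> C"
            using lin by blast
          then show ?case
            using insert by (auto simp: Int_absorb1 Int_absorb2)
        qed auto
        then show ?thesis
          using that D by (auto simp: \<A>_def)
      qed auto
      have "\<Inter>\<D> \<noteq> {}"
      proof -
        have "\<forall>C\<in>\<D>. closedin X C"
          using D by (auto simp: \<A>_def)
        moreover have "\<forall>\<F>. finite \<F> \<and> \<F> \<subseteq> \<D> \<longrightarrow> \<Inter>\<F> \<noteq> {}"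
          using fip by blast
        ultimately show ?thesis
          using comp unfolding compact_space_fip by blast
      qed
      moreover have "closedin X (\<Inter>\<D>)"
        using D by (intro closedin_Inter) (auto simp: \<A>_def)
      ultimately have "\<Inter>\<D> \<in> \<A>"
        using D by (auto simp: \<A>_def)
      then show "\<Union>\<C> \<in> uminus ` \<A>"
        unfolding DC by (rule imageI)
    qed
    then obtain M where M: "M \<in> uminus ` \<A>" "\<forall>N\<in>uminus ` \<A>. M \<subseteq> N \<longrightarrow> N = M"
      by (rule bexE)
    obtain Z where Z: "M = - Z" "Z \<in> \<A>"
      using M(1) by (rule imageE)
    have "W = Z" if "W \<in> \<A>" "W \<subseteq> Z" for W
    proof -
      have "- W \<in> uminus ` \<A>"
        using that(1) by (rule imageI)
      moreover have "M \<subseteq> - W"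
        using that(2) Z(1) by simp
      ultimately have "- W = M"
        by (rule M(2)[rule_format])
      then show ?thesis
        using Z(1) by simp
    qed
    then show ?thesis
      using Z(2) by blast
  qed
  then obtain Z where Z: "Z \<in> \<A>" and min': "\<forall>W\<in>\<A>. W \<subseteq> Z \<longrightarrow> W = Z"
    by (rule bexE)
  note min = min'[rule_format]
  have Zc: "closedin X Z" "Z \<noteq> {}" and Zi: "\<And>x g. x \<in> Z \<Longrightarrow> g \<in> carrier G \<Longrightarrow> a x g \<in> Z"
    using Z by (auto simp: \<A>_def)
  have Zs: "Z \<subseteq> topspace X"
    using Zc closedin_subset by blast
  have tZ: "topspace (subtopology X Z) = Z"
    using Zs by auto
  have "flow G T (subtopology X Z) a"
    unfolding flow_def tZ
  proof (intro conjI)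
    show "compact_space (subtopology X Z)"
      using closedin_compact_space[OF comp Zc(1)] by (rule compact_space_subtopology)
    show "Hausdorff_space (subtopology X Z)"
      using haus by (rule Hausdorff_space_subtopology)
    show "Z \<noteq> {}"
      by fact
    have "continuous_map (prod_topology (subtopology X Z) T) X (\<lambda>(x, g). a x g)"
      unfolding prod_topology_subtopology(1)
      using cont by (rule continuous_map_from_subtopology)
    moreover have "(\<lambda>(x, g). a x g) \<in> topspace (prod_topology (subtopology X Z) T) \<rightarrow> Z"
      using Zi tZ G' by auto
    ultimately show "continuous_map (prod_topology (subtopology X Z) T) (subtopology X Z) (\<lambda>(x, g). a x g)"
      unfolding continuous_map_in_subtopology by blast
    show "\<forall>x\<in>Z. a x \<one>\<^bsub>G\<^esub> = x"
      using one Zs by (simp add: subset_iff)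
    show "\<forall>x\<in>Z. \<forall>g\<in>carrier G. \<forall>h\<in>carrier G. a (a x g) h = a x (g \<otimes>\<^bsub>G\<^esub> h)"
      using mult Zs by (simp add: subset_iff)
  qed
  moreover have "subtopology X Z closure_of (a x ` carrier G) = Z" if x: "x \<in> Z" for x
  proof -
    let ?O = "a x ` carrier G"
    have OZ: "?O \<subseteq> Z"
      using Zi x by auto
    have OX: "?O \<subseteq> X closure_of ?O"
      using OZ Zs closure_of_subset by blast
    have "a y g \<in> X closure_of ?O" if "y \<in> X closure_of ?O" "g \<in> carrier G" for y g
    proof -
      have "(\<lambda>y. a y g) ` (X closure_of ?O) \<subseteq> X closure_of ((\<lambda>y. a y g) ` ?O)"
        using continuous_map_image_closure_subset[OF flow_act_continuous[OF X G'(2) that(2)]] .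
      moreover have "(\<lambda>y. a y g) ` ?O \<subseteq> ?O"
        using mult x Zs that(2) by auto
      ultimately show ?thesis
        using that(1) closure_of_mono[of "(\<lambda>y. a y g) ` ?O" ?O X] by (metis imageI subsetD)
    qed
    moreover have "?O \<noteq> {}"
      by auto
    ultimately have "X closure_of ?O \<in> \<A>"
      using OX by (auto simp: \<A>_def)
    moreover have "X closure_of ?O \<subseteq> Z"
      using OZ Zc(1) by (simp add: closure_of_minimal)
    ultimately have "X closure_of ?O = Z"
      by (rule min)
    then show ?thesis
      using OZ by (simp add: closure_of_subtopology inf.absorb2)
  qed
  ultimately have "minimal_flow G T (subtopology X Z) a"
    unfolding minimal_flow_def tZ by blast
  with Zs show ?thesis
    by (intro exI conjI)
qed

lemma universal_minimal_flow_exists: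
  fixes G :: "('g, 'm) monoid_scheme" and T :: "'g topology"
  assumes G: "topological_group G T"
  shows "\<exists>(X :: 'g set set topology) a. is_universal_minimal_flow G T X a"
proof -
  have G': "group G" "topspace T = carrier G"
    using G by (auto simp: topological_group_def)
  define I :: "('g set set topology \<times> ('g set set \<Rightarrow> 'g \<Rightarrow> 'g set set)) set"
    where "I = {F. minimal_flow G T (fst F) (snd F)}"
  define P where "P = product_topology fst I"
  define p where "p = (\<lambda>x g. \<lambda>i\<in>I. snd i (x i) g)"
  have If: "flow G T (fst i) (snd i)" if "i \<in> I" for i
    using that by (auto simp: I_def minimal_flow_def)
  have Ic: "compact_space (fst i)" and Ih: "Hausdorff_space (fst i)" and In: "topspace (fst i) \<noteq> {}"
    and I1: "\<And>x. x \<in> topspace (fst i) \<Longrightarrow> snd i x \<one>\<^bsub>G\<^esub> = x"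
    and Im: "\<And>x g h. x \<in> topspace (fst i) \<Longrightarrow> g \<in> carrier G \<Longrightarrow> h \<in> carrier G \<Longrightarrow>
               snd i (snd i x g) h = snd i x (g \<otimes>\<^bsub>G\<^esub> h)"
    if "i \<in> I" for i
    using If[OF that] unfolding flow_def by blast+
  have tP: "topspace P = (\<Pi>\<^sub>E i\<in>I. topspace (fst i))"
    by (simp add: P_def)
  have proj: "continuous_map P (fst i) (\<lambda>x. x i)" if "i \<in> I" for i
    unfolding P_def using that by (rule continuous_map_product_projection)
  have "flow G T P p"
    unfolding flow_def
  proof (intro conjI ballI)
    show "compact_space P"
      unfolding P_def compact_space_product_topology using Ic by blast
    show "Hausdorff_space P"
      unfolding P_def Hausdorff_space_product_topology using Ih by blast
    show "topspace P \<noteq> {}"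
      unfolding tP PiE_eq_empty_iff using In by blast
    show "continuous_map (prod_topology P T) P (\<lambda>(x, g). p x g)"
      unfolding P_def continuous_map_componentwise
    proof (intro conjI ballI)
      show "(\<lambda>(x, g). p x g) ` topspace (prod_topology (product_topology fst I) T) \<subseteq> extensional I"
        by (auto simp: p_def)
      fix i assume i: "i \<in> I"
      have 1: "continuous_map (prod_topology P T) (prod_topology (fst i) T) (\<lambda>z. (fst z i, snd z))"
        using continuous_map_compose[OF continuous_map_fst proj[OF i]]
        by (simp add: continuous_map_pairwise continuous_map_snd o_def)
      have 2: "continuous_map (prod_topology (fst i) T) (fst i) (\<lambda>(x, g). snd i x g)"
        using If[OF i] by (simp add: flow_def)
      show "continuous_map (prod_topology (product_topology fst I) T) (fst i)
              (\<lambda>x. (case x of (x, g) \<Rightarrow> p x g) i)"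
        using continuous_map_compose[OF 1 2] i
        by (simp add: o_def p_def case_prod_unfold P_def)
    qed
    fix x assume x: "x \<in> topspace P"
    have xi: "x i \<in> topspace (fst i)" if "i \<in> I" for i
      using PiE_mem[OF x[unfolded tP] that] .
    show "p x \<one>\<^bsub>G\<^esub> = x"
    proof
      fix i show "p x \<one>\<^bsub>G\<^esub> i = x i"
      proof (cases "i \<in> I")
        case True
        then show ?thesis
          using I1[OF True xi[OF True]] by (simp add: p_def)
      next
        case False
        then show ?thesis
          using PiE_arb[OF x[unfolded tP] False] by (simp add: p_def)
      qed
    qed
    fix g h assume gh: "g \<in> carrier G" "h \<in> carrier G"
    show "p (p x g) h = p x (g \<otimes>\<^bsub>G\<^esub> h)"
    proof
      fix i show "p (p x g) h i = p x (g \<otimes>\<^bsub>G\<^esub> h) i"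
      proof (cases "i \<in> I")
        case True
        then show ?thesis
          using Im[OF True xi[OF True] gh] by (simp add: p_def)
      qed (simp add: p_def)
    qed
  qed
  then obtain Z where Z: "Z \<subseteq> topspace P" "minimal_flow G T (subtopology P Z) p"
    using minimal_subflow_exists[OF G] by blast
  obtain X :: "'g set set topology" and a f f' where X: "minimal_flow G T X a"
    "flow_map G X a (subtopology P Z) p f'"
    using minimal_flow_small_copy[OF G'(2) Z(2)] by blast
  have "is_universal_minimal_flow G T X a"
    unfolding is_universal_minimal_flow_def
  proof (intro conjI allI impI)
    show "minimal_flow G T X a" by fact
    fix Y :: "'g set set topology" and b
    assume Y: "minimal_flow G T Y b"
    then have i: "(Y, b) \<in> I"
      by (simp add: I_def)
    have f': "continuous_map X P f'"
      using X(2) by (simp add: flow_map_def continuous_map_in_subtopology)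
    have "flow_map G X a Y b (\<lambda>x. f' x (Y, b))"
      unfolding flow_map_def
    proof (intro conjI ballI)
      show "continuous_map X Y (\<lambda>x. f' x (Y, b))"
        using continuous_map_compose[OF f' proj[OF i]] by (simp add: o_def)
      fix x g assume "x \<in> topspace X" "g \<in> carrier G"
      then show "f' (a x g) (Y, b) = b (f' x (Y, b)) g"
        using X(2) i by (simp add: flow_map_def p_def)
    qed
    moreover from this have "(\<lambda>x. f' x (Y, b)) ` topspace X = topspace Y"
      using X(1) by (intro flow_map_onto_minimal[OF G' _ Y]) (simp_all add: minimal_flow_def)
    ultimately show "\<exists>f. flow_map G X a Y b f \<and> f ` topspace X = topspace Y"
      by (intro exI conjI)
  qed
  then show ?thesis
    by blast
qed

lemma is_universal_minimal_flow_UMF: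
  fixes G :: "('g, 'm) monoid_scheme" and T :: "'g topology"
  assumes "topological_group G T"
  shows "is_universal_minimal_flow G T (fst (UMF G T)) (snd (UMF G T))"
proof -
  have "\<exists>F :: 'g set set topology \<times> ('g set set \<Rightarrow> 'g \<Rightarrow> 'g set set).
          is_universal_minimal_flow G T (fst F) (snd F)"
    using universal_minimal_flow_exists[OF assms] by simp
  then show ?thesis
    unfolding UMF_def by (rule someI_ex)
qed

end

theory Submission
  imports Defs
begin

text \<open>Invariant regular Borel probability measures on a compact Hausdorff flow are the same as
  invariant positive normalized functionals (states) on its continuous functions. Let \<open>X\<close> be the
  universal minimal flow of \<open>G\<close> and \<open>U\<close> that of \<open>H\<close>, with unique invariant state \<open>m\<close>.

  Because \<open>U\<close> is metrizable, the \<open>H\<close>-maps \<open>U \<rightarrow> X\<close> obtained by extending the orbit maps of \<open>X\<close> to the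
  greatest ambit of \<open>H\<close> are equicontinuous: a convergent sequence in the greatest ambit converges
  uniformly on every equi-uniform family of functions. Their pointwise closure is therefore a compact
  set of \<open>H\<close>-maps on which evaluation is jointly continuous, so the points of \<open>X\<close> in minimal
  \<open>H\<close>-subflows form a closed set. It is \<open>G\<close>-invariant as \<open>H\<close> is normal, hence all of \<open>X\<close>. Every such
  subflow is an image of \<open>U\<close> and, \<open>H\<close> being amenable, uniquely ergodic; averaging over the subflows
  gives a conditional expectation of the continuous functions on \<open>X\<close> onto the \<open>H\<close>-invariant ones,
  which preserves every \<open>H\<close>-invariant state. So \<open>G\<close>-invariant states on \<open>X\<close> are determined by their
  restrictions to the \<open>H\<close>-invariant functions, and on these unique ergodicity of \<open>G/H\<close> gives existence
  and uniqueness.\<close>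

section \<open>States\<close>

text \<open>\<open>X\<close> is not known to be metrizable and its minimal \<open>H\<close>-subflows
  come with no measurable parametrization, so no measure is disintegrated. Only positive functionals
  occur, on function spaces that may contain discontinuous functions; the set of orbit maps even
  loses its topology when a state on \<open>X\<close> is lifted to pairs (orbit map, point of
  \<open>U\<close>). Such lifts come from a Hahn-Banach extension, which destroys invariance;
  averaging the translates with an invariant mean on the bounded uniformly continuous functions of
  the group restores it. The mean comes from \<open>m\<close>: unique ergodicity includes existence,
  hence amenability. Equicontinuity is a statement about sequences. If it failed along
  \<open>w n\<close> tending to \<open>u\<close>, normalized functions \<open>F n\<close> would have
  value 1 at \<open>w n\<close> while each fixed \<open>F j\<close> tends to 0 along the sequence.
  The supremum of every other disjointified bump is then one uniformly continuous function whose
  values at the \<open>w n\<close> oscillate, although it is continuous on \<open>U\<close>.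
  Normality of \<open>H\<close> is used a second time to make the averages over
  \<open>H\<close>-subflows commute with translations by \<open>G\<close>.\<close>

definition cfun :: "'x topology \<Rightarrow> ('x \<Rightarrow> real) set" where
  "cfun X = {f. continuous_map X euclideanreal f}"

definition fun_space :: "('x \<Rightarrow> real) set \<Rightarrow> bool" where
  "fun_space V \<longleftrightarrow> (\<forall>f\<in>V. \<forall>g\<in>V. (\<lambda>x. f x + g x) \<in> V) \<and> (\<forall>c. \<forall>f\<in>V. (\<lambda>x. c * f x) \<in> V) \<and>
     (\<forall>c. (\<lambda>_. c) \<in> V)"

text \<open>Functions are total, and their values off \<open>D\<close> are unconstrained. Testing
  positivity on \<open>D\<close> only makes a state blind to them (\<open>state_cong\<close>). The
  space \<open>V\<close> is a parameter because one functional is restricted to smaller spaces and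
  extended to larger ones.\<close>

definition state :: "'x set \<Rightarrow> ('x \<Rightarrow> real) set \<Rightarrow> (('x \<Rightarrow> real) \<Rightarrow> real) \<Rightarrow> bool" where
  "state D V I \<longleftrightarrow> fun_space V \<and>
     (\<forall>f\<in>V. \<forall>g\<in>V. I (\<lambda>x. f x + g x) = I f + I g) \<and> (\<forall>c. \<forall>f\<in>V. I (\<lambda>x. c * f x) = c * I f) \<and>
     (\<forall>f\<in>V. (\<forall>x\<in>D. 0 \<le> f x) \<longrightarrow> 0 \<le> I f) \<and> I (\<lambda>_. 1) = 1"

lemma fun_space_add: "fun_space V \<Longrightarrow> f \<in> V \<Longrightarrow> g \<in> V \<Longrightarrow> (\<lambda>x. f x + g x) \<in> V"
  and fun_space_scale: "fun_space V \<Longrightarrow> f \<in> V \<Longrightarrow> (\<lambda>x. c * f x) \<in> V"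
  and fun_space_const: "fun_space V \<Longrightarrow> (\<lambda>_. c) \<in> V"
  by (auto simp: fun_space_def)

lemma fun_space_diff:
  assumes "fun_space V" "f \<in> V" "g \<in> V"
  shows "(\<lambda>x. f x - g x) \<in> V"
  using fun_space_add[OF assms(1,2) fun_space_scale[OF assms(1,3), of "-1"]] by simp

lemma fun_space_sum:
  assumes "fun_space V" "\<And>i. i \<in> J \<Longrightarrow> f i \<in> V"
  shows "(\<lambda>x. \<Sum>i\<in>J. f i x) \<in> V"
  using assms(2)
proof (induction J rule: infinite_finite_induct)
  case (insert j J)
  then have "(\<lambda>x. f j x + (\<Sum>i\<in>J. f i x)) \<in> V"
    by (intro fun_space_add[OF assms(1)]) auto
  then show ?case
    using insert by simp
qed (auto intro: fun_space_const[OF assms(1)])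

lemma fun_space_cfun: "fun_space (cfun X)"
  by (auto simp: fun_space_def cfun_def intro: continuous_map_add continuous_map_real_mult)

lemma state_space: "state D V I \<Longrightarrow> fun_space V"
  and state_add: "state D V I \<Longrightarrow> f \<in> V \<Longrightarrow> g \<in> V \<Longrightarrow> I (\<lambda>x. f x + g x) = I f + I g"
  and state_scale: "state D V I \<Longrightarrow> f \<in> V \<Longrightarrow> I (\<lambda>x. c * f x) = c * I f"
  and state_nonneg: "state D V I \<Longrightarrow> f \<in> V \<Longrightarrow> (\<And>x. x \<in> D \<Longrightarrow> 0 \<le> f x) \<Longrightarrow> 0 \<le> I f"
  and state_one: "state D V I \<Longrightarrow> I (\<lambda>_. 1) = 1"
  by (auto simp: state_def)

lemma state_const: "state D V I \<Longrightarrow> I (\<lambda>_. c) = c"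
  using state_scale[of D V I "\<lambda>_. 1" c] state_one[of D V I] fun_space_const[OF state_space, of D V I 1]
  by simp

lemma state_diff:
  assumes "state D V I" "f \<in> V" "g \<in> V"
  shows "I (\<lambda>x. f x - g x) = I f - I g"
  using state_add[OF assms(1,2) fun_space_scale[OF state_space[OF assms(1)] assms(3), of "-1"]]
    state_scale[OF assms(1,3), of "-1"] by simp

lemma state_mono:
  assumes "state D V I" "f \<in> V" "g \<in> V" "\<And>x. x \<in> D \<Longrightarrow> f x \<le> g x"
  shows "I f \<le> I g"
  using state_nonneg[OF assms(1) fun_space_diff[OF state_space[OF assms(1)] assms(3,2)]]
    state_diff[OF assms(1,3,2)] assms(4) by simp

lemma state_cong:
  assumes "state D V I" "f \<in> V" "g \<in> V" "\<And>x. x \<in> D \<Longrightarrow> f x = g x"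
  shows "I f = I g"
  using state_mono[OF assms(1-3)] state_mono[OF assms(1,3,2)] assms(4) by fastforce

lemma state_le_const:
  assumes "state D V I" "f \<in> V" "\<And>x. x \<in> D \<Longrightarrow> f x \<le> c"
  shows "I f \<le> c"
  using state_mono[OF assms(1,2) fun_space_const[OF state_space[OF assms(1)]] assms(3)]
    state_const[OF assms(1)] by simp

lemma state_ge_const:
  assumes "state D V I" "f \<in> V" "\<And>x. x \<in> D \<Longrightarrow> c \<le> f x"
  shows "c \<le> I f"
  using state_mono[OF assms(1) fun_space_const[OF state_space[OF assms(1)]] assms(2,3)]
    state_const[OF assms(1)] by simp

lemma state_dist_le:
  assumes "state D V I" "f \<in> V" "g \<in> V" "\<And>x. x \<in> D \<Longrightarrow> \<bar>f x - g x\<bar> \<le> e"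
  shows "\<bar>I f - I g\<bar> \<le> e"
proof -
  note d = fun_space_diff[OF state_space[OF assms(1)] assms(2,3)]
  have "f x - g x \<le> e" "- e \<le> f x - g x" if "x \<in> D" for x
    using assms(4)[OF that] by auto
  then show ?thesis
    using state_le_const[OF assms(1) d, of e] state_ge_const[OF assms(1) d, of "- e"]
      state_diff[OF assms(1-3)] by fastforce
qed

lemma state_sum:
  assumes "state D V I" "\<And>i. i \<in> J \<Longrightarrow> f i \<in> V"
  shows "I (\<lambda>x. \<Sum>i\<in>J. f i x) = (\<Sum>i\<in>J. I (f i))"
  using assms(2)
proof (induction J rule: infinite_finite_induct)
  case (insert j J)
  then have "I (\<lambda>x. f j x + (\<Sum>i\<in>J. f i x)) = I (f j) + I (\<lambda>x. \<Sum>i\<in>J. f i x)"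
    by (intro state_add[OF assms(1)] fun_space_sum[OF state_space[OF assms(1)]]) auto
  then show ?case
    using insert by simp
qed (use state_const[OF assms(1), of 0] in auto)

lemma state_point: "x \<in> D \<Longrightarrow> fun_space V \<Longrightarrow> state D V (\<lambda>f. f x)"
  by (simp add: state_def)

text \<open>Integrating a family of states against a state. Linearity of \<open>\<Phi>\<close> holds
  only at the points of \<open>D\<close>, which suffices because \<open>I\<close> does not see the
  rest.\<close>

lemma state_compose:
  assumes I: "state D V I" and W: "fun_space W" and V: "\<And>f. f \<in> W \<Longrightarrow> \<Phi> f \<in> V"
    and pt: "\<And>x. x \<in> D \<Longrightarrow> state E W (\<lambda>f. \<Phi> f x)"
  shows "state E W (\<lambda>f. I (\<Phi> f))"
  unfolding state_def
proof (intro conjI ballI allI impI W)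
  fix f g assume fg: "f \<in> W" "g \<in> W"
  have "I (\<Phi> (\<lambda>x. f x + g x)) = I (\<lambda>x. \<Phi> f x + \<Phi> g x)"
    by (rule state_cong[OF I V[OF fun_space_add[OF W fg]] fun_space_add[OF state_space[OF I] V[OF fg(1)] V[OF fg(2)]]])
      (rule state_add[OF pt fg])
  then show "I (\<Phi> (\<lambda>x. f x + g x)) = I (\<Phi> f) + I (\<Phi> g)"
    using state_add[OF I V[OF fg(1)] V[OF fg(2)]] by simp
next
  fix c f assume f: "f \<in> W"
  have "I (\<Phi> (\<lambda>x. c * f x)) = I (\<lambda>x. c * \<Phi> f x)"
    by (rule state_cong[OF I V[OF fun_space_scale[OF W f]] fun_space_scale[OF state_space[OF I] V[OF f]]])
      (rule state_scale[OF pt f])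
  then show "I (\<Phi> (\<lambda>x. c * f x)) = c * I (\<Phi> f)"
    using state_scale[OF I V[OF f]] by simp
next
  fix f assume "f \<in> W" "\<forall>x\<in>E. 0 \<le> f x"
  then show "0 \<le> I (\<Phi> f)"
    by (intro state_nonneg[OF I V] state_nonneg[OF pt]) auto
next
  have "I (\<Phi> (\<lambda>_. 1)) = I (\<lambda>_. 1)"
    by (rule state_cong[OF I V[OF fun_space_const[OF W]] fun_space_const[OF state_space[OF I]]])
      (rule state_one[OF pt])
  then show "I (\<Phi> (\<lambda>_. 1)) = 1"
    by (simp add: state_one[OF I])
qed

lemma state_pullback:
  assumes I: "state D V I" and W: "fun_space W"
    and V: "\<And>f. f \<in> W \<Longrightarrow> (\<lambda>z. f (k z)) \<in> V" and k: "\<And>z. z \<in> D \<Longrightarrow> k z \<in> E"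
  shows "state E W (\<lambda>f. I (\<lambda>z. f (k z)))"
  by (rule state_compose[where \<Phi> = "\<lambda>f z. f (k z)", OF I W V state_point[OF k W]])

lemma real_eq_by_dist:
  fixes x y :: real
  assumes "\<And>e. e > 0 \<Longrightarrow> \<bar>x - y\<bar> \<le> e"
  shows "x = y"
  using field_le_epsilon[of "\<bar>x - y\<bar>" 0] assms by simp

lemma closedin_level: "f \<in> cfun X \<Longrightarrow> closedin X {x \<in> topspace X. e \<le> f x}"
  using closedin_continuous_map_preimage[of X euclideanreal f "{e..}"] by (simp add: cfun_def)

lemma openin_level: "f \<in> cfun X \<Longrightarrow> openin X {x \<in> topspace X. e < f x}"
  using openin_continuous_map_preimage[of X euclideanreal f "{e<..}"] by (simp add: cfun_def)

text \<open>In a compact Hausdorff space the complement of a compact set is open, so inner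
  approximation of the complement of \<open>B\<close> is outer approximation of \<open>B\<close>.
  Only the inner condition has to be checked.\<close>

lemma regular_borel_probI:
  assumes X: "compact_space X" "Hausdorff_space X"
    and \<nu>: "prob_space \<nu>" "sets \<nu> = sets (borel_of X)"
    and inner: "\<And>B e. B \<in> sets \<nu> \<Longrightarrow> e > 0 \<Longrightarrow>
      \<exists>C. compactin X C \<and> C \<subseteq> B \<and> emeasure \<nu> B \<le> emeasure \<nu> C + ennreal e"
  shows "regular_borel_prob X \<nu>"
proof -
  interpret \<nu>: prob_space \<nu> by fact
  have Pow: "{U. openin X U} \<subseteq> Pow (topspace X)"
    by (auto dest: openin_subset)
  have s: "sets \<nu> = sigma_sets (topspace X) {U. openin X U}" and sp: "space \<nu> = topspace X"
    using \<nu>(2) sets_eq_imp_space_eq[OF \<nu>(2)] Pow by (auto simp: borel_of_def space_measure_of_conv)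
  have closed_sets: "C \<in> sets \<nu>" if "closedin X C" for C
  proof -
    have "topspace X - C \<in> sets \<nu>"
      using that by (auto simp: s)
    from sets.compl_sets[OF this] show ?thesis
      using closedin_subset[OF that] by (simp add: sp double_diff)
  qed
  have inner': "emeasure \<nu> B = (SUP C\<in>{C. compactin X C \<and> C \<subseteq> B}. emeasure \<nu> C)" if B: "B \<in> sets \<nu>" for B
  proof (rule antisym)
    show "emeasure \<nu> B \<le> (SUP C\<in>{C. compactin X C \<and> C \<subseteq> B}. emeasure \<nu> C)"
    proof (rule ennreal_le_epsilon)
      fix e :: real assume "0 < e"
      then obtain C where C: "compactin X C" "C \<subseteq> B" "emeasure \<nu> B \<le> emeasure \<nu> C + ennreal e"
        using inner[OF B] by blast
      have "emeasure \<nu> C \<le> (SUP C\<in>{C. compactin X C \<and> C \<subseteq> B}. emeasure \<nu> C)"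
        using C by (intro SUP_upper) auto
      with C(3) show "emeasure \<nu> B \<le> (SUP C\<in>{C. compactin X C \<and> C \<subseteq> B}. emeasure \<nu> C) + ennreal e"
        by (meson add_right_mono order_trans)
    qed
  qed (use B in \<open>auto intro!: SUP_least emeasure_mono\<close>)
  have outer: "emeasure \<nu> B = (INF U\<in>{U. openin X U \<and> B \<subseteq> U}. emeasure \<nu> U)" if B: "B \<in> sets \<nu>" for B
  proof (rule antisym)
    show "emeasure \<nu> B \<le> (INF U\<in>{U. openin X U \<and> B \<subseteq> U}. emeasure \<nu> U)"
      by (auto intro!: INF_greatest emeasure_mono simp: s)
    show "(INF U\<in>{U. openin X U \<and> B \<subseteq> U}. emeasure \<nu> U) \<le> emeasure \<nu> B"
    proof (rule ennreal_le_epsilon)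
      fix e :: real assume e: "0 < e"
      have B': "topspace X - B \<in> sets \<nu>"
        using sets.compl_sets[OF B] by (simp add: sp)
      obtain C where C: "compactin X C" "C \<subseteq> topspace X - B" "emeasure \<nu> (topspace X - B) \<le> emeasure \<nu> C + ennreal e"
        using inner[OF B' e] by blast
      have Cs: "closedin X C"
        using C(1) X(2) compactin_imp_closedin by blast
      have "measure \<nu> (topspace X - B) \<le> measure \<nu> C + e"
        using C(3) e by (simp add: \<nu>.emeasure_eq_measure flip: ennreal_plus)
      then have "measure \<nu> (topspace X - C) \<le> measure \<nu> B + e"
        using \<nu>.prob_compl[of B] \<nu>.prob_compl[of C] B closed_sets[OF Cs] sp by simp
      then have "emeasure \<nu> (topspace X - C) \<le> emeasure \<nu> B + ennreal e"
        using e by (simp add: \<nu>.emeasure_eq_measure flip: ennreal_plus)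
      moreover have "(INF U\<in>{U. openin X U \<and> B \<subseteq> U}. emeasure \<nu> U) \<le> emeasure \<nu> (topspace X - C)"
        using Cs C(2) sets.sets_into_space[OF B] sp by (intro INF_lower) auto
      ultimately show "(INF U\<in>{U. openin X U \<and> B \<subseteq> U}. emeasure \<nu> U) \<le> emeasure \<nu> B + ennreal e"
        by (rule order_trans[rotated])
    qed
  qed
  show ?thesis
    unfolding regular_borel_prob_def using \<nu> inner' outer by blast
qed

section \<open>The Riesz representation theorem on a compact Hausdorff space\<close>

locale compact_state =
  fixes X :: "'x topology" and I :: "('x \<Rightarrow> real) \<Rightarrow> real"
  assumes compact: "compact_space X" and Hausdorff: "Hausdorff_space X"
    and state: "state (topspace X) (cfun X) I"
begin

text \<open>Vanishing off \<open>U\<close> replaces the usual support condition. Truncating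
  \<open>f\<close> to \<open>max 0 (f - e)\<close> costs at most \<open>e\<close> and makes it
  vanish off the closed set where \<open>e \<le> f\<close>, which lies inside
  \<open>U\<close>.\<close>

definition below :: "'x set \<Rightarrow> ('x \<Rightarrow> real) set" where
  "below U = {f \<in> cfun X. (\<forall>x\<in>topspace X. 0 \<le> f x \<and> f x \<le> 1) \<and> (\<forall>x\<in>topspace X - U. f x = 0)}"

definition content :: "'x set \<Rightarrow> ennreal" where
  "content U = (SUP f\<in>below U. ennreal (I f))"

definition outer :: "'x set \<Rightarrow> ennreal" where
  "outer A = (INF U\<in>{U. openin X U \<and> A \<subseteq> U}. content U)"

lemma normal: "normal_space X"
  using compact Hausdorff compact_Hausdorff_or_regular_imp_normal_space by blast

lemma below_cfun: "f \<in> below U \<Longrightarrow> f \<in> cfun X"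
  by (simp add: below_def)

lemma content_ge: "f \<in> below U \<Longrightarrow> ennreal (I f) \<le> content U"
  unfolding content_def by (rule SUP_upper)

lemma zero_below: "(\<lambda>_. 0) \<in> below U"
  by (auto simp: below_def intro: fun_space_const[OF fun_space_cfun])

lemma content_empty: "content {} = 0"
proof -
  have "I f = 0" if "f \<in> below {}" for f
    using state_cong[OF state below_cfun[OF that] below_cfun[OF zero_below]] that
      state_const[OF state, of 0] by (auto simp: below_def)
  then show ?thesis
    unfolding content_def using zero_below by (auto intro!: antisym SUP_least)
qed

lemma content_mono: "U \<subseteq> W \<Longrightarrow> content U \<le> content W"
  unfolding content_def by (rule SUP_subset_mono) (auto simp: below_def)

lemma content_top: "content (topspace X) = 1"
proof (rule antisym)
  show "content (topspace X) \<le> 1"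
    unfolding content_def
  proof (rule SUP_least)
    fix f assume "f \<in> below (topspace X)"
    then show "ennreal (I f) \<le> 1"
      using state_le_const[OF state, of f 1] by (auto simp: below_def)
  qed
  have "(\<lambda>_. 1) \<in> below (topspace X)"
    by (auto simp: below_def intro: fun_space_const[OF fun_space_cfun])
  from content_ge[OF this] show "1 \<le> content (topspace X)"
    by (simp add: state_one[OF state])
qed

lemma content_le1: "openin X U \<Longrightarrow> content U \<le> 1"
  using content_mono[OF openin_subset] content_top by metis

lemma cfun_truncate: "f \<in> cfun X \<Longrightarrow> (\<lambda>x. max 0 (f x - c)) \<in> cfun X"
  unfolding cfun_def mem_Collect_eq by (intro continuous_intros continuous_map_real_max) auto

lemma below_truncate:
  assumes "f \<in> below U" "e > 0"
  shows "(\<lambda>x. max 0 (f x - e)) \<in> below U" "I f \<le> I (\<lambda>x. max 0 (f x - e)) + e"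
proof -
  note c = cfun_truncate[OF below_cfun[OF assms(1)], of e]
  have "f x - e \<le> 1" if "x \<in> topspace X" for x
    using assms that unfolding below_def by force
  then show "(\<lambda>x. max 0 (f x - e)) \<in> below U"
    using assms c by (auto simp: below_def)
  have "I f \<le> I (\<lambda>x. max 0 (f x - e) + e)"
    by (rule state_mono[OF state below_cfun[OF assms(1)]
          fun_space_add[OF fun_space_cfun c fun_space_const[OF fun_space_cfun]]]) simp
  then show "I f \<le> I (\<lambda>x. max 0 (f x - e)) + e"
    by (simp add: state_add[OF state c fun_space_const[OF fun_space_cfun]] state_const[OF state])
qed

text \<open>A partition of unity with two members. On the compact set \<open>K\<close> that carries
  the truncated function, the Urysohn function \<open>s\<close> is 0 off \<open>U\<close> and 1 off
  \<open>W\<close>, so \<open>g * s\<close> lives in \<open>U\<close> and \<open>g * (1 - s)\<close>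
  lives in \<open>W\<close>.\<close>

lemma content_Un:
  assumes "openin X U" "openin X W"
  shows "content (U \<union> W) \<le> content U + content W"
  unfolding content_def[of "U \<union> W"]
proof (rule SUP_least, rule ennreal_le_epsilon)
  fix f and e :: real assume f: "f \<in> below (U \<union> W)" and e: "e > 0"
  define K where "K = {x \<in> topspace X. e \<le> f x}"
  have K: "closedin X K"
    unfolding K_def using f by (intro closedin_level below_cfun)
  have "K \<subseteq> U \<union> W"
    using f e by (force simp: K_def below_def)
  then have "disjnt (K - U) (K - W)" "closedin X (K - U)" "closedin X (K - W)"
    using K assms by (auto simp: disjnt_def)
  then obtain s where s: "continuous_map X (top_of_set {0..1::real}) s" "s ` (K - U) \<subseteq> {0}" "s ` (K - W) \<subseteq> {1}"
    using Urysohn_lemma[OF normal, of "K - U" "K - W" 0 1] by auto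
  have sc: "s \<in> cfun X" and s01: "\<And>x. x \<in> topspace X \<Longrightarrow> 0 \<le> s x \<and> s x \<le> 1"
    using s(1) by (auto simp: cfun_def continuous_map_in_subtopology Pi_iff image_subset_iff)
  define g where "g = (\<lambda>x. max 0 (f x - e))"
  have g: "g \<in> below (U \<union> W)" "I f \<le> I g + e"
    using below_truncate[OF f e] by (auto simp: g_def)
  have gK: "g x = 0" if "x \<in> topspace X" "x \<notin> K" for x
    using that by (auto simp: g_def K_def)
  have c1: "(\<lambda>x. g x * s x) \<in> cfun X" and c2: "(\<lambda>x. g x * (1 - s x)) \<in> cfun X"
    using below_cfun[OF g(1)] sc unfolding cfun_def mem_Collect_eq
    by (intro continuous_map_real_mult continuous_map_diff; simp)+
  have g01: "0 \<le> g x \<and> g x \<le> 1" if "x \<in> topspace X" for x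
    using g(1) that by (auto simp: below_def)
  have b1: "(\<lambda>x. g x * s x) \<in> below U"
    unfolding below_def using c1 g01 s01 gK s(2) by (force intro: mult_le_one simp: image_subset_iff)
  have b2: "(\<lambda>x. g x * (1 - s x)) \<in> below W"
    unfolding below_def using c2 g01 s01 gK s(3) by (force intro: mult_le_one simp: image_subset_iff)
  have "I g = I (\<lambda>x. g x * s x + g x * (1 - s x))"
    by (simp add: algebra_simps)
  also have "\<dots> = I (\<lambda>x. g x * s x) + I (\<lambda>x. g x * (1 - s x))"
    by (rule state_add[OF state c1 c2])
  finally have "ennreal (I f) \<le> ennreal (I (\<lambda>x. g x * s x) + I (\<lambda>x. g x * (1 - s x)) + e)"
    using g(2) by (intro ennreal_leI) simp
  also have "\<dots> = ennreal (I (\<lambda>x. g x * s x)) + ennreal (I (\<lambda>x. g x * (1 - s x))) + ennreal e"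
    using state_nonneg[OF state c1] state_nonneg[OF state c2] g01 s01 e by simp
  also have "\<dots> \<le> content U + content W + ennreal e"
    by (intro add_mono content_ge b1 b2 order_refl)
  finally show "ennreal (I f) \<le> content U + content W + ennreal e" .
qed

lemma content_finite_UN:
  fixes U :: "nat \<Rightarrow> 'x set"
  assumes "\<And>n. openin X (U n)"
  shows "content (\<Union>i<n. U i) \<le> (\<Sum>i<n. content (U i))"
proof (induction n)
  case (Suc n)
  have "content (\<Union>i<Suc n. U i) \<le> content (\<Union>i<n. U i) + content (U n)"
    using content_Un[of "\<Union>i<n. U i" "U n"] openin_Union[of "U ` {..<n}" X] assms
    by (auto simp: lessThan_Suc Un_commute)
  also have "\<dots> \<le> (\<Sum>i<n. content (U i)) + content (U n)"
    using Suc by (rule add_right_mono)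
  finally show ?case
    by simp
qed (simp add: content_empty)

text \<open>After truncation only a compact level set matters, and finitely many of the
  \<open>U n\<close> cover it.\<close>

lemma content_UN:
  fixes U :: "nat \<Rightarrow> 'x set"
  assumes U: "\<And>n. openin X (U n)"
  shows "content (\<Union>n. U n) \<le> (\<Sum>n. content (U n))"
  unfolding content_def[of "\<Union>n. U n"]
proof (rule SUP_least, rule ennreal_le_epsilon)
  fix f and e :: real assume f: "f \<in> below (\<Union>n. U n)" and e: "e > 0"
  define K where "K = {x \<in> topspace X. e \<le> f x}"
  have "compactin X K"
    unfolding K_def using f by (intro closedin_compact_space[OF compact] closedin_level below_cfun)
  moreover have "K \<subseteq> \<Union>(range U)"
    using f e by (force simp: K_def below_def)
  ultimately obtain \<F> where \<F>: "finite \<F>" "\<F> \<subseteq> range U" "K \<subseteq> \<Union>\<F>"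
    using U unfolding compactin_def by (metis (no_types, lifting) imageE)
  then obtain J where J: "finite J" "\<F> = U ` J"
    by (meson finite_subset_image)
  define N where "N = Suc (Max (insert 0 J))"
  have "j < N" if "j \<in> J" for j
    using J(1) that by (simp add: N_def less_Suc_eq_le)
  then have KN: "K \<subseteq> (\<Union>i<N. U i)"
    using \<F>(3) J(2) by blast
  have "(\<lambda>x. max 0 (f x - e)) \<in> below (\<Union>i<N. U i)"
    using below_truncate(1)[OF f e] KN unfolding below_def by (auto simp: K_def subset_iff)
  then have *: "ennreal (I (\<lambda>x. max 0 (f x - e))) \<le> content (\<Union>i<N. U i)"
    by (rule content_ge)
  have "0 \<le> I (\<lambda>x. max 0 (f x - e))"
    using below_cfun[OF f] by (intro state_nonneg[OF state] cfun_truncate) auto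
  then have "ennreal (I f) \<le> ennreal (I (\<lambda>x. max 0 (f x - e))) + ennreal e"
    using below_truncate(2)[OF f e] e by (simp flip: ennreal_plus)
  also have "\<dots> \<le> (\<Sum>i<N. content (U i)) + ennreal e"
    by (intro add_right_mono order_trans[OF *] content_finite_UN U)
  also have "\<dots> \<le> (\<Sum>i. content (U i)) + ennreal e"
    by (intro add_right_mono sum_le_suminf) auto
  finally show "ennreal (I f) \<le> (\<Sum>i. content (U i)) + ennreal e" .
qed

lemma outer_open: "openin X U \<Longrightarrow> outer U = content U"
  unfolding outer_def by (intro antisym INF_lower INF_greatest content_mono) auto

lemma outer_mono: "A \<subseteq> B \<Longrightarrow> outer A \<le> outer B"
  unfolding outer_def by (rule INF_superset_mono) auto

lemma outer_le1: "A \<subseteq> topspace X \<Longrightarrow> outer A \<le> 1"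
  using outer_mono[of A "topspace X"] outer_open[OF openin_topspace] content_top by simp

lemma outer_approx:
  assumes "A \<subseteq> topspace X" "e > 0"
  obtains U where "openin X U" "A \<subseteq> U" "content U < outer A + ennreal e"
proof -
  have "outer A < \<infinity>"
    using le_less_trans[OF outer_le1[OF assms(1)] ennreal_one_less_top] by simp
  then have "outer A < outer A + ennreal e"
    using assms(2) by (simp add: less_top)
  then obtain U where "openin X U" "A \<subseteq> U" "content U < outer A + ennreal e"
    unfolding outer_def[of A] INF_less_iff by auto
  then show ?thesis
    using that by blast
qed

lemma outer_measure_space: "outer_measure_space (Pow (topspace X)) outer"
  unfolding outer_measure_space_def
proof (intro conjI)
  show "positive (Pow (topspace X)) outer"
    by (simp add: positive_def outer_open content_empty)
  show "increasing (Pow (topspace X)) outer"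
    by (simp add: increasing_def outer_mono)
  show "countably_subadditive (Pow (topspace X)) outer"
    unfolding countably_subadditive_def
  proof (intro allI impI)
    fix A :: "nat \<Rightarrow> 'x set" assume A: "range A \<subseteq> Pow (topspace X)"
    show "outer (\<Union>i. A i) \<le> (\<Sum>i. outer (A i))"
    proof (rule ennreal_le_epsilon)
      fix e :: real assume e: "0 < e"
      have "\<exists>U. openin X U \<and> A n \<subseteq> U \<and> content U \<le> outer (A n) + ennreal (e * (1/2) ^ Suc n)" for n
        using outer_approx[of "A n" "e * (1/2) ^ Suc n"] A e
        by (metis PowD half_gt_zero_iff less_imp_le mult_pos_pos range_subsetD zero_less_one zero_less_power)
      then obtain U where U: "\<And>n. openin X (U n)" "\<And>n. A n \<subseteq> U n"
        "\<And>n. content (U n) \<le> outer (A n) + ennreal (e * (1/2) ^ Suc n)"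
        by metis
      have "outer (\<Union>i. A i) \<le> outer (\<Union>i. U i)"
        using U(2) by (intro outer_mono) blast
      also have "\<dots> = content (\<Union>i. U i)"
        using U(1) by (intro outer_open) blast
      also have "\<dots> \<le> (\<Sum>i. content (U i))"
        using U(1) by (rule content_UN)
      also have "\<dots> \<le> (\<Sum>n. outer (A n) + ennreal (e * (1/2) ^ Suc n))"
        using U(3) by (intro suminf_le) auto
      also have "\<dots> = (\<Sum>n. outer (A n)) + (\<Sum>n. ennreal e * ennreal ((1/2) ^ Suc n))"
        using \<open>0 < e\<close> by (subst suminf_add[symmetric])
          (auto simp del: ennreal_suminf_cmult simp add: ennreal_mult[symmetric])
      also have "\<dots> = (\<Sum>n. outer (A n)) + e"
        unfolding ennreal_suminf_cmult
        by (subst suminf_ennreal_eq[OF zero_le_power power_half_series]) auto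
      finally show "outer (\<Union>i. A i) \<le> (\<Sum>i. outer (A i)) + ennreal e" .
    qed
  qed
qed

text \<open>Caratheodory's condition for open sets. If \<open>f\<close> nearly exhausts
  \<open>U \<inter> W\<close> and \<open>g\<close> nearly exhausts \<open>U - K\<close>, where
  \<open>K\<close> carries the truncation of \<open>f\<close>, then the two have disjoint carriers
  and their sum is still admissible for \<open>U\<close>.\<close>

lemma outer_measurable:
  assumes W: "openin X W" and A: "A \<subseteq> topspace X"
  shows "outer (A \<inter> W) + outer (A - W) \<le> outer A"
proof (rule ennreal_le_epsilon)
  fix e :: real assume "0 < e"
  \<comment> \<open>Four losses share \<open>e\<close>: the choices of \<open>U\<close>,
    \<open>f\<close> and \<open>g\<close>, and the truncation of \<open>f\<close>.\<close>
  define d where "d = e / 4"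
  have d: "d > 0" "e = d + (d + d + d)"
    using \<open>0 < e\<close> by (auto simp: d_def)
  obtain U where U: "openin X U" "A \<subseteq> U" "content U < outer A + ennreal d"
    using outer_approx[OF A d(1)] .
  have pick: "\<exists>f\<in>below V. content V \<le> ennreal (I f) + ennreal d" if V: "openin X V" for V
  proof (rule ccontr)
    assume "\<not> ?thesis"
    then have *: "\<And>f. f \<in> below V \<Longrightarrow> ennreal (I f) + ennreal d \<le> content V"
      by (meson linear)
    have "content V + ennreal d \<le> content V"
      unfolding content_def[of V]
      by (subst ennreal_SUP_add_left[symmetric])
        (use zero_below * in \<open>auto intro!: SUP_least simp flip: content_def\<close>)
    moreover have "content V < \<infinity>"
      using le_less_trans[OF content_le1[OF V] ennreal_one_less_top] by simp
    ultimately show False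
      using d(1) by (metis add.commute ennreal_add_left_cancel_le add_0_right ennreal_less_zero_iff not_le less_top)
  qed
  obtain f where f: "f \<in> below (U \<inter> W)" "content (U \<inter> W) \<le> ennreal (I f) + ennreal d"
    using pick[of "U \<inter> W"] U(1) W by blast
  define K where "K = {x \<in> topspace X. d \<le> f x}"
  have K: "closedin X K"
    unfolding K_def using f by (intro closedin_level below_cfun)
  obtain g where g: "g \<in> below (U - K)" "content (U - K) \<le> ennreal (I g) + ennreal d"
    using pick[of "U - K"] U(1) K by blast
  let ?f = "\<lambda>x. max 0 (f x - d)"
  note t = below_truncate[OF f(1) d(1)]
  have fg: "(\<lambda>x. ?f x + g x) \<in> below U"
  proof -
    have "?f x + g x \<le> 1 \<and> 0 \<le> ?f x + g x" if "x \<in> topspace X" for x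
      using t(1) g(1) that by (cases "x \<in> K") (auto simp: below_def K_def)
    moreover have "?f x + g x = 0" if "x \<in> topspace X - U" for x
      using t(1) g(1) that by (auto simp: below_def)
    ultimately show ?thesis
      using fun_space_add[OF fun_space_cfun below_cfun[OF t(1)] below_cfun[OF g(1)]] by (simp add: below_def)
  qed
  have nn: "0 \<le> I ?f" "0 \<le> I g"
    using t(1) g(1) by (auto simp: below_def intro!: state_nonneg[OF state])
  have "outer (A \<inter> W) + outer (A - W) \<le> content (U \<inter> W) + content (U - K)"
  proof (rule add_mono)
    show "outer (A \<inter> W) \<le> content (U \<inter> W)"
      using U W outer_mono[of "A \<inter> W" "U \<inter> W"] outer_open[OF openin_Int[OF U(1) W]]
      by (metis Int_mono order_refl)
    have "K \<subseteq> W"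
      using f(1) d(1) by (force simp: K_def below_def)
    then show "outer (A - W) \<le> content (U - K)"
      using outer_mono[of "A - W" "U - K"] outer_open[OF openin_diff[OF U(1) K]] U(2) by (metis Diff_mono)
  qed
  also have "\<dots> \<le> (ennreal (I f) + ennreal d) + (ennreal (I g) + ennreal d)"
    by (intro add_mono f g)
  also have "\<dots> \<le> (ennreal (I ?f + d) + ennreal d) + (ennreal (I g) + ennreal d)"
    by (intro add_right_mono ennreal_leI t(2))
  also have "\<dots> = ennreal (I ?f + d + d + (I g + d))"
    using nn d(1) by (simp flip: ennreal_plus add: algebra_simps)
  also have "\<dots> = ennreal (I ?f + I g) + ennreal (d + d + d)"
    using nn d(1) by (simp flip: ennreal_plus add: algebra_simps)
  also have "I ?f + I g = I (\<lambda>x. ?f x + g x)"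
    by (rule state_add[OF state below_cfun[OF t(1)] below_cfun[OF g(1)], symmetric])
  also have "ennreal (I (\<lambda>x. ?f x + g x)) + ennreal (d + d + d) \<le> content U + ennreal (d + d + d)"
    by (intro add_right_mono content_ge fg)
  also have "\<dots> \<le> outer A + ennreal d + ennreal (d + d + d)"
    using U(3) by (intro add_right_mono) simp
  also have "\<dots> = outer A + ennreal e"
    using d by (simp add: add.assoc flip: ennreal_plus)
  finally show "outer (A \<inter> W) + outer (A - W) \<le> outer A + ennreal e" .
qed

definition riesz :: "'x measure" where
  "riesz = measure_of (topspace X) {U. openin X U} outer"

lemma open_Pow: "{U. openin X U} \<subseteq> Pow (topspace X)"
  by (auto dest: openin_subset)

lemma space_riesz: "space riesz = topspace X"
  and sets_riesz: "sets riesz = sigma_sets (topspace X) {U. openin X U}"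
  and sets_riesz_borel: "sets riesz = sets (borel_of X)"
  using open_Pow by (simp_all add: riesz_def borel_of_def space_measure_of_conv sets_measure_of)

text \<open>\<open>measure_of\<close> returns the zero measure unless \<open>outer\<close> is a
  measure on the generated sigma-algebra. Caratheodory makes it one on the lambda system, which
  contains the open sets by \<open>outer_measurable\<close> and hence all Borel sets.\<close>

lemma emeasure_riesz:
  assumes "A \<in> sets riesz"
  shows "emeasure riesz A = outer A"
proof -
  interpret pow: sigma_algebra "topspace X" "Pow (topspace X)"
    by (rule sigma_algebra_Pow)
  let ?L = "lambda_system (topspace X) (Pow (topspace X)) outer"
  have ms: "measure_space (topspace X) ?L outer"
    by (rule pow.caratheodory_lemma[OF outer_measure_space])
  have "U \<in> ?L" if U: "openin X U" for U
    unfolding pow.lambda_system_eq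
  proof (intro CollectI conjI ballI antisym)
    show "U \<in> Pow (topspace X)"
      using U openin_subset by auto
    fix A assume A: "A \<in> Pow (topspace X)"
    show "outer (A \<inter> U) + outer (A - U) \<le> outer A"
      using A by (intro outer_measurable[OF U]) auto
    have "subadditive (Pow (topspace X)) outer"
      using outer_measure_space pow.countably_subadditive_subadditive
      by (auto simp: outer_measure_space_def)
    then have "outer ((A \<inter> U) \<union> (A - U)) \<le> outer (A \<inter> U) + outer (A - U)"
      using A by (intro subadditiveD) auto
    then show "outer A \<le> outer (A \<inter> U) + outer (A - U)"
      by (simp add: Int_Diff_Un)
  qed
  moreover have sa: "sigma_algebra (topspace X) ?L"
    using ms by (simp add: measure_space_def)
  ultimately have sub: "sets riesz \<subseteq> ?L"
    unfolding sets_riesz by (intro sigma_algebra.sigma_sets_subset) auto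
  have "positive (sets riesz) outer" "countably_additive (sets riesz) outer"
    using ms sub unfolding measure_space_def positive_def countably_additive_def by blast+
  then show ?thesis
    using assms open_Pow unfolding riesz_def
    by (intro emeasure_measure_of[OF refl]) (auto simp flip: riesz_def)
qed

lemma open_sets_riesz: "openin X U \<Longrightarrow> U \<in> sets riesz"
  by (auto simp: sets_riesz)

lemma emeasure_riesz_open: "openin X U \<Longrightarrow> emeasure riesz U = content U"
  by (simp add: emeasure_riesz open_sets_riesz outer_open)

lemma prob_riesz: "prob_space riesz"
  by (rule prob_spaceI) (simp add: space_riesz emeasure_riesz_open content_top)

text \<open>The definition of \<open>outer\<close> gives an open set slightly larger than the
  complement of \<open>B\<close>; the complement of that open set is the compact set wanted inside
  \<open>B\<close>.\<close>

lemma regular_riesz: "regular_borel_prob X riesz"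
proof (rule regular_borel_probI[OF compact Hausdorff prob_riesz sets_riesz_borel])
  interpret prob_space riesz by (rule prob_riesz)
  fix B and e :: real assume B: "B \<in> sets riesz" and e: "0 < e"
  have sub: "B \<subseteq> topspace X"
    using sets.sets_into_space[OF B] by (simp add: space_riesz)
  let ?B = "topspace X - B"
  have B': "?B \<in> sets riesz"
    using sets.compl_sets[OF B] by (simp add: space_riesz)
  obtain U where U: "openin X U" "?B \<subseteq> U" "content U < outer ?B + ennreal e"
    using outer_approx[of ?B e] e by auto
  have Us: "U \<in> sets riesz"
    using U(1) by (rule open_sets_riesz)
  have "emeasure riesz U \<le> emeasure riesz ?B + ennreal e"
    using U B' by (simp add: emeasure_riesz_open emeasure_riesz[of ?B])
  then have mU: "measure riesz U \<le> measure riesz ?B + e"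
    using e by (simp add: emeasure_eq_measure flip: ennreal_plus)
  let ?C = "topspace X - U"
  have C: "compactin X ?C" "?C \<subseteq> B"
    using closedin_compact_space[OF compact] U by auto
  have "measure riesz ?C = 1 - measure riesz U" "measure riesz ?B = 1 - measure riesz B"
    using prob_compl[OF Us] prob_compl[OF B] by (simp_all add: space_riesz)
  then have "emeasure riesz B \<le> emeasure riesz ?C + ennreal e"
    using mU e by (simp add: emeasure_eq_measure flip: ennreal_plus)
  then show "\<exists>C. compactin X C \<and> C \<subseteq> B \<and> emeasure riesz B \<le> emeasure riesz C + ennreal e"
    using C by blast
qed

end


section \<open>Integrals of continuous functions against Borel probability measures\<close>

lemma cfun_measurable:
  assumes "sets \<mu> = sets (borel_of X)" "f \<in> cfun X"
  shows "f \<in> borel_measurable \<mu>"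
proof -
  have "{U. openin X U} \<subseteq> Pow (topspace X)"
    by (auto dest: openin_subset)
  then have s: "sets \<mu> = sigma_sets (topspace X) {U. openin X U}"
    and "space \<mu> = topspace X"
    using sets_eq_imp_space_eq[OF assms(1)] assms(1) by (auto simp: borel_of_def space_measure_of_conv)
  then show ?thesis
    unfolding borel_measurable_iff_greater using openin_level[OF assms(2)] by auto
qed

lemma cfun_bounded:
  assumes "compact_space X" "f \<in> cfun X"
  obtains B where "B > 0" "\<And>x. x \<in> topspace X \<Longrightarrow> \<bar>f x\<bar> \<le> B"
proof -
  have "compactin euclideanreal (f ` topspace X)"
    using assms image_compactin unfolding cfun_def compact_space_def by blast
  then have "bounded (f ` topspace X)"
    by (simp add: compact_imp_bounded)
  then show ?thesis
    using that by (auto simp: bounded_pos)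
qed

lemma cfun_integrable:
  assumes "prob_space \<mu>" "sets \<mu> = sets (borel_of X)" "compact_space X" "f \<in> cfun X"
  shows "integrable \<mu> f"
proof -
  interpret prob_space \<mu> by fact
  obtain B where B: "\<And>x. x \<in> topspace X \<Longrightarrow> \<bar>f x\<bar> \<le> B"
    using cfun_bounded[OF assms(3,4)] by blast
  have "space \<mu> = topspace X"
    using sets_eq_imp_space_eq[OF assms(2)] by (simp add: borel_of_def space_measure_of_conv)
  then show ?thesis
    using cfun_measurable[OF assms(2,4)] B by (intro integrable_const_bound[where B = B]) auto
qed

lemma state_integral:
  assumes "prob_space \<mu>" "sets \<mu> = sets (borel_of X)" "compact_space X"
  shows "state (topspace X) (cfun X) (\<lambda>f. \<integral>x. f x \<partial>\<mu>)"
proof -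
  interpret prob_space \<mu> by fact
  have "space \<mu> = topspace X"
    using sets_eq_imp_space_eq[OF assms(2)] by (simp add: borel_of_def space_measure_of_conv)
  then show ?thesis
    using cfun_integrable[OF assms]
    using prob_space by (auto simp: state_def fun_space_cfun intro!: integral_nonneg_AE)
qed

text \<open>Cuts a number into layers of height 1. With \<open>sum_below_count\<close> this replaces
  the layer-cake formula.\<close>

lemma sum_clamp:
  fixes t :: real
  shows "0 \<le> t \<Longrightarrow> (\<Sum>i<n. max 0 (min 1 (t - real i))) = min t (real n)"
  by (induction n) (auto simp: min_def max_def)

lemma sum_below_count:
  fixes t :: real
  assumes "0 \<le> t"
  shows "(\<Sum>i<n. if real i < t then 1 else 0 :: real) \<le> t + 1"
proof -
  have "(\<Sum>i<n. if real i < t then 1 else 0 :: real) \<le> min (real n) (t + 1)"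
    using assms by (induction n) (auto simp: min_def split: if_splits)
  then show ?thesis by simp
qed

context compact_state
begin

text \<open>\<open>n * f\<close> is the sum of its \<open>n\<close> unit layers \<open>k i\<close>.
  Each layer is admissible for the open set \<open>U i\<close>, so its state is at most the measure
  of \<open>U i\<close>. The indicators of the \<open>U i\<close> add up to at most
  \<open>n * f + 1\<close>; dividing by \<open>n\<close> leaves the error
  \<open>1 / n\<close>.\<close>

lemma riesz_ge_aux:
  assumes f: "f \<in> cfun X" "\<And>x. x \<in> topspace X \<Longrightarrow> 0 \<le> f x \<and> f x \<le> 1" and n: "n > 0"
  shows "I f \<le> (\<integral>x. f x \<partial>riesz) + 1 / real n"
proof -
  interpret prob_space riesz by (rule prob_riesz)
  define k where "k i = (\<lambda>x. max 0 (min 1 (real n * f x - real i)))" for i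
  define U where "U i = {x \<in> topspace X. real i / real n < f x}" for i
  have kc: "k i \<in> cfun X" for i
    using f(1) unfolding cfun_def k_def mem_Collect_eq
    by (intro continuous_map_real_max continuous_map_real_min continuous_map_diff continuous_map_real_mult) auto
  have U: "openin X (U i)" for i
    unfolding U_def using f(1) by (rule openin_level)
  have kb: "k i \<in> below (U i)" for i
    using kc n by (auto simp: below_def k_def U_def field_simps)
  have Ik: "I (k i) \<le> measure riesz (U i)" for i
  proof -
    have "ennreal (I (k i)) \<le> emeasure riesz (U i)"
      using content_ge[OF kb] by (simp add: emeasure_riesz_open U)
    then show ?thesis
      by (simp add: emeasure_eq_measure)
  qed
  have Uint: "integrable riesz (indicat_real (U i))" for i
    using open_sets_riesz[OF U] by (simp add: emeasure_eq_measure)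
  have fi: "integrable riesz f"
    by (rule cfun_integrable[OF prob_riesz sets_riesz_borel compact f(1)])
  have "real n * I f = I (\<lambda>x. real n * f x)"
    by (simp add: state_scale[OF state f(1)])
  also have "\<dots> = I (\<lambda>x. \<Sum>i<n. k i x)"
  proof (rule state_cong[OF state])
    show "(\<lambda>x. real n * f x) \<in> cfun X" "(\<lambda>x. \<Sum>i<n. k i x) \<in> cfun X"
      using kc f(1) by (auto intro: fun_space_scale fun_space_sum fun_space_cfun)
    fix x assume "x \<in> topspace X"
    then show "real n * f x = (\<Sum>i<n. k i x)"
      using f(2)[of x] by (simp add: k_def sum_clamp mult_left_le)
  qed
  also have "\<dots> = (\<Sum>i<n. I (k i))"
    by (rule state_sum[OF state kc])
  also have "\<dots> \<le> (\<Sum>i<n. measure riesz (U i))"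
    by (intro sum_mono Ik)
  also have "\<dots> = (\<integral>x. (\<Sum>i<n. indicator (U i) x) \<partial>riesz)"
    using Uint open_sets_riesz[OF U] by (subst Bochner_Integration.integral_sum) (auto intro!: sum.cong)
  also have "\<dots> \<le> (\<integral>x. real n * f x + 1 \<partial>riesz)"
  proof (rule integral_mono)
    show "integrable riesz (\<lambda>x. \<Sum>i<n. indicat_real (U i) x)"
      using Uint by (intro Bochner_Integration.integrable_sum)
    show "integrable riesz (\<lambda>x. real n * f x + 1)"
      using fi by simp
    fix x assume "x \<in> space riesz"
    then have x: "x \<in> topspace X" by (simp add: space_riesz)
    have "(\<Sum>i<n. indicat_real (U i) x) = (\<Sum>i<n. if real i < real n * f x then 1 else 0)"
      using x n by (intro sum.cong) (auto simp: U_def indicator_def field_simps)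
    also have "\<dots> \<le> real n * f x + 1"
      using f(2)[OF x] by (intro sum_below_count) simp
    finally show "(\<Sum>i<n. indicat_real (U i) x) \<le> real n * f x + 1" .
  qed
  also have "\<dots> = real n * (\<integral>x. f x \<partial>riesz) + 1"
    using fi by (simp add: prob_space)
  finally show ?thesis
    using n by (simp add: field_simps)
qed

lemma riesz_ge:
  assumes f: "f \<in> cfun X"
  shows "I f \<le> (\<integral>x. f x \<partial>riesz)"
proof -
  note state' = state_integral[OF prob_riesz sets_riesz_borel compact]
  obtain B where B: "B > 0" "\<And>x. x \<in> topspace X \<Longrightarrow> \<bar>f x\<bar> \<le> B"
    using cfun_bounded[OF compact f] by blast
  \<comment> \<open>An affine change of \<open>f\<close> into the range from 0 to 1; both
    functionals respect it.\<close>
  define g where "g = (\<lambda>x. 1 / (2 * B) * f x + 1 / 2)"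
  have g: "g \<in> cfun X"
    unfolding g_def by (intro fun_space_add fun_space_scale fun_space_const fun_space_cfun f)
  have g01: "0 \<le> g x \<and> g x \<le> 1" if "x \<in> topspace X" for x
    using B(2)[OF that] B(1) by (simp add: g_def field_simps abs_le_iff)
  have "I g \<le> (\<integral>x. g x \<partial>riesz)"
  proof (rule field_le_epsilon)
    fix e :: real assume "0 < e"
    then obtain n where "1 / real (Suc n) < e"
      using nat_approx_posE by blast
    then show "I g \<le> (\<integral>x. g x \<partial>riesz) + e"
      using riesz_ge_aux[OF g g01, of "Suc n"] by simp
  qed
  moreover have "I g = 1 / (2 * B) * I f + 1 / 2"
    unfolding g_def
    using state_add[OF state fun_space_scale[OF fun_space_cfun f] fun_space_const[OF fun_space_cfun]]
    by (simp add: state_const[OF state] state_scale[OF state f] del: times_divide_eq_left)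
  moreover have "(\<integral>x. g x \<partial>riesz) = 1 / (2 * B) * (\<integral>x. f x \<partial>riesz) + 1 / 2"
    unfolding g_def
    using state_add[OF state' fun_space_scale[OF fun_space_cfun f] fun_space_const[OF fun_space_cfun]]
    by (simp only: state_const[OF state'] state_scale[OF state' f])
  ultimately show ?thesis
    using B(1) by (simp add: divide_le_cancel)
qed

lemma integral_riesz:
  assumes f: "f \<in> cfun X"
  shows "(\<integral>x. f x \<partial>riesz) = I f"
proof (rule antisym)
  \<comment> \<open>The inequality \<open>riesz_ge\<close> is one-sided for every \<open>f\<close>,
    so its instance at \<open>- f\<close> is the converse.\<close>
  have "(\<lambda>x. -1 * f x) \<in> cfun X"
    using fun_space_scale[OF fun_space_cfun f] .
  from riesz_ge[OF this] show "(\<integral>x. f x \<partial>riesz) \<le> I f"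
    by (simp only: state_scale[OF state f]) simp
qed (rule riesz_ge[OF f])

end

text \<open>A Urysohn function between a compact \<open>C\<close> and an open \<open>U\<close>
  around it bounds the first measure of \<open>C\<close> by the second measure of \<open>U\<close>.
  Inner regularity and symmetry give equality on the open sets, a generator stable under
  intersection.\<close>

lemma regular_measure_eqI:
  assumes X: "compact_space X" "Hausdorff_space X"
    and \<mu>: "regular_borel_prob X \<mu>" and \<nu>: "regular_borel_prob X \<nu>"
    and eq: "\<And>f. f \<in> cfun X \<Longrightarrow> (\<integral>x. f x \<partial>\<mu>) = (\<integral>x. f x \<partial>\<nu>)"
  shows "\<mu> = \<nu>"
proof -
  have Pow: "{U. openin X U} \<subseteq> Pow (topspace X)"
    by (auto dest: openin_subset)
  have *: "emeasure \<mu> U \<le> emeasure \<nu> U"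
    if \<mu>: "regular_borel_prob X \<mu>" and \<nu>: "regular_borel_prob X \<nu>"
      and eq: "\<And>f. f \<in> cfun X \<Longrightarrow> (\<integral>x. f x \<partial>\<mu>) = (\<integral>x. f x \<partial>\<nu>)" and U: "openin X U" for \<mu> \<nu> U
  proof -
    interpret \<mu>: prob_space \<mu> using \<mu> by (simp add: regular_borel_prob_def)
    interpret \<nu>: prob_space \<nu> using \<nu> by (simp add: regular_borel_prob_def)
    have s\<mu>: "sets \<mu> = sets (borel_of X)" and s\<nu>: "sets \<nu> = sets (borel_of X)"
      using \<mu> \<nu> by (auto simp: regular_borel_prob_def)
    have sp: "space \<mu> = topspace X" "space \<nu> = topspace X"
      using sets_eq_imp_space_eq[OF s\<mu>] sets_eq_imp_space_eq[OF s\<nu>]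
      by (auto simp: borel_of_def space_measure_of_conv)
    have Us: "U \<in> sets (borel_of X)"
      using U Pow by (simp add: borel_of_def)
    have "emeasure \<mu> U = (SUP C\<in>{C. compactin X C \<and> C \<subseteq> U}. emeasure \<mu> C)"
      using \<mu> Us by (simp add: regular_borel_prob_def)
    also have "\<dots> \<le> emeasure \<nu> U"
    proof (rule SUP_least)
      fix C assume "C \<in> {C. compactin X C \<and> C \<subseteq> U}"
      then have C: "closedin X C" "C \<subseteq> U"
        using compactin_imp_closedin[OF X(2)] by auto
      have Cs: "C \<in> sets (borel_of X)"
      proof -
        have "topspace X - C \<in> sets (borel_of X)"
          using C Pow by (auto simp: borel_of_def)
        from sets.compl_sets[OF this] show ?thesis
          using closedin_subset[OF C(1)] by (simp add: borel_of_def space_measure_of_conv double_diff)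
      qed
      have "closedin X (topspace X - U)" "disjnt (topspace X - U) C"
        using U C by (auto simp: disjnt_def)
      then obtain f where f: "continuous_map X (top_of_set {0..1::real}) f" "f ` (topspace X - U) \<subseteq> {0}" "f ` C \<subseteq> {1}"
        using Urysohn_lemma[OF compact_Hausdorff_or_regular_imp_normal_space[OF X(1)], of "topspace X - U" C 0 1] X(2) C
        by auto
      have fc: "f \<in> cfun X" and f01: "\<And>x. x \<in> topspace X \<Longrightarrow> 0 \<le> f x \<and> f x \<le> 1"
        using f(1) by (auto simp: cfun_def continuous_map_in_subtopology Pi_iff image_subset_iff)
      have "measure \<mu> C = (\<integral>x. indicator C x \<partial>\<mu>)"
        using Cs s\<mu> by simp
      also have "\<dots> \<le> (\<integral>x. f x \<partial>\<mu>)"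
        using f(3) f01 Cs s\<mu> sp
        by (intro integral_mono cfun_integrable[OF _ s\<mu> X(1) fc] \<mu>.prob_space_axioms)
          (auto simp: \<mu>.emeasure_eq_measure image_subset_iff split: split_indicator)
      also have "\<dots> = (\<integral>x. f x \<partial>\<nu>)"
        by (rule eq[OF fc])
      also have "\<dots> \<le> (\<integral>x. indicator U x \<partial>\<nu>)"
        using f(2) f01 Us s\<nu> sp
        by (intro integral_mono cfun_integrable[OF _ s\<nu> X(1) fc] \<nu>.prob_space_axioms)
          (auto simp: \<nu>.emeasure_eq_measure image_subset_iff split: split_indicator)
      also have "\<dots> = measure \<nu> U"
        using Us s\<nu> by simp
      finally show "emeasure \<mu> C \<le> emeasure \<nu> U"
        by (simp add: \<mu>.emeasure_eq_measure \<nu>.emeasure_eq_measure)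
    qed
    finally show ?thesis .
  qed
  have s: "sets \<mu> = sigma_sets (topspace X) {U. openin X U}" "sets \<nu> = sigma_sets (topspace X) {U. openin X U}"
    using \<mu> \<nu> Pow by (auto simp: regular_borel_prob_def borel_of_def)
  interpret \<mu>: prob_space \<mu> using \<mu> by (simp add: regular_borel_prob_def)
  show ?thesis
  proof (rule measure_eqI_generator_eq[where A = "\<lambda>_. topspace X", OF _ Pow _ s])
    show "emeasure \<mu> U = emeasure \<nu> U" if "U \<in> {U. openin X U}" for U
      using that by (intro antisym *[OF \<mu> \<nu> eq] *[OF \<nu> \<mu> eq[symmetric]]) auto
  qed (auto simp: Int_stable_def)
qed

text \<open>The image of a compact set is compact: inner approximations of a preimage under
  \<open>h\<close> are carried by \<open>h\<close> to inner approximations for the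
  push-forward.\<close>

lemma distr_regular:
  assumes X: "compact_space X" "Hausdorff_space X"
    and \<mu>: "regular_borel_prob X \<mu>" and h: "continuous_map X X h"
  shows "h \<in> measurable \<mu> \<mu>" "regular_borel_prob X (distr \<mu> \<mu> h)"
proof -
  interpret prob_space \<mu> using \<mu> by (simp add: regular_borel_prob_def)
  have Pow: "{U. openin X U} \<subseteq> Pow (topspace X)"
    by (auto dest: openin_subset)
  have s: "sets \<mu> = sigma_sets (topspace X) {U. openin X U}" and s\<mu>: "sets \<mu> = sets (borel_of X)"
    using \<mu> Pow by (auto simp: regular_borel_prob_def borel_of_def)
  have sp: "space \<mu> = topspace X"
    using sets_eq_imp_space_eq[OF s\<mu>] by (auto simp: borel_of_def space_measure_of_conv)
  have hX: "h x \<in> topspace X" if "x \<in> topspace X" for x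
    using h that continuous_map_image_subset_topspace by blast
  show m: "h \<in> measurable \<mu> \<mu>"
  proof (rule measurable_sigma_sets[OF s Pow])
    fix U assume "U \<in> {U. openin X U}"
    then have "openin X {x \<in> topspace X. h x \<in> U}"
      using openin_continuous_map_preimage[OF h] by simp
    moreover have "h -` U \<inter> space \<mu> = {x \<in> topspace X. h x \<in> U}"
      by (auto simp: sp)
    ultimately show "h -` U \<inter> space \<mu> \<in> sets \<mu>"
      by (simp add: s)
  qed (use hX sp in auto)
  define \<nu> where "\<nu> = distr \<mu> \<mu> h"
  have s\<nu>: "sets \<nu> = sets \<mu>" "space \<nu> = topspace X"
    by (simp_all add: \<nu>_def sp)
  interpret \<nu>: prob_space \<nu>
    unfolding \<nu>_def by (rule prob_space_distr[OF m])
  have closed_sets: "C \<in> sets \<mu>" if "closedin X C" for C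
  proof -
    have "topspace X - C \<in> sets \<mu>"
      using that by (auto simp: s)
    from sets.compl_sets[OF this] show ?thesis
      using closedin_subset[OF that] by (simp add: sp double_diff)
  qed
  have inner: "\<exists>C. compactin X C \<and> C \<subseteq> B \<and> emeasure \<nu> B \<le> emeasure \<nu> C + ennreal e"
    if B: "B \<in> sets \<mu>" and e: "e > 0" for B and e :: real
  proof -
    let ?B = "h -` B \<inter> space \<mu>"
    have Bs: "?B \<in> sets \<mu>"
      by (rule measurable_sets[OF m B])
    have "emeasure \<mu> ?B < \<infinity>"
      by (simp add: emeasure_eq_measure)
    moreover have SUP: "emeasure \<mu> ?B = (SUP C\<in>{C. compactin X C \<and> C \<subseteq> ?B}. emeasure \<mu> C)"
      using \<mu> Bs by (simp add: regular_borel_prob_def)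
    moreover have "{C. compactin X C \<and> C \<subseteq> ?B} \<noteq> {}"
      using compactin_empty by blast
    ultimately have "\<exists>C\<in>{C. compactin X C \<and> C \<subseteq> ?B}. emeasure \<mu> ?B < emeasure \<mu> C + ennreal e"
      using SUP_approx_ennreal[OF e _ SUP] by (metis less_irrefl)
    then obtain C where C: "compactin X C" "C \<subseteq> ?B" "emeasure \<mu> ?B < emeasure \<mu> C + ennreal e"
      by auto
    have hC: "compactin X (h ` C)"
      using image_compactin[OF C(1) h] .
    then have hCs: "h ` C \<in> sets \<mu>"
      by (intro closed_sets compactin_imp_closedin[OF X(2)])
    have "emeasure \<mu> C \<le> emeasure \<mu> (h -` (h ` C) \<inter> space \<mu>)"
      using C(2) measurable_sets[OF m hCs] by (intro emeasure_mono) auto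
    then have "emeasure \<nu> B \<le> emeasure \<nu> (h ` C) + ennreal e"
      using C(3) B hCs unfolding \<nu>_def by (simp add: emeasure_distr[OF m] add_right_mono order_trans[OF less_imp_le])
    then show ?thesis
      using hC C(2) by (intro exI[of _ "h ` C"]) auto
  qed
  show "regular_borel_prob X (distr \<mu> \<mu> h)"
    unfolding \<nu>_def[symmetric]
    by (rule regular_borel_probI[OF X \<nu>.prob_space_axioms]) (use s\<nu> s\<mu> inner in auto)
qed

section \<open>Invariant measures as invariant states\<close>

definition invariant_state ::
  "('g, 'm) monoid_scheme \<Rightarrow> 'x set \<Rightarrow> ('x \<Rightarrow> 'g \<Rightarrow> 'x) \<Rightarrow> ('x \<Rightarrow> real) set \<Rightarrow> (('x \<Rightarrow> real) \<Rightarrow> real) \<Rightarrow> bool" where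
  "invariant_state G D a V I \<longleftrightarrow> state D V I \<and> (\<forall>g\<in>carrier G. \<forall>f\<in>V. I (\<lambda>x. f (a x g)) = I f)"

lemma invariant_measure_integral:
  assumes X: "flow G T X a" "topspace T = carrier G" and \<mu>: "invariant_measure G X a \<mu>"
  shows "invariant_state G (topspace X) a (cfun X) (\<lambda>f. \<integral>x. f x \<partial>\<mu>)"
  unfolding invariant_state_def
proof (intro conjI ballI)
  have c: "compact_space X" "Hausdorff_space X"
    using X by (auto simp: flow_def)
  have r: "regular_borel_prob X \<mu>" and s: "sets \<mu> = sets (borel_of X)"
    using \<mu> by (auto simp: invariant_measure_def regular_borel_prob_def)
  show "state (topspace X) (cfun X) (\<lambda>f. \<integral>x. f x \<partial>\<mu>)"
    using r c by (intro state_integral) (auto simp: regular_borel_prob_def)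
  fix g f assume g: "g \<in> carrier G" and f: "f \<in> cfun X"
  have "(\<integral>x. f x \<partial>\<mu>) = (\<integral>x. f x \<partial>(distr \<mu> \<mu> (\<lambda>x. a x g)))"
    using \<mu> g by (simp add: invariant_measure_def)
  also have "\<dots> = (\<integral>x. f (a x g) \<partial>\<mu>)"
    by (rule integral_distr[OF distr_regular(1)[OF c r flow_act_continuous[OF X g]] cfun_measurable[OF s f]])
  finally show "(\<integral>x. f (a x g) \<partial>\<mu>) = (\<integral>x. f x \<partial>\<mu>)" by simp
qed

lemma invariant_measure_riesz:
  assumes X: "flow G T X a" "topspace T = carrier G" and I: "invariant_state G (topspace X) a (cfun X) I"
  obtains \<mu> where "invariant_measure G X a \<mu>" "\<And>f. f \<in> cfun X \<Longrightarrow> (\<integral>x. f x \<partial>\<mu>) = I f"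
proof -
  have c: "compact_space X" "Hausdorff_space X"
    using X by (auto simp: flow_def)
  interpret compact_state X I
    using c I by unfold_locales (auto simp: invariant_state_def)
  have "distr riesz riesz (\<lambda>x. a x g) = riesz" if g: "g \<in> carrier G" for g
  proof (rule regular_measure_eqI[OF c _ regular_riesz])
    note d = distr_regular[OF c regular_riesz flow_act_continuous[OF X g]]
    show "regular_borel_prob X (distr riesz riesz (\<lambda>x. a x g))"
      by (rule d)
    fix f assume f: "f \<in> cfun X"
    have f': "(\<lambda>x. f (a x g)) \<in> cfun X"
      using continuous_map_compose[OF flow_act_continuous[OF X g], of _ f] f by (simp add: cfun_def o_def)
    have "(\<integral>x. f x \<partial>(distr riesz riesz (\<lambda>x. a x g))) = (\<integral>x. f (a x g) \<partial>riesz)"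
      by (rule integral_distr[OF d(1) cfun_measurable[OF sets_riesz_borel f]])
    also have "\<dots> = (\<integral>x. f x \<partial>riesz)"
      using I g f unfolding integral_riesz[OF f'] integral_riesz[OF f] by (simp add: invariant_state_def)
    finally show "(\<integral>x. f x \<partial>(distr riesz riesz (\<lambda>x. a x g))) = (\<integral>x. f x \<partial>riesz)" .
  qed
  then show ?thesis
    using that regular_riesz integral_riesz unfolding invariant_measure_def by blast
qed

text \<open>A functional is arbitrary outside \<open>cfun X\<close>, so \<open>\<exists>!\<close>
  would be false for states; uniqueness is agreement on \<open>cfun X\<close>.\<close>

lemma unique_invariant_measure_iff:
  assumes X: "flow G T X a" "topspace T = carrier G"
  shows "(\<exists>!\<mu>. invariant_measure G X a \<mu>) \<longleftrightarrow>
    (\<exists>I. invariant_state G (topspace X) a (cfun X) I \<and> (\<forall>J. invariant_state G (topspace X) a (cfun X) J \<longrightarrow> (\<forall>f\<in>cfun X. J f = I f)))"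
  (is "?L = ?R")
proof
  assume ?L
  then obtain \<mu> where \<mu>: "invariant_measure G X a \<mu>" "\<And>\<nu>. invariant_measure G X a \<nu> \<Longrightarrow> \<nu> = \<mu>"
    by blast
  have "J f = (\<integral>x. f x \<partial>\<mu>)" if "invariant_state G (topspace X) a (cfun X) J" "f \<in> cfun X" for J f
    using invariant_measure_riesz[OF X that(1)] \<mu>(2) that(2) by metis
  then show ?R
    using invariant_measure_integral[OF X \<mu>(1)] by blast
next
  assume ?R
  then obtain I where I: "invariant_state G (topspace X) a (cfun X) I"
    "\<And>J f. invariant_state G (topspace X) a (cfun X) J \<Longrightarrow> f \<in> cfun X \<Longrightarrow> J f = I f"
    by blast
  obtain \<mu> where \<mu>: "invariant_measure G X a \<mu>"
    using invariant_measure_riesz[OF X I(1)] by blast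
  have "\<nu> = \<nu>'" if "invariant_measure G X a \<nu>" "invariant_measure G X a \<nu>'" for \<nu> \<nu>'
    using that X I(2)[OF invariant_measure_integral[OF X that(1)]] I(2)[OF invariant_measure_integral[OF X that(2)]]
    by (intro regular_measure_eqI[of X]) (auto simp: flow_def invariant_measure_def)
  with \<mu> show ?L
    by blast
qed

lemma invariant_stateD:
  "invariant_state G D a V I \<Longrightarrow> g \<in> carrier G \<Longrightarrow> f \<in> V \<Longrightarrow> I (\<lambda>x. f (a x g)) = I f"
  by (simp add: invariant_state_def)

section \<open>Uniformly continuous functions and the greatest ambit\<close>

text \<open>The algebraic part of a flow. \<open>D\<close> has no topology: the group itself and the
  product \<open>orbit_maps \<times> topspace U\<close> also take its place.\<close>

definition action :: "('g, 'm) monoid_scheme \<Rightarrow> 'x set \<Rightarrow> ('x \<Rightarrow> 'g \<Rightarrow> 'x) \<Rightarrow> bool" where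
  "action G D a \<longleftrightarrow> (\<forall>x\<in>D. \<forall>g\<in>carrier G. a x g \<in> D) \<and> (\<forall>x\<in>D. a x \<one>\<^bsub>G\<^esub> = x) \<and>
     (\<forall>x\<in>D. \<forall>g\<in>carrier G. \<forall>h\<in>carrier G. a (a x g) h = a x (g \<otimes>\<^bsub>G\<^esub> h))"

text \<open>Only displacements by group elements near the identity are measured, so the notion makes
  sense without a topology on \<open>D\<close>. On the group it is uniform continuity for the
  neighbourhoods \<open>h V\<close> of \<open>h\<close>.\<close>

definition equi_uniform ::
  "('g, 'm) monoid_scheme \<Rightarrow> 'g topology \<Rightarrow> 'x set \<Rightarrow> ('x \<Rightarrow> 'g \<Rightarrow> 'x) \<Rightarrow> ('x \<Rightarrow> real) set \<Rightarrow> bool" where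
  "equi_uniform G T D a \<Phi> \<longleftrightarrow> (\<forall>e>0. \<exists>V. openin T V \<and> \<one>\<^bsub>G\<^esub> \<in> V \<and>
     (\<forall>f\<in>\<Phi>. \<forall>x\<in>D. \<forall>v\<in>V. \<bar>f (a x v) - f x\<bar> \<le> e))"

definition bounded_funs :: "'x set \<Rightarrow> ('x \<Rightarrow> real) set" where
  "bounded_funs D = {f. \<exists>B. \<forall>x\<in>D. \<bar>f x\<bar> \<le> B}"

definition uniform_funs ::
  "('g, 'm) monoid_scheme \<Rightarrow> 'g topology \<Rightarrow> 'x set \<Rightarrow> ('x \<Rightarrow> 'g \<Rightarrow> 'x) \<Rightarrow> ('x \<Rightarrow> real) set" where
  "uniform_funs G T D a = {f \<in> bounded_funs D. equi_uniform G T D a {f}}"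

abbreviation group_funs :: "('g, 'm) monoid_scheme \<Rightarrow> 'g topology \<Rightarrow> ('g \<Rightarrow> real) set" where
  "group_funs G T \<equiv> uniform_funs G T (carrier G) (\<otimes>\<^bsub>G\<^esub>)"

lemma action_in: "action G D a \<Longrightarrow> x \<in> D \<Longrightarrow> g \<in> carrier G \<Longrightarrow> a x g \<in> D"
  and action_one: "action G D a \<Longrightarrow> x \<in> D \<Longrightarrow> a x \<one>\<^bsub>G\<^esub> = x"
  and action_mult: "action G D a \<Longrightarrow> x \<in> D \<Longrightarrow> g \<in> carrier G \<Longrightarrow> h \<in> carrier G \<Longrightarrow>
    a (a x g) h = a x (g \<otimes>\<^bsub>G\<^esub> h)"
  by (auto simp: action_def)

lemma action_flow:
  assumes "flow G T X a" "topspace T = carrier G"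
  shows "action G (topspace X) a"
  using assms flow_act_in[OF assms] by (auto simp: action_def flow_def)

lemma action_group:
  assumes "group G"
  shows "action G (carrier G) (\<otimes>\<^bsub>G\<^esub>)"
proof -
  interpret group G by fact
  show ?thesis
    by (simp add: action_def m_assoc)
qed

lemma equi_uniformD:
  assumes "equi_uniform G T D a \<Phi>" "e > 0"
  obtains V where "openin T V" "\<one>\<^bsub>G\<^esub> \<in> V"
    "\<And>f x v. f \<in> \<Phi> \<Longrightarrow> x \<in> D \<Longrightarrow> v \<in> V \<Longrightarrow> \<bar>f (a x v) - f x\<bar> \<le> e"
proof -
  have "\<exists>V. openin T V \<and> \<one>\<^bsub>G\<^esub> \<in> V \<and> (\<forall>f\<in>\<Phi>. \<forall>x\<in>D. \<forall>v\<in>V. \<bar>f (a x v) - f x\<bar> \<le> e)"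
    using assms by (simp add: equi_uniform_def)
  then obtain V where "openin T V \<and> \<one>\<^bsub>G\<^esub> \<in> V \<and> (\<forall>f\<in>\<Phi>. \<forall>x\<in>D. \<forall>v\<in>V. \<bar>f (a x v) - f x\<bar> \<le> e)" ..
  then show ?thesis
    by (intro that) auto
qed

lemma uniform_funsD:
  assumes "f \<in> uniform_funs G T D a" "e > 0"
  obtains V where "openin T V" "\<one>\<^bsub>G\<^esub> \<in> V" "\<And>x v. x \<in> D \<Longrightarrow> v \<in> V \<Longrightarrow> \<bar>f (a x v) - f x\<bar> \<le> e"
proof -
  have "equi_uniform G T D a {f}"
    using assms(1) by (simp add: uniform_funs_def)
  then show ?thesis
    by (rule equi_uniformD[OF _ assms(2)]) (use that in blast)
qed

lemma uniform_funsI: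
  assumes "\<And>x. x \<in> D \<Longrightarrow> \<bar>f x\<bar> \<le> B"
    and "\<And>e. e > 0 \<Longrightarrow>
      \<exists>V. openin T V \<and> \<one>\<^bsub>G\<^esub> \<in> V \<and> (\<forall>x\<in>D. \<forall>v\<in>V. \<bar>f (a x v) - f x\<bar> \<le> e)"
  shows "f \<in> uniform_funs G T D a"
  using assms unfolding uniform_funs_def bounded_funs_def equi_uniform_def by auto

lemma uniform_funs_bounded:
  assumes "f \<in> uniform_funs G T D a"
  obtains B where "\<And>x. x \<in> D \<Longrightarrow> \<bar>f x\<bar> \<le> B"
  using assms by (auto simp: uniform_funs_def bounded_funs_def)

lemma equi_uniform_mono: "equi_uniform G T D a \<Phi> \<Longrightarrow> \<Psi> \<subseteq> \<Phi> \<Longrightarrow> equi_uniform G T D a \<Psi>"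
  unfolding equi_uniform_def by (meson subsetD)

lemma fun_space_bounded: "fun_space (bounded_funs D)"
  unfolding fun_space_def bounded_funs_def
proof (intro conjI allI ballI)
  fix f g :: "'a \<Rightarrow> real" assume "f \<in> {f. \<exists>B. \<forall>x\<in>D. \<bar>f x\<bar> \<le> B}" "g \<in> {f. \<exists>B. \<forall>x\<in>D. \<bar>f x\<bar> \<le> B}"
  then obtain B C where "\<And>x. x \<in> D \<Longrightarrow> \<bar>f x\<bar> \<le> B" "\<And>x. x \<in> D \<Longrightarrow> \<bar>g x\<bar> \<le> C"
    by blast
  then have "\<forall>x\<in>D. \<bar>f x + g x\<bar> \<le> B + C"
    by (auto intro: order_trans[OF abs_triangle_ineq] add_mono)
  then show "(\<lambda>x. f x + g x) \<in> {f. \<exists>B. \<forall>x\<in>D. \<bar>f x\<bar> \<le> B}"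
    by blast
next
  fix c :: real and f :: "'a \<Rightarrow> real" assume "f \<in> {f. \<exists>B. \<forall>x\<in>D. \<bar>f x\<bar> \<le> B}"
  then obtain B where "\<And>x. x \<in> D \<Longrightarrow> \<bar>f x\<bar> \<le> B"
    by blast
  then have "\<forall>x\<in>D. \<bar>c * f x\<bar> \<le> \<bar>c\<bar> * B"
    by (simp add: abs_mult mult_left_mono)
  then show "(\<lambda>x. c * f x) \<in> {f. \<exists>B. \<forall>x\<in>D. \<bar>f x\<bar> \<le> B}"
    by blast
qed auto

lemma uniform_funs_transfer:
  assumes f: "f \<in> uniform_funs G T D' a'" and T: "topspace T = carrier G"
    and B: "\<And>x. x \<in> D \<Longrightarrow> \<bar>F x\<bar> \<le> B"
    and C: "\<And>x. x \<in> D \<Longrightarrow> \<exists>y\<in>D'. \<forall>v\<in>carrier G. \<bar>F (a x v) - F x\<bar> \<le> C * \<bar>f (a' y v) - f y\<bar>"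
  shows "F \<in> uniform_funs G T D a"
proof (rule uniform_funsI[OF B])
  fix e :: real assume "e > 0"
  \<comment> \<open>\<open>C\<close> may be zero or negative; \<open>\<bar>C\<bar> + 1\<close> is a
    safe divisor.\<close>
  then have e: "e / (\<bar>C\<bar> + 1) > 0" by (simp add: add_nonneg_pos)
  obtain V where V: "openin T V" "\<one>\<^bsub>G\<^esub> \<in> V" "\<And>y v. y \<in> D' \<Longrightarrow> v \<in> V \<Longrightarrow> \<bar>f (a' y v) - f y\<bar> \<le> e / (\<bar>C\<bar> + 1)"
    by (rule uniform_funsD[OF f e]) blast
  have "\<bar>F (a x v) - F x\<bar> \<le> e" if x: "x \<in> D" and v: "v \<in> V" for x v
  proof -
    have "v \<in> carrier G"
      using openin_subset[OF V(1)] T v by auto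
    then obtain y where y: "y \<in> D'" "\<bar>F (a x v) - F x\<bar> \<le> C * \<bar>f (a' y v) - f y\<bar>"
      using C[OF x] by blast
    note y(2)
    also have "C * \<bar>f (a' y v) - f y\<bar> \<le> (\<bar>C\<bar> + 1) * (e / (\<bar>C\<bar> + 1))"
      using V(3)[OF y(1) v] by (intro mult_mono) auto
    finally show ?thesis by simp
  qed
  then show "\<exists>V. openin T V \<and> \<one>\<^bsub>G\<^esub> \<in> V \<and> (\<forall>x\<in>D. \<forall>v\<in>V. \<bar>F (a x v) - F x\<bar> \<le> e)"
    using V(1,2) by blast
qed

lemma fun_space_uniform:
  assumes "topspace T = carrier G" "group G"
  shows "fun_space (uniform_funs G T D a)"
  unfolding fun_space_def
proof (intro conjI allI ballI)
  fix f g assume fg: "f \<in> uniform_funs G T D a" "g \<in> uniform_funs G T D a"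
  obtain B C where BC: "\<And>x. x \<in> D \<Longrightarrow> \<bar>f x\<bar> \<le> B" "\<And>x. x \<in> D \<Longrightarrow> \<bar>g x\<bar> \<le> C"
    using uniform_funs_bounded[OF fg(1)] uniform_funs_bounded[OF fg(2)] by metis
  show "(\<lambda>x. f x + g x) \<in> uniform_funs G T D a"
  proof (rule uniform_funsI)
    show "\<bar>f x + g x\<bar> \<le> B + C" if "x \<in> D" for x
      using BC[OF that] by linarith
    fix e :: real assume "e > 0"
    then have e: "e / 2 > 0" by simp
    obtain V where V: "openin T V" "\<one>\<^bsub>G\<^esub> \<in> V" "\<And>x v. x \<in> D \<Longrightarrow> v \<in> V \<Longrightarrow> \<bar>f (a x v) - f x\<bar> \<le> e / 2"
      by (rule uniform_funsD[OF fg(1) e]) blast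
    obtain W where W: "openin T W" "\<one>\<^bsub>G\<^esub> \<in> W" "\<And>x v. x \<in> D \<Longrightarrow> v \<in> W \<Longrightarrow> \<bar>g (a x v) - g x\<bar> \<le> e / 2"
      by (rule uniform_funsD[OF fg(2) e]) blast
    have "\<bar>(f (a x v) + g (a x v)) - (f x + g x)\<bar> \<le> e" if "x \<in> D" "v \<in> V \<inter> W" for x v
      using V(3)[OF that(1) IntD1[OF that(2)]] W(3)[OF that(1) IntD2[OF that(2)]] by linarith
    then show "\<exists>V. openin T V \<and> \<one>\<^bsub>G\<^esub> \<in> V \<and> (\<forall>x\<in>D. \<forall>v\<in>V. \<bar>(f (a x v) + g (a x v)) - (f x + g x)\<bar> \<le> e)"
      using V(1,2) W(1,2) by (intro exI[of _ "V \<inter> W"]) auto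
  qed
next
  fix c f assume f: "f \<in> uniform_funs G T D a"
  obtain B where B: "\<And>x. x \<in> D \<Longrightarrow> \<bar>f x\<bar> \<le> B"
    by (rule uniform_funs_bounded[OF f]) blast
  show "(\<lambda>x. c * f x) \<in> uniform_funs G T D a"
  proof (rule uniform_funs_transfer[OF f assms(1), where C = "\<bar>c\<bar>" and B = "\<bar>c\<bar> * B"])
    show "\<bar>c * f x\<bar> \<le> \<bar>c\<bar> * B" if "x \<in> D" for x
      using B[OF that] by (simp add: abs_mult mult_left_mono)
    show "\<exists>y\<in>D. \<forall>v\<in>carrier G. \<bar>c * f (a x v) - c * f x\<bar> \<le> \<bar>c\<bar> * \<bar>f (a y v) - f y\<bar>" if "x \<in> D" for x
      using that by (intro bexI[of _ x]) (simp_all flip: abs_mult right_diff_distrib)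
  qed
next
  fix c :: real
  have "\<one>\<^bsub>G\<^esub> \<in> topspace T"
    using assms by (simp add: group.is_monoid monoid.one_closed)
  then show "(\<lambda>_. c) \<in> uniform_funs G T D a"
    using openin_topspace by (intro uniform_funsI[where B = "\<bar>c\<bar>"]) auto
qed

lemma continuous_map_realI:
  assumes "\<And>x e. x \<in> topspace X \<Longrightarrow> e > 0 \<Longrightarrow> \<exists>U. openin X U \<and> x \<in> U \<and> (\<forall>y\<in>U. \<bar>f y - f x\<bar> < e)"
  shows "continuous_map X euclideanreal f"
  using assms Met_TC.continuous_map_to_metric[of X f]
  by (simp add: dist_real_def) (metis abs_minus_commute)

lemma cfun_nbhd:
  assumes "f \<in> cfun X" "x \<in> topspace X" "e > 0"
  shows "openin X {y \<in> topspace X. \<bar>f y - f x\<bar> < e}"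
proof -
  have "{y \<in> topspace X. \<bar>f y - f x\<bar> < e} = {y \<in> topspace X. f y \<in> ball (f x) e}"
    by (auto simp: dist_real_def)
  then show ?thesis
    using openin_continuous_map_preimage[of X euclideanreal f "ball (f x) e"] assms by (simp add: cfun_def)
qed

text \<open>The points where acting changes \<open>f\<close> by less than \<open>e\<close> form an
  open set containing \<open>X\<close> times the identity. As \<open>X\<close> is compact, the tube
  lemma gives one neighbourhood of the identity for all points.\<close>

lemma cfun_uniform:
  assumes X: "flow G T X a" "topspace T = carrier G" and G: "group G" and f: "f \<in> cfun X"
  shows "f \<in> uniform_funs G T (topspace X) a"
proof -
  have comp: "compact_space X" and act: "continuous_map (prod_topology X T) X (\<lambda>(x, g). a x g)"
    and one: "\<And>x. x \<in> topspace X \<Longrightarrow> a x \<one>\<^bsub>G\<^esub> = x"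
    using X by (auto simp: flow_def)
  have f': "continuous_map X euclideanreal f"
    using f by (simp add: cfun_def)
  have c: "(\<lambda>z. \<bar>f (a (fst z) (snd z)) - f (fst z)\<bar>) \<in> cfun (prod_topology X T)"
    unfolding cfun_def mem_Collect_eq
    using continuous_map_compose[OF act f'] continuous_map_compose[OF continuous_map_fst f']
    by (intro continuous_map_real_abs continuous_map_diff) (auto simp: o_def case_prod_unfold)
  have 1: "\<one>\<^bsub>G\<^esub> \<in> topspace T"
    using X G by (simp add: group.is_monoid monoid.one_closed)
  have "\<exists>V. openin T V \<and> \<one>\<^bsub>G\<^esub> \<in> V \<and> (\<forall>x\<in>topspace X. \<forall>v\<in>V. \<bar>f (a x v) - f x\<bar> \<le> e)"
    if e: "e > 0" for e :: real
  proof -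
    let ?W = "{z \<in> topspace (prod_topology X T). \<bar>f (a (fst z) (snd z)) - f (fst z)\<bar> < e}"
    have "openin (prod_topology X T) ?W"
      using openin_continuous_map_preimage[of "prod_topology X T" euclideanreal _ "{..<e}"] c
      by (simp add: cfun_def)
    moreover have "topspace X \<times> {\<one>\<^bsub>G\<^esub>} \<subseteq> ?W"
      using one 1 e by auto
    ultimately obtain U V where "openin T V" "topspace X \<subseteq> U" "\<one>\<^bsub>G\<^esub> \<in> V" "U \<times> V \<subseteq> ?W"
      using tube_lemma_left[of X T ?W "topspace X" "\<one>\<^bsub>G\<^esub>"] comp 1 unfolding compact_space_def by blast
    then show ?thesis
      by (intro exI[of _ V]) (force simp: less_imp_le)
  qed
  moreover obtain B where "\<And>x. x \<in> topspace X \<Longrightarrow> \<bar>f x\<bar> \<le> B"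
    using cfun_bounded[OF comp f] by blast
  ultimately show ?thesis
    by (intro uniform_funsI)
qed

text \<open>The bound for \<open>f\<close> at the point \<open>a x h\<close> is the bound for the
  orbit function at \<open>h\<close>. One \<open>V\<close> therefore serves all starting points
  \<open>x\<close>, and this is what makes the orbit maps equicontinuous later.\<close>

lemma equi_uniform_orbit:
  assumes "action G D a" "topspace T = carrier G" "equi_uniform G T D a \<Phi>"
  shows "equi_uniform G T (carrier G) (\<otimes>\<^bsub>G\<^esub>) {\<lambda>h. f (a x h) |f x. f \<in> \<Phi> \<and> x \<in> D}"
  unfolding equi_uniform_def
proof (intro allI impI)
  fix e :: real assume "e > 0"
  then obtain V where V: "openin T V" "\<one>\<^bsub>G\<^esub> \<in> V"
    "\<And>f x v. f \<in> \<Phi> \<Longrightarrow> x \<in> D \<Longrightarrow> v \<in> V \<Longrightarrow> \<bar>f (a x v) - f x\<bar> \<le> e"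
    using equi_uniformD[OF assms(3)] by blast
  have "\<bar>f (a x (h \<otimes>\<^bsub>G\<^esub> v)) - f (a x h)\<bar> \<le> e" if "f \<in> \<Phi>" "x \<in> D" "h \<in> carrier G" "v \<in> V" for f x h v
  proof -
    have "v \<in> carrier G"
      using openin_subset[OF V(1)] assms(2) that by auto
    then show ?thesis
      using V(3)[of f "a x h" v] that action_in[OF assms(1)] action_mult[OF assms(1)] by simp
  qed
  then show "\<exists>V. openin T V \<and> \<one>\<^bsub>G\<^esub> \<in> V \<and>
      (\<forall>F\<in>{\<lambda>h. f (a x h) |f x. f \<in> \<Phi> \<and> x \<in> D}. \<forall>h\<in>carrier G. \<forall>v\<in>V. \<bar>F (h \<otimes>\<^bsub>G\<^esub> v) - F h\<bar> \<le> e)"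
    using V(1,2) by (intro exI[of _ V]) auto
qed

lemma orbit_fun:
  assumes "action G D a" "topspace T = carrier G" "f \<in> uniform_funs G T D a" "x \<in> D"
  shows "(\<lambda>h. f (a x h)) \<in> group_funs G T"
proof -
  obtain B where B: "\<And>y. y \<in> D \<Longrightarrow> \<bar>f y\<bar> \<le> B"
    by (rule uniform_funs_bounded[OF assms(3)]) blast
  show ?thesis
  proof (rule uniform_funs_transfer[OF assms(3,2) B[OF action_in[OF assms(1,4)]], where C = 1])
    fix h assume h: "h \<in> carrier G"
    then show "\<exists>y\<in>D. \<forall>v\<in>carrier G. \<bar>f (a x (h \<otimes>\<^bsub>G\<^esub> v)) - f (a x h)\<bar> \<le> 1 * \<bar>f (a y v) - f y\<bar>"
      using action_in[OF assms(1,4) h] action_mult[OF assms(1,4) h] by (intro bexI[of _ "a x h"]) auto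
  qed
qed

lemma conj_open:
  assumes G: "topological_group G T" and V: "openin T V" "\<one>\<^bsub>G\<^esub> \<in> V" and g: "g \<in> carrier G"
  obtains W where "openin T W" "\<one>\<^bsub>G\<^esub> \<in> W" "\<And>w. w \<in> W \<Longrightarrow> inv\<^bsub>G\<^esub> g \<otimes>\<^bsub>G\<^esub> w \<otimes>\<^bsub>G\<^esub> g \<in> V"
proof -
  have grp: "group G" and T: "topspace T = carrier G"
    and m: "continuous_map (prod_topology T T) T (\<lambda>(x, y). x \<otimes>\<^bsub>G\<^esub> y)"
    using G by (auto simp: topological_group_def)
  interpret group G by fact
  have l: "continuous_map T T (\<lambda>x. inv\<^bsub>G\<^esub> g \<otimes>\<^bsub>G\<^esub> x)"
    using continuous_map_compose[OF _ m, of T "\<lambda>x. (inv\<^bsub>G\<^esub> g, x)"] g T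
    by (simp add: continuous_map_pairwise o_def)
  have r: "continuous_map T T (\<lambda>x. x \<otimes>\<^bsub>G\<^esub> g)"
    using continuous_map_compose[OF _ m, of T "\<lambda>x. (x, g)"] g T
    by (simp add: continuous_map_pairwise o_def)
  have "openin T {w \<in> topspace T. inv\<^bsub>G\<^esub> g \<otimes>\<^bsub>G\<^esub> w \<otimes>\<^bsub>G\<^esub> g \<in> V}"
    using openin_continuous_map_preimage[OF continuous_map_compose[OF l r] V(1)] by (simp add: o_def)
  then show ?thesis
    by (rule that) (use g V T in \<open>auto simp: m_assoc\<close>)
qed

text \<open>Moving \<open>v\<close> past \<open>g\<close> conjugates it:
  \<open>v g = g (inv g v g)\<close>. The neighbourhood for \<open>f\<close> must therefore be
  conjugated by \<open>g\<close>, which \<open>conj_open\<close> allows.\<close>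

lemma translate_fun:
  assumes G: "topological_group G T" and a: "action G D a" and f: "f \<in> uniform_funs G T D a" and g: "g \<in> carrier G"
  shows "(\<lambda>x. f (a x g)) \<in> uniform_funs G T D a"
proof -
  have grp: "group G" and T: "topspace T = carrier G"
    using G by (auto simp: topological_group_def)
  interpret group G by fact
  have "\<exists>V. openin T V \<and> \<one>\<^bsub>G\<^esub> \<in> V \<and> (\<forall>x\<in>D. \<forall>v\<in>V. \<bar>f (a (a x v) g) - f (a x g)\<bar> \<le> e)"
    if e: "e > 0" for e :: real
  proof -
    obtain V where V: "openin T V" "\<one>\<^bsub>G\<^esub> \<in> V" "\<And>x v. x \<in> D \<Longrightarrow> v \<in> V \<Longrightarrow> \<bar>f (a x v) - f x\<bar> \<le> e"
      by (rule uniform_funsD[OF f e]) blast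
    obtain W where W: "openin T W" "\<one>\<^bsub>G\<^esub> \<in> W" "\<And>w. w \<in> W \<Longrightarrow> inv\<^bsub>G\<^esub> g \<otimes>\<^bsub>G\<^esub> w \<otimes>\<^bsub>G\<^esub> g \<in> V"
      using conj_open[OF G V(1,2) g] by blast
    have "\<bar>f (a (a x v) g) - f (a x g)\<bar> \<le> e" if "x \<in> D" "v \<in> W" for x v
    proof -
      have v: "v \<in> carrier G"
        using openin_subset[OF W(1)] T that by auto
      have "g \<otimes>\<^bsub>G\<^esub> (inv\<^bsub>G\<^esub> g \<otimes>\<^bsub>G\<^esub> v \<otimes>\<^bsub>G\<^esub> g) = v \<otimes>\<^bsub>G\<^esub> g"
        using v g by (simp add: m_assoc[symmetric])
      then have "a (a x v) g = a (a x g) (inv\<^bsub>G\<^esub> g \<otimes>\<^bsub>G\<^esub> v \<otimes>\<^bsub>G\<^esub> g)"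
        using action_mult[OF a that(1)] v g by simp
      then show ?thesis
        using V(3)[OF action_in[OF a that(1) g] W(3)[OF that(2)]] by simp
    qed
    then show ?thesis
      using W by (intro exI[of _ W]) auto
  qed
  moreover obtain B where "\<And>x. x \<in> D \<Longrightarrow> \<bar>f x\<bar> \<le> B"
    by (rule uniform_funs_bounded[OF f]) blast
  then have "\<And>x. x \<in> D \<Longrightarrow> \<bar>f (a x g)\<bar> \<le> B"
    using action_in[OF a _ g] by blast
  ultimately show ?thesis
    by (intro uniform_funsI)
qed

section \<open>The greatest ambit as a closure of point evaluations\<close>

definition fun_topology :: "('g, 'm) monoid_scheme \<Rightarrow> 'g topology \<Rightarrow> (('g \<Rightarrow> real) \<Rightarrow> real) topology" where
  "fun_topology G T = product_topology (\<lambda>_. euclideanreal) (group_funs G T)"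

definition point_eval :: "('g, 'm) monoid_scheme \<Rightarrow> 'g topology \<Rightarrow> 'g \<Rightarrow> ('g \<Rightarrow> real) \<Rightarrow> real" where
  "point_eval G T h = (\<lambda>F\<in>group_funs G T. F h)"

text \<open>The point set of the greatest ambit (the Samuel compactification of the group), realized
  inside a power of the reals. Its points are functionals, so they can be used as states
  directly.\<close>

definition ambit_points :: "('g, 'm) monoid_scheme \<Rightarrow> 'g topology \<Rightarrow> (('g \<Rightarrow> real) \<Rightarrow> real) set" where
  "ambit_points G T = fun_topology G T closure_of (point_eval G T ` carrier G)"

definition ambit_act ::
  "('g, 'm) monoid_scheme \<Rightarrow> 'g topology \<Rightarrow> (('g \<Rightarrow> real) \<Rightarrow> real) \<Rightarrow> 'g \<Rightarrow> ('g \<Rightarrow> real) \<Rightarrow> real" where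
  "ambit_act G T q g = (\<lambda>F\<in>group_funs G T. q (\<lambda>h. F (h \<otimes>\<^bsub>G\<^esub> g)))"

lemma eval_cfun: "F \<in> group_funs G T \<Longrightarrow> (\<lambda>q. q F) \<in> cfun (fun_topology G T)"
  unfolding cfun_def fun_topology_def mem_Collect_eq by (rule continuous_map_product_projection)

lemma closure_le:
  assumes "K \<in> cfun P" "\<And>s. s \<in> S \<Longrightarrow> K s \<le> c" "p \<in> P closure_of S"
  shows "K p \<le> c"
proof (rule ccontr)
  assume "\<not> K p \<le> c"
  then have "p \<in> {x \<in> topspace P. c < K x}"
    using assms(3) by (simp add: in_closure_of)
  then obtain s where "s \<in> S" "s \<in> {x \<in> topspace P. c < K x}"
    using assms(3) openin_level[OF assms(1), of c] unfolding in_closure_of by meson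
  then show False
    using assms(2)[of s] by simp
qed

lemma cfun_abs_diff: "f \<in> cfun X \<Longrightarrow> g \<in> cfun X \<Longrightarrow> (\<lambda>x. \<bar>f x - g x\<bar>) \<in> cfun X"
  unfolding cfun_def mem_Collect_eq by (intro continuous_map_real_abs continuous_map_diff)

text \<open>The way every identity reaches ambit points: it holds at point evaluations, and
  \<open>K\<close> is the absolute difference of the two sides with \<open>c = 0\<close>.\<close>

lemma ambit_closed:
  assumes "q \<in> ambit_points G T" "K \<in> cfun (fun_topology G T)"
    and "\<And>h. h \<in> carrier G \<Longrightarrow> K (point_eval G T h) \<le> c"
  shows "K q \<le> c"
  using assms by (intro closure_le[OF assms(2) _ assms(1)[unfolded ambit_points_def]]) auto

lemma ambit_approx:
  assumes q: "q \<in> ambit_points G T" and A: "finite A" "A \<subseteq> group_funs G T" and e: "e > 0"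
  obtains h where "h \<in> carrier G" "\<And>F. F \<in> A \<Longrightarrow> \<bar>F h - q F\<bar> < e"
proof -
  let ?P = "fun_topology G T"
  have qP: "q \<in> topspace ?P"
    using q by (simp add: ambit_points_def in_closure_of)
  define W where "W = {p \<in> topspace ?P. \<forall>F\<in>A. \<bar>p F - q F\<bar> < e}"
  have "openin ?P W"
  proof (cases "A = {}")
    case False
    have "W = (\<Inter>F\<in>A. {p \<in> topspace ?P. \<bar>p F - q F\<bar> < e})"
      using False by (auto simp: W_def)
    moreover have "openin ?P {p \<in> topspace ?P. \<bar>p F - q F\<bar> < e}" if "F \<in> A" for F
      by (rule cfun_nbhd[OF eval_cfun qP e]) (use A that in auto)
    ultimately show ?thesis
      using A False by (auto intro!: openin_Inter)
  qed (simp add: W_def)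
  moreover have "q \<in> W"
    using qP e by (auto simp: W_def)
  ultimately obtain h where h: "h \<in> carrier G" "point_eval G T h \<in> W"
    using q unfolding ambit_points_def in_closure_of by blast
  then have "\<bar>F h - q F\<bar> < e" if "F \<in> A" for F
    using subsetD[OF A(2) that] that by (auto simp: W_def point_eval_def)
  with h show ?thesis
    using that by blast
qed

lemma ambit_state:
  assumes G: "topological_group G T" and q: "q \<in> ambit_points G T"
  shows "state (carrier G) (group_funs G T) q"
  unfolding state_def
proof (intro conjI ballI allI impI)
  show S: "fun_space (group_funs G T)"
    using G by (intro fun_space_uniform) (auto simp: topological_group_def)
  fix f assume f: "f \<in> group_funs G T"
  {
    fix g assume g: "g \<in> group_funs G T"
    note fg = fun_space_add[OF S f g]
    have "\<bar>q (\<lambda>x. f x + g x) - (q f + q g)\<bar> \<le> 0"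
      by (rule ambit_closed[OF q cfun_abs_diff[OF eval_cfun[OF fg]
              fun_space_add[OF fun_space_cfun eval_cfun[OF f] eval_cfun[OF g]]]])
        (simp add: point_eval_def f g fg)
    then show "q (\<lambda>x. f x + g x) = q f + q g"
      by simp
  next
    fix c
    note cf = fun_space_scale[OF S f, of c]
    have "\<bar>q (\<lambda>x. c * f x) - c * q f\<bar> \<le> 0"
      by (rule ambit_closed[OF q cfun_abs_diff[OF eval_cfun[OF cf] fun_space_scale[OF fun_space_cfun eval_cfun[OF f]]]])
        (simp add: point_eval_def f cf)
    then show "q (\<lambda>x. c * f x) = c * q f"
      by simp
  next
    assume "\<forall>x\<in>carrier G. 0 \<le> f x"
    then have "-1 * q f \<le> 0"
      by (intro ambit_closed[OF q fun_space_scale[OF fun_space_cfun eval_cfun[OF f]]])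
        (simp add: point_eval_def f)
    then show "0 \<le> q f"
      by simp
  }
next
  note one = fun_space_const[OF fun_space_uniform, of T G 1]
  have 1: "(\<lambda>_. 1) \<in> group_funs G T"
    using G by (intro one) (auto simp: topological_group_def)
  have "\<bar>q (\<lambda>_. 1) - 1\<bar> \<le> 0"
    by (rule ambit_closed[OF q cfun_abs_diff[OF eval_cfun[OF 1] fun_space_const[OF fun_space_cfun]]])
      (simp add: point_eval_def 1)
  then show "q (\<lambda>_. 1) = 1"
    by simp
qed

text \<open>Compactness is Tychonoff. Joint continuity is the real issue: it holds because ambit
  points are states and the functions are uniformly continuous, so a small change of the group
  element changes all values by little at once.\<close>

lemma ambit_flow:
  assumes G: "topological_group G T"
  shows "flow G T (subtopology (fun_topology G T) (ambit_points G T)) (ambit_act G T)"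
proof -
  let ?P = "fun_topology G T" and ?S = "ambit_points G T" and ?a = "ambit_act G T" and ?V = "group_funs G T"
  have grp: "group G" and T: "topspace T = carrier G"
    using G by (auto simp: topological_group_def)
  interpret group G by fact
  have SP: "?S \<subseteq> topspace ?P"
    unfolding ambit_points_def by (rule closure_of_subset_topspace)
  then have tS: "topspace (subtopology ?P ?S) = ?S"
    by auto
  have ext: "q \<in> extensional ?V" if "q \<in> ?S" for q
    using SP that by (auto simp: fun_topology_def PiE_def)
  have tr: "(\<lambda>h. F (h \<otimes>\<^bsub>G\<^esub> g)) \<in> ?V" if "F \<in> ?V" "g \<in> carrier G" for F g
    using translate_fun[OF G action_group[OF grp] that] by simp
  have pe: "point_eval G T h \<in> ?S" if "h \<in> carrier G" for h
    using that unfolding ambit_points_def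
    by (intro closure_of_subset[THEN subsetD]) (auto simp: fun_topology_def point_eval_def)
  have closed: "closedin ?P ?S"
    unfolding ambit_points_def by (rule closedin_closure_of)
  have compact: "compactin ?P ?S"
  proof -
    have "\<forall>F\<in>?V. \<exists>B. \<forall>h\<in>carrier G. \<bar>F h\<bar> \<le> B"
      by (auto simp: uniform_funs_def bounded_funs_def)
    then obtain B where B: "\<And>F h. F \<in> ?V \<Longrightarrow> h \<in> carrier G \<Longrightarrow> \<bar>F h\<bar> \<le> B F"
      by metis
    \<comment> \<open>Point evaluations respect the bound of every function, hence so does their
      closure.\<close>
    let ?K = "PiE ?V (\<lambda>F. {- B F..B F})"
    have K: "compactin ?P ?K"
      unfolding fun_topology_def compactin_PiE by simp
    have "Hausdorff_space ?P"
      unfolding fun_topology_def by (simp add: Hausdorff_space_product_topology)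
    then have "closedin ?P ?K"
      using K compactin_imp_closedin by blast
    moreover have "point_eval G T ` carrier G \<subseteq> ?K"
      using B by (auto simp: point_eval_def abs_le_iff minus_le_iff)
    ultimately have "?S \<subseteq> ?K"
      unfolding ambit_points_def by (intro closure_of_minimal)
    then show ?thesis
      using closed K closed_compactin by blast
  qed
  have act_cont: "continuous_map ?P ?P (\<lambda>q. ?a q g)" if "g \<in> carrier G" for g
  proof -
    have "continuous_map ?P euclideanreal (\<lambda>q. ?a q g F)" if "F \<in> ?V" for F
      using eval_cfun[OF tr[OF that \<open>g \<in> carrier G\<close>]] that by (simp add: cfun_def ambit_act_def)
    then show ?thesis
      unfolding fun_topology_def[of G T] continuous_map_componentwise
      by (auto simp: ambit_act_def fun_topology_def)
  qed
  have actS: "?a q g \<in> ?S" if "q \<in> ?S" "g \<in> carrier G" for q g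
  proof -
    have "?a (point_eval G T h) g = point_eval G T (h \<otimes>\<^bsub>G\<^esub> g)" if "h \<in> carrier G" for h
      using tr \<open>g \<in> carrier G\<close> by (auto simp: ambit_act_def point_eval_def)
    then have "(\<lambda>q. ?a q g) ` (point_eval G T ` carrier G) \<subseteq> point_eval G T ` carrier G"
      using that(2) by auto
    then have "?P closure_of ((\<lambda>q. ?a q g) ` (point_eval G T ` carrier G)) \<subseteq> ?S"
      unfolding ambit_points_def by (rule closure_of_mono)
    then show ?thesis
      using continuous_map_image_closure_subset[OF act_cont[OF that(2)]] that(1)
      unfolding ambit_points_def by blast
  qed
  have joint: "continuous_map (prod_topology (subtopology ?P ?S) T) euclideanreal (\<lambda>z. ?a (fst z) (snd z) F)"
    if F: "F \<in> ?V" for F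
  proof (rule continuous_map_realI)
    fix z and e :: real assume z: "z \<in> topspace (prod_topology (subtopology ?P ?S) T)" and e: "e > 0"
    obtain q g where qg: "z = (q, g)" "q \<in> ?S" "g \<in> carrier G"
      using z tS T by (cases z) auto
    have e2: "e / 2 > 0" using e by simp
    obtain V where V: "openin T V" "\<one>\<^bsub>G\<^esub> \<in> V" "\<And>x v. x \<in> carrier G \<Longrightarrow> v \<in> V \<Longrightarrow> \<bar>F (x \<otimes>\<^bsub>G\<^esub> v) - F x\<bar> \<le> e / 2"
      by (rule uniform_funsD[OF F e2]) blast
    \<comment> \<open>This is the neighbourhood \<open>g V\<close> of \<open>g\<close>. For
      \<open>w\<close> in it, \<open>h w\<close> is \<open>h g\<close> moved by an element of
      \<open>V\<close>, uniformly in \<open>h\<close>.\<close>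
    define W where "W = {w \<in> topspace T. inv\<^bsub>G\<^esub> g \<otimes>\<^bsub>G\<^esub> w \<in> V}"
    have m: "continuous_map (prod_topology T T) T (\<lambda>(x, y). x \<otimes>\<^bsub>G\<^esub> y)"
      using G by (auto simp: topological_group_def)
    have "continuous_map T T (\<lambda>x. inv\<^bsub>G\<^esub> g \<otimes>\<^bsub>G\<^esub> x)"
      using continuous_map_compose[OF _ m, of T "\<lambda>x. (inv\<^bsub>G\<^esub> g, x)"] qg T
      by (simp add: continuous_map_pairwise o_def)
    then have W: "openin T W"
      unfolding W_def using V(1) by (rule openin_continuous_map_preimage)
    let ?F = "\<lambda>h. F (h \<otimes>\<^bsub>G\<^esub> g)"
    define N where "N = {p \<in> topspace (subtopology ?P ?S). \<bar>p ?F - q ?F\<bar> < e / 2}"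
    have N: "openin (subtopology ?P ?S) N"
      unfolding N_def using eval_cfun[OF tr[OF F qg(3)]] qg(2) tS e
      by (intro cfun_nbhd) (auto simp: cfun_def intro: continuous_map_from_subtopology)
    have "\<bar>?a p w F - ?a q g F\<bar> < e" if pw: "p \<in> N" "w \<in> W" for p w
    proof -
      have p: "p \<in> ?S" and w: "w \<in> carrier G" "inv\<^bsub>G\<^esub> g \<otimes>\<^bsub>G\<^esub> w \<in> V"
        using pw T tS by (auto simp: N_def W_def)
      have "\<bar>p (\<lambda>h. F (h \<otimes>\<^bsub>G\<^esub> w)) - p ?F\<bar> \<le> e / 2"
      proof (rule state_dist_le[OF ambit_state[OF G p] tr[OF F w(1)] tr[OF F qg(3)]])
        fix h assume h: "h \<in> carrier G"
        have "h \<otimes>\<^bsub>G\<^esub> g \<otimes>\<^bsub>G\<^esub> (inv\<^bsub>G\<^esub> g \<otimes>\<^bsub>G\<^esub> w) = h \<otimes>\<^bsub>G\<^esub> w"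
          using h qg(3) w(1) by (metis inv_closed m_assoc m_closed r_inv r_one)
        then show "\<bar>F (h \<otimes>\<^bsub>G\<^esub> w) - F (h \<otimes>\<^bsub>G\<^esub> g)\<bar> \<le> e / 2"
          using V(3)[of "h \<otimes>\<^bsub>G\<^esub> g" "inv\<^bsub>G\<^esub> g \<otimes>\<^bsub>G\<^esub> w"] h qg(3) w(2) by simp
      qed
      moreover have "\<bar>p ?F - q ?F\<bar> < e / 2"
        using pw by (simp add: N_def)
      ultimately have "\<bar>p (\<lambda>h. F (h \<otimes>\<^bsub>G\<^esub> w)) - q ?F\<bar> < e"
        by linarith
      then show ?thesis
        using F by (simp add: ambit_act_def)
    qed
    moreover have "openin (prod_topology (subtopology ?P ?S) T) (N \<times> W)"
      using N W by (simp add: openin_prod_Times_iff)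
    moreover have "z \<in> N \<times> W"
      using qg e tS T V(2) by (auto simp: N_def W_def)
    ultimately show "\<exists>U. openin (prod_topology (subtopology ?P ?S) T) U \<and> z \<in> U \<and>
        (\<forall>y\<in>U. \<bar>?a (fst y) (snd y) F - ?a (fst z) (snd z) F\<bar> < e)"
      using qg(1) by (intro exI[of _ "N \<times> W"]) auto
  qed
  show ?thesis
    unfolding flow_def tS
  proof (intro conjI ballI)
    show "compact_space (subtopology ?P ?S)"
      using compact by (rule compact_space_subtopology)
    show "Hausdorff_space (subtopology ?P ?S)"
      unfolding fun_topology_def by (intro Hausdorff_space_subtopology) (simp add: Hausdorff_space_product_topology)
    show "?S \<noteq> {}"
      using pe[OF one_closed] by blast
    have "continuous_map (prod_topology (subtopology ?P ?S) T) ?P (\<lambda>z. ?a (fst z) (snd z))"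
      using joint unfolding fun_topology_def[of G T] continuous_map_componentwise
      by (auto simp: ambit_act_def fun_topology_def)
    then show "continuous_map (prod_topology (subtopology ?P ?S) T) (subtopology ?P ?S) (\<lambda>(x, g). ?a x g)"
      using actS T SP by (auto simp: continuous_map_in_subtopology case_prod_unfold)
    fix q assume q: "q \<in> ?S"
    note st = ambit_state[OF G q]
    show "?a q \<one>\<^bsub>G\<^esub> = q"
    proof (rule extensionalityI[of _ ?V])
      fix F assume F: "F \<in> ?V"
      then show "?a q \<one>\<^bsub>G\<^esub> F = q F"
        using state_cong[OF st tr[OF F one_closed] F] by (simp add: ambit_act_def)
    qed (use ext[OF q] in \<open>auto simp: ambit_act_def\<close>)
    fix g h assume g: "g \<in> carrier G" and h: "h \<in> carrier G"
    show "?a (?a q g) h = ?a q (g \<otimes>\<^bsub>G\<^esub> h)"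
    proof (rule extensionalityI[of _ ?V])
      fix F assume F: "F \<in> ?V"
      have "q (\<lambda>x. F (x \<otimes>\<^bsub>G\<^esub> g \<otimes>\<^bsub>G\<^esub> h)) = q (\<lambda>x. F (x \<otimes>\<^bsub>G\<^esub> (g \<otimes>\<^bsub>G\<^esub> h)))"
        using tr[OF tr[OF F h] g] tr[OF F m_closed[OF g h]] g h
        by (intro state_cong[OF st]) (auto simp: m_assoc)
      then show "?a (?a q g) h F = ?a q (g \<otimes>\<^bsub>G\<^esub> h) F"
        using F tr[OF F h] by (simp add: ambit_act_def)
    qed (auto simp: ambit_act_def)
  qed
qed

text \<open>The greatest ambit contains a minimal subflow, and \<open>U\<close> maps onto it. From
  here on the universality of \<open>U\<close> is used only through \<open>\<psi>\<close>, a
  continuous equivariant family of states on \<open>group_funs\<close>.\<close>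

lemma universal_ambit_map:
  assumes G: "topological_group G T" and U: "is_universal_minimal_flow G T U a"
  obtains \<psi> where "\<And>u. u \<in> topspace U \<Longrightarrow> \<psi> u \<in> ambit_points G T"
    and "\<And>F. F \<in> group_funs G T \<Longrightarrow> (\<lambda>u. \<psi> u F) \<in> cfun U"
    and "\<And>u g F. u \<in> topspace U \<Longrightarrow> g \<in> carrier G \<Longrightarrow> F \<in> group_funs G T \<Longrightarrow>
      \<psi> (a u g) F = \<psi> u (\<lambda>h. F (h \<otimes>\<^bsub>G\<^esub> g))"
proof -
  let ?S = "subtopology (fun_topology G T) (ambit_points G T)"
  obtain Z where Z: "Z \<subseteq> topspace ?S" "minimal_flow G T (subtopology ?S Z) (ambit_act G T)"
    using minimal_subflow_exists[OF G ambit_flow[OF G]] by blast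
  obtain \<psi> where \<psi>: "flow_map G U a (subtopology ?S Z) (ambit_act G T) \<psi>"
    using universal_minimal_flow_onto[OF G U Z(2)] by blast
  then have c: "continuous_map U ?S \<psi>" and eq: "\<And>u g. u \<in> topspace U \<Longrightarrow> g \<in> carrier G \<Longrightarrow> \<psi> (a u g) = ambit_act G T (\<psi> u) g"
    by (auto simp: flow_map_def continuous_map_in_subtopology)
  show ?thesis
  proof
    show "\<psi> u \<in> ambit_points G T" if "u \<in> topspace U" for u
      using c that continuous_map_image_subset_topspace[OF c] by auto
    show "(\<lambda>u. \<psi> u F) \<in> cfun U" if "F \<in> group_funs G T" for F
      using continuous_map_compose[of U "fun_topology G T" \<psi>] c eval_cfun[OF that]
      by (auto simp: cfun_def continuous_map_in_subtopology o_def)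
    show "\<psi> (a u g) F = \<psi> u (\<lambda>h. F (h \<otimes>\<^bsub>G\<^esub> g))"
      if "u \<in> topspace U" "g \<in> carrier G" "F \<in> group_funs G T" for u g F
      using eq that by (simp add: ambit_act_def)
  qed
qed

section \<open>Invariant extensions of positive functionals\<close>

text \<open>Amenability: the states \<open>\<psi> u\<close> are averaged against the invariant state
  \<open>m\<close>.\<close>

lemma invariant_mean_exists:
  assumes G: "topological_group G T" and U: "is_universal_minimal_flow G T U a"
    and m: "invariant_state G (topspace U) a (cfun U) m"
  obtains n where "invariant_state G (carrier G) (\<otimes>\<^bsub>G\<^esub>) (group_funs G T) n"
proof -
  have grp: "group G" and T: "topspace T = carrier G"
    using G by (auto simp: topological_group_def)
  obtain \<psi> where \<psi>: "\<And>u. u \<in> topspace U \<Longrightarrow> \<psi> u \<in> ambit_points G T"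
    "\<And>F. F \<in> group_funs G T \<Longrightarrow> (\<lambda>u. \<psi> u F) \<in> cfun U"
    "\<And>u g F. u \<in> topspace U \<Longrightarrow> g \<in> carrier G \<Longrightarrow> F \<in> group_funs G T \<Longrightarrow>
      \<psi> (a u g) F = \<psi> u (\<lambda>h. F (h \<otimes>\<^bsub>G\<^esub> g))"
    using universal_ambit_map[OF G U] by blast
  have st: "state (topspace U) (cfun U) m"
    using m by (simp add: invariant_state_def)
  note s\<psi> = ambit_state[OF G \<psi>(1)]
  have S: "fun_space (group_funs G T)"
    by (rule fun_space_uniform[OF T grp])
  have tr: "(\<lambda>h. F (h \<otimes>\<^bsub>G\<^esub> g)) \<in> group_funs G T" if "F \<in> group_funs G T" "g \<in> carrier G" for F g
    using translate_fun[OF G action_group[OF grp] that] by simp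
  define n where "n F = m (\<lambda>u. \<psi> u F)" for F
  have "state (carrier G) (group_funs G T) n"
    unfolding n_def[abs_def] by (rule state_compose[where \<Phi> = "\<lambda>F u. \<psi> u F", OF st S \<psi>(2) s\<psi>])
  moreover have "n (\<lambda>x. F (x \<otimes>\<^bsub>G\<^esub> g)) = n F" if g: "g \<in> carrier G" and F: "F \<in> group_funs G T" for g F
  proof -
    have fl: "flow G T U a"
      using U by (simp add: is_universal_minimal_flow_def minimal_flow_def)
    have "(\<lambda>u. \<psi> (a u g) F) \<in> cfun U"
      using continuous_map_compose[OF flow_act_continuous[OF fl T g]] \<psi>(2)[OF F] by (simp add: cfun_def o_def)
    then have "n (\<lambda>x. F (x \<otimes>\<^bsub>G\<^esub> g)) = m (\<lambda>u. \<psi> (a u g) F)"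
      unfolding n_def using \<psi>(2)[OF tr[OF F g]] \<psi>(3)[OF _ g F]
      by (intro state_cong[OF st]) auto
    also have "\<dots> = n F"
      unfolding n_def by (rule invariant_stateD[OF m g \<psi>(2)[OF F]])
    finally show ?thesis .
  qed
  ultimately show ?thesis
    by (intro that[of n]) (auto simp: invariant_state_def)
qed

text \<open>The graph of a partial positive normalized functional. Graphs make the union of a chain
  in Zorn's lemma immediate; that they are single-valued follows from positivity through
  \<open>positive_graph_mono\<close>.\<close>

definition positive_graph :: "'x set \<Rightarrow> (('x \<Rightarrow> real) \<times> real) set \<Rightarrow> bool" where
  "positive_graph D L \<longleftrightarrow>
     (\<forall>f c g d. (f, c) \<in> L \<longrightarrow> (g, d) \<in> L \<longrightarrow> (\<lambda>x. f x + g x, c + d) \<in> L) \<and>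
     (\<forall>t f c. (f, c) \<in> L \<longrightarrow> (\<lambda>x. t * f x, t * c) \<in> L) \<and> (\<lambda>_. 1, 1) \<in> L \<and>
     (\<forall>f c. (f, c) \<in> L \<longrightarrow> (\<forall>x\<in>D. 0 \<le> f x) \<longrightarrow> 0 \<le> c)"

lemma positive_graphD:
  assumes "positive_graph D L"
  shows "(f, c) \<in> L \<Longrightarrow> (g, d) \<in> L \<Longrightarrow> (\<lambda>x. f x + g x, c + d) \<in> L"
    and "(f, c) \<in> L \<Longrightarrow> (\<lambda>x. t * f x, t * c) \<in> L"
    and "(\<lambda>_. 1, 1) \<in> L" and "(\<lambda>_. r, r) \<in> L"
    and "(f, c) \<in> L \<Longrightarrow> (\<And>x. x \<in> D \<Longrightarrow> 0 \<le> f x) \<Longrightarrow> 0 \<le> c"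
proof -
  show 1: "(\<lambda>_. 1, 1) \<in> L"
    using assms by (simp add: positive_graph_def)
  show sc: "(\<lambda>x. t * f x, t * c) \<in> L" if "(f, c) \<in> L" for t f c
    using assms that by (simp add: positive_graph_def)
  show "(\<lambda>_. r, r) \<in> L"
    using sc[OF 1, of r] by simp
qed (use assms in \<open>auto simp: positive_graph_def\<close>)

lemma positive_graph_mono:
  assumes L: "positive_graph D L" and "(f, c) \<in> L" "(g, d) \<in> L" "\<And>x. x \<in> D \<Longrightarrow> f x \<le> g x"
  shows "c \<le> d"
proof -
  have "(\<lambda>x. g x + -1 * f x, d + -1 * c) \<in> L"
    by (intro positive_graphD(1)[OF L] positive_graphD(2)[OF L] assms)
  from positive_graphD(5)[OF L this] show ?thesis
    using assms(4) by simp
qed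

text \<open>One step of Hahn-Banach. The new value \<open>c0\<close> is the infimum over majorants
  of \<open>f\<close> in the domain. It is finite because \<open>f\<close> is bounded and the domain
  contains the constants, and by monotonicity it also dominates the values on minorants.\<close>

lemma positive_graph_extend:
  assumes L: "positive_graph D L" and f: "f \<in> bounded_funs D"
  obtains L' c where "positive_graph D L'" "L \<subseteq> L'" "(f, c) \<in> L'"
proof -
  obtain B where B: "\<And>x. x \<in> D \<Longrightarrow> \<bar>f x\<bar> \<le> B"
    using f by (auto simp: bounded_funs_def)
  define A where "A = {c. \<exists>g. (g, c) \<in> L \<and> (\<forall>x\<in>D. f x \<le> g x)}"
  define c0 where "c0 = Inf A"
  have BA: "B \<in> A"
    unfolding A_def using B positive_graphD(4)[OF L, of B] by (auto simp: abs_le_iff)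
  have "- B \<le> c" if "c \<in> A" for c
    using that B positive_graph_mono[OF L positive_graphD(4)[OF L, of "- B"]]
    unfolding A_def by (force simp: abs_le_iff)
  then have bdd: "bdd_below A"
    by (rule bdd_belowI)
  have upper: "c0 \<le> c" if "(g, c) \<in> L" "\<And>x. x \<in> D \<Longrightarrow> f x \<le> g x" for g c
    unfolding c0_def using that by (intro cInf_lower bdd) (auto simp: A_def)
  have lower: "c \<le> c0" if "(g, c) \<in> L" "\<And>x. x \<in> D \<Longrightarrow> g x \<le> f x" for g c
    unfolding c0_def
  proof (rule cInf_greatest)
    fix d assume "d \<in> A"
    then obtain g' where "(g', d) \<in> L" "\<And>x. x \<in> D \<Longrightarrow> f x \<le> g' x"
      by (auto simp: A_def)
    then show "c \<le> d"
      using positive_graph_mono[OF L that(1)] that(2) order_trans by metis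
  qed (use BA in blast)
  define L' where "L' = {(\<lambda>x. g x + t * f x, c + t * c0) |g c t. (g, c) \<in> L}"
  have L'I: "(\<lambda>x. g x + t * f x, c + t * c0) \<in> L'" if "(g, c) \<in> L" for g c t
    using that by (auto simp: L'_def)
  have "positive_graph D L'"
    unfolding positive_graph_def
  proof (intro conjI allI impI)
    fix p c q d assume "(p, c) \<in> L'" "(q, d) \<in> L'"
    then obtain g c1 t h d1 s where *: "p = (\<lambda>x. g x + t * f x)" "c = c1 + t * c0" "(g, c1) \<in> L"
      "q = (\<lambda>x. h x + s * f x)" "d = d1 + s * c0" "(h, d1) \<in> L"
      unfolding L'_def by blast
    show "(\<lambda>x. p x + q x, c + d) \<in> L'"
      using L'I[OF positive_graphD(1)[OF L *(3,6)], of "t + s"] * by (simp add: algebra_simps)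
  next
    fix r p c assume "(p, c) \<in> L'"
    then obtain g c1 t where *: "p = (\<lambda>x. g x + t * f x)" "c = c1 + t * c0" "(g, c1) \<in> L"
      unfolding L'_def by blast
    show "(\<lambda>x. r * p x, r * c) \<in> L'"
      using L'I[OF positive_graphD(2)[OF L *(3), of r], of "r * t"] * by (simp add: algebra_simps)
  next
    show "(\<lambda>_. 1, 1) \<in> L'"
      using L'I[OF positive_graphD(3)[OF L], of 0] by simp
  next
    fix p c assume "(p, c) \<in> L'" and nn: "\<forall>x\<in>D. 0 \<le> p x"
    then obtain g c1 t where *: "p = (\<lambda>x. g x + t * f x)" "c = c1 + t * c0" "(g, c1) \<in> L"
      unfolding L'_def by blast
    \<comment> \<open>Dividing \<open>g + t f \<ge> 0\<close> by \<open>t\<close> makes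
      \<open>- g / t\<close> a minorant of \<open>f\<close> for positive \<open>t\<close> and a
      majorant for negative \<open>t\<close>.\<close>
    consider "t = 0" | "t > 0" | "t < 0" by linarith
    then show "0 \<le> c"
    proof cases
      case 1
      then show ?thesis
        using positive_graphD(5)[OF L *(3)] nn * by simp
    next
      case 2
      have "- (1 / t) * c1 \<le> c0"
      proof (rule lower[OF positive_graphD(2)[OF L *(3)]])
        fix x assume "x \<in> D"
        then have "0 \<le> g x + t * f x"
          using nn * by simp
        then show "- (1 / t) * g x \<le> f x"
          using 2 by (simp add: field_simps)
      qed
      then show ?thesis
        using 2 * by (simp add: field_simps)
    next
      case 3
      have "c0 \<le> - (1 / t) * c1"
      proof (rule upper[OF positive_graphD(2)[OF L *(3)]])
        fix x assume "x \<in> D"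
        then have "0 \<le> g x + t * f x"
          using nn * by simp
        then show "f x \<le> - (1 / t) * g x"
          using 3 by (simp add: field_simps)
      qed
      then show ?thesis
        using 3 * by (simp add: field_simps)
    qed
  qed
  moreover have "L \<subseteq> L'"
    using L'I[where t = 0] by auto
  moreover have "(f, c0) \<in> L'"
    using L'I[OF positive_graphD(4)[OF L, of 0], of 1] by simp
  ultimately show ?thesis
    using that by blast
qed

lemma positive_extension:
  assumes L: "positive_graph D L" and D: "L \<subseteq> bounded_funs D \<times> UNIV"
  obtains I where "state D (bounded_funs D) I" "\<And>f c. (f, c) \<in> L \<Longrightarrow> I f = c"
proof -
  define \<A> where "\<A> = {L'. positive_graph D L' \<and> L \<subseteq> L'}"
  have "\<exists>M\<in>\<A>. \<forall>N\<in>\<A>. M \<subseteq> N \<longrightarrow> N = M"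
  proof (rule subset_Zorn_nonempty)
    show "\<A> \<noteq> {}"
      using L by (auto simp: \<A>_def)
    fix \<C> assume \<C>: "\<C> \<noteq> {}" "subset.chain \<A> \<C>"
    have pg: "positive_graph D L'" and sub: "L \<subseteq> L'" if "L' \<in> \<C>" for L'
      using \<C>(2) that by (auto simp: subset_chain_def \<A>_def)
    have lin: "L1 \<subseteq> L2 \<or> L2 \<subseteq> L1" if "L1 \<in> \<C>" "L2 \<in> \<C>" for L1 L2
      using \<C>(2) that by (auto simp: subset_chain_def)
    have "positive_graph D (\<Union>\<C>)"
      unfolding positive_graph_def
    proof (intro conjI allI impI)
      fix f c g d assume "(f, c) \<in> \<Union>\<C>" "(g, d) \<in> \<Union>\<C>"
      then obtain L1 L2 where 12: "(f, c) \<in> L1" "(g, d) \<in> L2" "L1 \<in> \<C>" "L2 \<in> \<C>"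
        by blast
      then obtain L3 where "L3 \<in> \<C>" "(f, c) \<in> L3" "(g, d) \<in> L3"
        using lin[OF 12(3,4)] by blast
      then show "(\<lambda>x. f x + g x, c + d) \<in> \<Union>\<C>"
        using positive_graphD(1)[OF pg] by blast
    next
      fix t f c assume "(f, c) \<in> \<Union>\<C>"
      then show "(\<lambda>x. t * f x, t * c) \<in> \<Union>\<C>"
        using positive_graphD(2)[OF pg] by blast
    next
      show "(\<lambda>_. 1, 1) \<in> \<Union>\<C>"
        using \<C>(1) positive_graphD(3)[OF pg] by blast
    next
      fix f c assume "(f, c) \<in> \<Union>\<C>" "\<forall>x\<in>D. 0 \<le> f x"
      then show "0 \<le> c"
        using positive_graphD(5)[OF pg] by blast
    qed
    moreover have "L \<subseteq> \<Union>\<C>"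
      using \<C>(1) sub by blast
    ultimately show "\<Union>\<C> \<in> \<A>"
      by (simp add: \<A>_def)
  qed
  then obtain M where M: "positive_graph D M" "L \<subseteq> M"
    and max: "\<And>N. positive_graph D N \<Longrightarrow> M \<subseteq> N \<Longrightarrow> N = M"
    unfolding \<A>_def by (smt (verit) mem_Collect_eq subset_trans)
  have ex: "\<exists>c. (f, c) \<in> M" if "f \<in> bounded_funs D" for f
    using positive_graph_extend[OF M(1) that] max by metis
  have unique: "c = d" if "(f, c) \<in> M" "(f, d) \<in> M" for f c d
    using positive_graph_mono[OF M(1) that] positive_graph_mono[OF M(1) that(2,1)] by force
  define I where "I f = (THE c. (f, c) \<in> M)" for f
  have I: "I f = c" if "(f, c) \<in> M" for f c
    unfolding I_def using that unique by blast
  have I': "(f, I f) \<in> M" if "f \<in> bounded_funs D" for f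
    using ex[OF that] I by blast
  have "state D (bounded_funs D) I"
    unfolding state_def
  proof (intro conjI ballI allI impI fun_space_bounded)
    show "0 \<le> I f" if "f \<in> bounded_funs D" "\<forall>x\<in>D. 0 \<le> f x" for f
      using positive_graphD(5)[OF M(1) I'[OF that(1)]] that(2) by blast
  qed (intro I positive_graphD[OF M(1)] I'; assumption)+
  then show ?thesis
    using that I M(2) by blast
qed

text \<open>A positive extension \<open>J\<close> to all bounded functions is not invariant. But
  \<open>k f\<close>, which records the values of \<open>J\<close> on all translates of
  \<open>f\<close>, is uniformly continuous on the group, so the mean \<open>n\<close> can average
  it. For \<open>f\<close> in the domain of \<open>L\<close> nothing changes: all translates have
  the same value there, and \<open>k f\<close> is constant.\<close>

lemma invariant_extension:
  assumes G: "topological_group G T" and a: "action G D a"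
    and n: "invariant_state G (carrier G) (\<otimes>\<^bsub>G\<^esub>) (group_funs G T) n"
    and L: "positive_graph D L" "L \<subseteq> uniform_funs G T D a \<times> UNIV"
    and inv: "\<And>f c g. (f, c) \<in> L \<Longrightarrow> g \<in> carrier G \<Longrightarrow> (\<lambda>x. f (a x g), c) \<in> L"
  obtains I where "invariant_state G D a (uniform_funs G T D a) I" "\<And>f c. (f, c) \<in> L \<Longrightarrow> I f = c"
proof -
  let ?V = "uniform_funs G T D a"
  have grp: "group G" and T: "topspace T = carrier G"
    using G by (auto simp: topological_group_def)
  interpret group G by fact
  have VB: "?V \<subseteq> bounded_funs D"
    by (auto simp: uniform_funs_def)
  obtain J where J: "state D (bounded_funs D) J" "\<And>f c. (f, c) \<in> L \<Longrightarrow> J f = c"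
  proof (rule positive_extension[OF L(1)])
    show "L \<subseteq> bounded_funs D \<times> UNIV"
      using L(2) VB by blast
  qed blast
  have st: "state (carrier G) (group_funs G T) n"
    using n by (simp add: invariant_state_def)
  have tr: "(\<lambda>x. f (a x g)) \<in> ?V" if "f \<in> ?V" "g \<in> carrier G" for f g
    by (rule translate_fun[OF G a that])
  have trB: "(\<lambda>x. f (a x g)) \<in> bounded_funs D" if "f \<in> ?V" "g \<in> carrier G" for f g
    using tr[OF that] VB by blast
  define k where "k f = (\<lambda>h. J (\<lambda>x. f (a x h)))" for f
  have k: "k f \<in> group_funs G T" if f: "f \<in> ?V" for f
  proof -
    obtain B where B: "\<And>x. x \<in> D \<Longrightarrow> \<bar>f x\<bar> \<le> B"
      by (rule uniform_funs_bounded[OF f]) blast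
    show ?thesis
    proof (rule uniform_funsI)
      show "\<bar>k f h\<bar> \<le> B" if "h \<in> carrier G" for h
        using state_dist_le[OF J(1) trB[OF f that] fun_space_const[OF fun_space_bounded, of 0]]
          B action_in[OF a _ that] state_const[OF J(1)] by (simp add: k_def)
      fix e :: real assume e: "e > 0"
      obtain V where V: "openin T V" "\<one>\<^bsub>G\<^esub> \<in> V" "\<And>x v. x \<in> D \<Longrightarrow> v \<in> V \<Longrightarrow> \<bar>f (a x v) - f x\<bar> \<le> e"
        by (rule uniform_funsD[OF f e]) blast
      have "\<bar>k f (h \<otimes>\<^bsub>G\<^esub> v) - k f h\<bar> \<le> e" if "h \<in> carrier G" "v \<in> V" for h v
      proof -
        have v: "v \<in> carrier G"
          using openin_subset[OF V(1)] T that by auto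
        show ?thesis
          unfolding k_def
          using that v V(3)[OF action_in[OF a _ that(1)] that(2)] action_mult[OF a _ that(1) v]
          by (intro state_dist_le[OF J(1)] trB[OF f]) auto
      qed
      then show "\<exists>V. openin T V \<and> \<one>\<^bsub>G\<^esub> \<in> V \<and> (\<forall>h\<in>carrier G. \<forall>v\<in>V. \<bar>k f (h \<otimes>\<^bsub>G\<^esub> v) - k f h\<bar> \<le> e)"
        using V(1,2) by blast
    qed
  qed
  have S: "fun_space ?V" and SG: "fun_space (group_funs G T)"
    by (rule fun_space_uniform[OF T grp])+
  define I where "I f = n (k f)" for f
  have "state D ?V I"
    unfolding I_def[abs_def]
  proof (rule state_compose[OF st S k])
    show "state D ?V (\<lambda>f. k f h)" if "h \<in> carrier G" for h
      unfolding k_def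
      by (rule state_pullback[where k = "\<lambda>x. a x h", OF J(1) S trB action_in[OF a]]) (use that in auto)
  qed
  moreover have "I (\<lambda>x. f (a x g)) = I f" if g: "g \<in> carrier G" and f: "f \<in> ?V" for g f
  proof -
    have "k (\<lambda>x. f (a x g)) h = k f (h \<otimes>\<^bsub>G\<^esub> g)" if h: "h \<in> carrier G" for h
      unfolding k_def
      using trB[OF tr[OF f g] h] trB[OF f m_closed[OF h g]] action_mult[OF a _ h g]
      by (intro state_cong[OF J(1)]) auto
    then have "I (\<lambda>x. f (a x g)) = n (\<lambda>h. k f (h \<otimes>\<^bsub>G\<^esub> g))"
      unfolding I_def using k[OF tr[OF f g]] translate_fun[OF G action_group[OF grp] k[OF f] g]
      by (intro state_cong[OF st]) auto
    also have "\<dots> = I f"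
      unfolding I_def by (rule invariant_stateD[OF n g k[OF f]])
    finally show ?thesis .
  qed
  moreover have "I f = c" if fc: "(f, c) \<in> L" for f c
  proof -
    have "n (k f) = n (\<lambda>_. c)"
      using k[of f] L(2) fc J(2)[OF inv[OF fc]] fun_space_const[OF SG]
      by (intro state_cong[OF st]) (auto simp: k_def)
    then show ?thesis
      by (simp add: I_def state_const[OF st])
  qed
  ultimately show ?thesis
    by (intro that[of I]) (auto simp: invariant_state_def)
qed

section \<open>Equicontinuity on metrizable flows\<close>

text \<open>True at point evaluations and preserved by limits. It reflects that ambit points are
  multiplicative, and it fails for general states.\<close>

lemma ambit_compose:
  assumes q: "q \<in> ambit_points G T" and F: "F \<in> group_funs G T" "(\<lambda>h. \<theta> (F h)) \<in> group_funs G T"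
    and c: "continuous_on UNIV \<theta>"
  shows "q (\<lambda>h. \<theta> (F h)) = \<theta> (q F)"
proof -
  have "(\<lambda>p. \<theta> (p F)) \<in> cfun (fun_topology G T)"
    using continuous_map_compose[of _ euclideanreal "\<lambda>p. p F" euclideanreal \<theta>] eval_cfun[OF F(1)] c
    by (simp add: cfun_def o_def)
  from ambit_closed[OF q cfun_abs_diff[OF eval_cfun[OF F(2)] this], of 0]
  have "\<bar>q (\<lambda>h. \<theta> (F h)) - \<theta> (q F)\<bar> \<le> 0"
    by (simp add: point_eval_def F)
  then show ?thesis
    by simp
qed

lemma abs_SUP_diff_le:
  fixes f g :: "'i \<Rightarrow> real"
  assumes "I \<noteq> {}" "\<And>i. i \<in> I \<Longrightarrow> \<bar>f i\<bar> \<le> B" "\<And>i. i \<in> I \<Longrightarrow> \<bar>g i\<bar> \<le> B"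
    and "\<And>i. i \<in> I \<Longrightarrow> \<bar>f i - g i\<bar> \<le> e"
  shows "\<bar>(SUP i\<in>I. f i) - (SUP i\<in>I. g i)\<bar> \<le> e"
proof -
  have "bdd_above (f ` I)" "bdd_above (g ` I)"
    using assms(2,3) by (auto intro!: bdd_aboveI[where M = B] simp: abs_le_iff)
  then have f: "f i \<le> (SUP i\<in>I. f i)" and g: "g i \<le> (SUP i\<in>I. g i)" if "i \<in> I" for i
    using that by (auto intro: cSUP_upper)
  have "(SUP i\<in>I. f i) \<le> (SUP i\<in>I. g i) + e"
  proof (rule cSUP_least[OF assms(1)])
    fix i assume "i \<in> I"
    then show "f i \<le> (SUP i\<in>I. g i) + e"
      using g[of i] assms(4)[of i] by (simp add: abs_le_iff)
  qed
  moreover have "(SUP i\<in>I. g i) \<le> (SUP i\<in>I. f i) + e"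
  proof (rule cSUP_least[OF assms(1)])
    fix i assume "i \<in> I"
    then show "g i \<le> (SUP i\<in>I. f i) + e"
      using f[of i] assms(4)[of i] by (simp add: abs_le_iff)
  qed
  ultimately show ?thesis
    by linarith
qed

text \<open>A subsequence is separated by a uniformly continuous function close to \<open>1\<close> at its even terms and
  to \<open>0\<close> at its odd ones: the supremum of bumps, each an \<open>F\<close> minus the maximum of its predecessors.\<close>

lemma ambit_sequence_separation:
  fixes q :: "nat \<Rightarrow> ('g \<Rightarrow> real) \<Rightarrow> real" and F :: "nat \<Rightarrow> 'g \<Rightarrow> real"
  assumes T: "topspace T = carrier G"
    and q: "\<And>n. q n \<in> ambit_points G T"
    and lim: "\<And>F. F \<in> group_funs G T \<Longrightarrow> convergent (\<lambda>n. q n F)"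
    and F: "\<And>n h. h \<in> carrier G \<Longrightarrow> 0 \<le> F n h \<and> F n h \<le> 1"
    and equi: "equi_uniform G T (carrier G) (\<otimes>\<^bsub>G\<^esub>) (range F)"
    and mG: "\<And>x y. x \<in> carrier G \<Longrightarrow> y \<in> carrier G \<Longrightarrow> x \<otimes>\<^bsub>G\<^esub> y \<in> carrier G"
    and one: "\<And>n. q n (F n) = 1" and zero: "\<And>j. (\<lambda>n. q n (F j)) \<longlonglongrightarrow> 0"
  shows False
proof -
  have FG: "F n \<in> group_funs G T" for n
    using equi_uniform_mono[OF equi, of "{F n}"] F
    by (auto simp: uniform_funs_def bounded_funs_def intro!: exI[of _ 1])
  have ev: "eventually (\<lambda>n. q n (F j) < 1/4) sequentially" for j
    using order_tendstoD(2)[OF zero, of "1/4"] by simp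
  \<comment> \<open>Only finitely many conditions are imposed at a time, so the indices can be
    thinned until each \<open>q (r k)\<close> is small at all earlier \<open>F (r j)\<close>. Its
    values at later \<open>F (r j)\<close> remain uncontrolled.\<close>
  have "\<exists>m>n. \<forall>j\<le>n. q m (F j) < 1/4" for n
  proof -
    have "eventually (\<lambda>m. \<forall>j\<in>{..n}. q m (F j) < 1/4) sequentially"
      using ev by (intro eventually_ball_finite) auto
    then have "eventually (\<lambda>m. m > n \<and> (\<forall>j\<le>n. q m (F j) < 1/4)) sequentially"
      using eventually_gt_at_top[of n] by eventually_elim auto
    then show ?thesis
      by (rule eventually_happens'[rotated]) simp
  qed
  then have "\<exists>r. \<forall>k. r (Suc k) > r k \<and> (\<forall>j\<le>r k. q (r (Suc k)) (F j) < 1/4)"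
    using dependent_nat_choice[of "\<lambda>_ _. True" "\<lambda>_ n m. m > n \<and> (\<forall>j\<le>n. q m (F j) < 1/4)"] by simp
  then obtain r :: "nat \<Rightarrow> nat" where "\<forall>k. r (Suc k) > r k \<and> (\<forall>j\<le>r k. q (r (Suc k)) (F j) < 1/4)" ..
  then have r: "\<And>k. r (Suc k) > r k" "\<And>k j. j \<le> r k \<Longrightarrow> q (r (Suc k)) (F j) < 1/4"
    by auto
  have sm: "strict_mono r"
    using r(1) by (simp add: strict_mono_Suc_iff)
  have small: "q (r k) (F (r j)) < 1/4" if jk: "j < k" for j k
  proof -
    obtain k' where "k = Suc k'"
      using jk by (cases k) auto
    with jk r(2)[of "r j" k'] sm show ?thesis
      by (simp add: strict_mono_less_eq)
  qed
  define M where "M k h = Max (insert 0 ((\<lambda>j. F (r j) h) ` {..<k}))" for k h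
  have M_ge: "F (r j) h \<le> M k h" if "j < k" for j k h
    unfolding M_def using that by (intro Max_ge) auto
  have M_le: "M k h \<le> c" if "0 \<le> c" "\<And>j. j < k \<Longrightarrow> F (r j) h \<le> c" for k h c
    unfolding M_def using that by (intro Max.boundedI) auto
  have M_0: "0 \<le> M k h" for k h
    unfolding M_def by (intro Max_ge) auto
  have M_mod: "M k h \<le> M k h' + e" if "\<And>j. F (r j) h \<le> F (r j) h' + e" "e \<ge> 0" for k h h' e
  proof (rule M_le)
    show "0 \<le> M k h' + e"
      using M_0[of k h'] that(2) by simp
    show "F (r j) h \<le> M k h' + e" if "j < k" for j
      using M_ge[OF that, of h'] \<open>\<And>j. F (r j) h \<le> F (r j) h' + e\<close>[of j] by linarith
  qed
  \<comment> \<open>Subtracting \<open>M\<close> disposes of the uncontrolled order: where an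
    earlier function is near 1, every later bump is near 0. Odd bumps are dropped to create the
    oscillation.\<close>
  define g where "g k h = (if even k then max 0 (F (r k) h - M k h) else 0)" for k :: nat and h
  define K where "K h = (SUP k. g k h)" for h
  have g01: "0 \<le> g k h \<and> g k h \<le> 1" if "h \<in> carrier G" for k h
    using F[OF that, of "r k"] M_0[of k h] by (simp add: g_def)
  have g_le: "g k h \<le> K h" if "h \<in> carrier G" for k h
    unfolding K_def using g01[OF that] by (intro cSUP_upper bdd_aboveI[where M = 1]) auto
  have KG: "K \<in> group_funs G T"
  proof (rule uniform_funsI)
    show "\<bar>K h\<bar> \<le> 1" if "h \<in> carrier G" for h
    proof -
      have "0 \<le> K h"
        using g01[OF that, of 0] g_le[OF that, of 0] by linarith
      moreover have "K h \<le> 1"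
        unfolding K_def using g01[OF that] by (intro cSUP_least) auto
      ultimately show ?thesis
        by simp
    qed
    fix e :: real assume e: "e > 0"
    then have "e / 2 > 0" by simp
    then obtain V where V: "openin T V" "\<one>\<^bsub>G\<^esub> \<in> V"
      "\<And>f h v. f \<in> range F \<Longrightarrow> h \<in> carrier G \<Longrightarrow> v \<in> V \<Longrightarrow> \<bar>f (h \<otimes>\<^bsub>G\<^esub> v) - f h\<bar> \<le> e / 2"
      by (rule equi_uniformD[OF equi]) blast
    have "\<bar>K (h \<otimes>\<^bsub>G\<^esub> v) - K h\<bar> \<le> e" if hv: "h \<in> carrier G" "v \<in> V" for h v
    proof -
      have v: "v \<in> carrier G"
        using openin_subset[OF V(1)] T hv by auto
      have d: "\<bar>F n (h \<otimes>\<^bsub>G\<^esub> v) - F n h\<bar> \<le> e / 2" for n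
        using V(3)[OF _ hv] by blast
      have d': "F n (h \<otimes>\<^bsub>G\<^esub> v) \<le> F n h + e / 2" "F n h \<le> F n (h \<otimes>\<^bsub>G\<^esub> v) + e / 2" for n
        using d[of n] by linarith+
      have e2: "0 \<le> e / 2"
        using e by simp
      \<comment> \<open>\<open>F\<close> and the maximum of its predecessors each move by at most
        \<open>e / 2\<close>. The bound does not depend on \<open>k\<close>, so it survives the
        supremum.\<close>
      have "\<bar>g k (h \<otimes>\<^bsub>G\<^esub> v) - g k h\<bar> \<le> e" for k
        using M_mod[OF d'(1) e2, of k] M_mod[OF d'(2) e2, of k] d'[of "r k"] e
        by (simp add: g_def max_def abs_le_iff)
      then show ?thesis
        unfolding K_def using g01[OF hv(1)] g01[OF mG[OF hv(1) v]]
        by (intro abs_SUP_diff_le[where B = 1]) auto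
    qed
    then show "\<exists>V. openin T V \<and> \<one>\<^bsub>G\<^esub> \<in> V \<and> (\<forall>h\<in>carrier G. \<forall>v\<in>V. \<bar>K (h \<otimes>\<^bsub>G\<^esub> v) - K h\<bar> \<le> e)"
      using V(1,2) by blast
  qed
  \<comment> \<open>A group element imitating \<open>q (r k)\<close> up to 1/16 on finitely many
    functions: 15/16 is 1 - 1/16 and 5/16 is 1/4 + 1/16.\<close>
  have approx: "\<exists>h\<in>carrier G. \<bar>K h - q (r k) K\<bar> < 1/16 \<and> F (r k) h > 15/16 \<and> (\<forall>j<k. F (r j) h < 5/16)" for k
  proof -
    have "finite (insert K ((\<lambda>j. F (r j)) ` {..k}))" "insert K ((\<lambda>j. F (r j)) ` {..k}) \<subseteq> group_funs G T"
      using KG FG by auto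
    then obtain h where h: "h \<in> carrier G"
      "\<And>f. f \<in> insert K ((\<lambda>j. F (r j)) ` {..k}) \<Longrightarrow> \<bar>f h - q (r k) f\<bar> < 1/16"
      by (rule ambit_approx[OF q[of "r k"], of _ "1/16"]) auto
    have "\<bar>F (r k) h - q (r k) (F (r k))\<bar> < 1/16"
      using h(2)[of "F (r k)"] by blast
    then have "F (r k) h > 15/16"
      using one[of "r k"] by linarith
    moreover have "F (r j) h < 5/16" if "j < k" for j
    proof -
      have "\<bar>F (r j) h - q (r k) (F (r j))\<bar> < 1/16"
        using h(2)[of "F (r j)"] that by auto
      then show ?thesis
        using small[OF that] by linarith
    qed
    ultimately show ?thesis
      using h by blast
  qed
  have even_large: "q (r k) K > 9/16" if "even k" for k
  proof -
    obtain h where h: "h \<in> carrier G" "\<bar>K h - q (r k) K\<bar> < 1/16" "F (r k) h > 15/16" "\<And>j. j < k \<Longrightarrow> F (r j) h < 5/16"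
      using approx[of k] by blast
    have "M k h \<le> 5/16"
      using h(4) by (intro M_le) (auto intro: less_imp_le)
    then have "g k h \<ge> 10/16"
      using h(3) that by (simp add: g_def)
    then show ?thesis
      using g_le[OF h(1), of k] h(2) by linarith
  qed
  have odd_small: "q (r k) K < 6/16" if "odd k" for k
  proof -
    obtain h where h: "h \<in> carrier G" "\<bar>K h - q (r k) K\<bar> < 1/16" "F (r k) h > 15/16" "\<And>j. j < k \<Longrightarrow> F (r j) h < 5/16"
      using approx[of k] by blast
    have "g j h \<le> 5/16" for j
    proof -
      consider "j < k" | "j = k" | "k < j" by linarith
      then show ?thesis
      proof cases
        case 1
        then show ?thesis
          using h(4)[of j] M_0[of j h] by (auto simp: g_def max_def)
      next
        case 2
        then show ?thesis
          using that by (simp add: g_def)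
      next
        \<comment> \<open>Here \<open>F (r k) h\<close> is among the subtracted values, so the bump
          is below 1/16.\<close>
        case 3
        then show ?thesis
          using M_ge[OF 3, of h] h(3) F[OF h(1), of "r j"] by (auto simp: g_def max_def)
      qed
    qed
    then have "K h \<le> 5/16"
      unfolding K_def by (intro cSUP_least) auto
    then show ?thesis
      using h(2) by linarith
  qed
  \<comment> \<open>Even terms exceed 9/16 and odd terms stay below 6/16, a gap that two errors of
    1/16 about the limit cannot bridge.\<close>
  obtain L where "(\<lambda>n. q n K) \<longlonglongrightarrow> L"
    using lim[OF KG] by (auto simp: convergent_def)
  then have "(\<lambda>k. q (r k) K) \<longlonglongrightarrow> L"
    using LIMSEQ_subseq_LIMSEQ[OF _ sm] by (force simp: o_def)
  then obtain N where N: "\<And>k. k \<ge> N \<Longrightarrow> \<bar>q (r k) K - L\<bar> < 1/16"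
    using LIMSEQ_D[of "\<lambda>k. q (r k) K" L "1/16"] by auto
  have "\<bar>q (r (2 * N)) K - L\<bar> < 1/16" "\<bar>q (r (Suc (2 * N))) K - L\<bar> < 1/16"
    by (rule N; simp)+
  moreover have "q (r (2 * N)) K > 9/16" "q (r (Suc (2 * N))) K < 6/16"
    by (rule even_large odd_small; simp)+
  ultimately show False
    by linarith
qed

text \<open>A failure at \<open>u\<close> yields, as \<open>U\<close> is metrizable, a sequence
  \<open>w n\<close> converging to \<open>u\<close> and functions \<open>F n\<close> in
  \<open>\<Phi>\<close> that jump by at least \<open>e\<close>. After normalization this is the
  situation excluded by \<open>ambit_sequence_separation\<close>.\<close>

lemma ambit_equicontinuous:
  assumes G: "topological_group G T" and U: "metrizable_space U"
    and \<psi>: "\<And>u. u \<in> topspace U \<Longrightarrow> \<psi> u \<in> ambit_points G T"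
      "\<And>F. F \<in> group_funs G T \<Longrightarrow> (\<lambda>u. \<psi> u F) \<in> cfun U"
    and \<Phi>: "\<Phi> \<subseteq> group_funs G T" "equi_uniform G T (carrier G) (\<otimes>\<^bsub>G\<^esub>) \<Phi>"
    and u: "u \<in> topspace U" and e: "e > 0"
  shows "\<exists>N. openin U N \<and> u \<in> N \<and> (\<forall>w\<in>N. \<forall>F\<in>\<Phi>. \<bar>\<psi> w F - \<psi> u F\<bar> < e)"
proof (rule ccontr)
  assume contra: "\<not> ?thesis"
  then have no: "\<exists>w\<in>N. \<exists>F\<in>\<Phi>. \<bar>\<psi> w F - \<psi> u F\<bar> \<ge> e" if "openin U N" "u \<in> N" for N
    using that contra by (meson not_le)
  have grp: "group G" and T: "topspace T = carrier G"
    using G by (auto simp: topological_group_def)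
  interpret group G by fact
  obtain X d where X: "Metric_space X d" "U = Metric_space.mtopology X d"
    using U by (auto simp: metrizable_space_def)
  interpret X: Metric_space X d by fact
  have uX: "u \<in> X"
    using u X(2) by simp
  have "\<exists>w F. w \<in> X.mball u (1 / real (Suc n)) \<and> F \<in> \<Phi> \<and> \<bar>\<psi> w F - \<psi> u F\<bar> \<ge> e" for n
  proof -
    have "openin U (X.mball u (1 / real (Suc n)))" "u \<in> X.mball u (1 / real (Suc n))"
      using uX X(2) by auto
    from no[OF this] show ?thesis
      by blast
  qed
  then obtain w F where w: "\<And>n. w n \<in> X.mball u (1 / real (Suc n))" and F: "\<And>n. F n \<in> \<Phi>"
    and large: "\<And>n. \<bar>\<psi> (w n) (F n) - \<psi> u (F n)\<bar> \<ge> e"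
    by metis
  have wU: "w n \<in> topspace U" for n
    using w[of n] X(2) by simp
  have lim: "(\<lambda>n. f (w n)) \<longlonglongrightarrow> f u" if f: "f \<in> cfun U" for f
  proof (rule LIMSEQ_I)
    fix \<delta> :: real assume "0 < \<delta>"
    then have "openin U {y \<in> topspace U. \<bar>f y - f u\<bar> < \<delta>}"
      by (rule cfun_nbhd[OF f u])
    then obtain \<rho> where \<rho>: "\<rho> > 0" "X.mball u \<rho> \<subseteq> {y \<in> topspace U. \<bar>f y - f u\<bar> < \<delta>}"
      using u \<open>0 < \<delta>\<close> unfolding X(2) X.openin_mtopology by auto
    obtain N where N: "1 / real (Suc N) < \<rho>"
      using nat_approx_posE[OF \<rho>(1)] by blast
    have "norm (f (w n) - f u) < \<delta>" if "n \<ge> N" for n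
    proof -
      have "1 / real (Suc n) \<le> 1 / real (Suc N)"
        using that by (simp add: frac_le)
      then have "w n \<in> X.mball u \<rho>"
        using w[of n] N by auto
      then show ?thesis
        using \<rho>(2) by auto
    qed
    then show "\<exists>N. \<forall>n\<ge>N. norm (f (w n) - f u) < \<delta>"
      by blast
  qed
  \<comment> \<open>\<open>\<theta> n\<close> is 0 at the value at \<open>u\<close> and 1 at
    distance at least \<open>e\<close> from it, so by \<open>ambit_compose\<close> the jump becomes
    exactly 0 against 1. Its Lipschitz constant \<open>1 / e\<close> is the same for all
    \<open>n\<close>, which keeps the family equi-uniform.\<close>
  define \<theta> where "\<theta> n t = min 1 (\<bar>t - \<psi> u (F n)\<bar> / e)" for n t
  define F' where "F' n h = \<theta> n (F n h)" for n h
  have \<theta>_mod: "\<bar>\<theta> n s - \<theta> n t\<bar> \<le> \<bar>s - t\<bar> / e" for n s t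
  proof -
    have "\<bar>\<theta> n s - \<theta> n t\<bar> \<le> \<bar>\<bar>s - \<psi> u (F n)\<bar> / e - \<bar>t - \<psi> u (F n)\<bar> / e\<bar>"
      unfolding \<theta>_def by (simp add: min_def abs_if)
    also have "\<dots> = \<bar>\<bar>s - \<psi> u (F n)\<bar> - \<bar>t - \<psi> u (F n)\<bar>\<bar> / e"
      using e by (simp add: abs_divide flip: diff_divide_distrib)
    also have "\<dots> \<le> \<bar>s - t\<bar> / e"
      using e abs_triangle_ineq3[of "s - \<psi> u (F n)" "t - \<psi> u (F n)"] by (intro divide_right_mono) auto
    finally show ?thesis .
  qed
  have \<theta>01: "0 \<le> \<theta> n t \<and> \<theta> n t \<le> 1" for n t
    using e by (simp add: \<theta>_def)
  have \<theta>c: "continuous_on UNIV (\<theta> n)" for n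
    unfolding \<theta>_def using e by (intro continuous_intros) auto
  have equi: "equi_uniform G T (carrier G) (\<otimes>\<^bsub>G\<^esub>) (range F')"
    unfolding equi_uniform_def
  proof (intro allI impI)
    fix c :: real assume "c > 0"
    then have "c * e > 0" using e by simp
    then obtain V where V: "openin T V" "\<one>\<^bsub>G\<^esub> \<in> V"
      "\<And>f h v. f \<in> \<Phi> \<Longrightarrow> h \<in> carrier G \<Longrightarrow> v \<in> V \<Longrightarrow> \<bar>f (h \<otimes>\<^bsub>G\<^esub> v) - f h\<bar> \<le> c * e"
      by (rule equi_uniformD[OF \<Phi>(2)]) blast
    have "\<bar>F' n (h \<otimes>\<^bsub>G\<^esub> v) - F' n h\<bar> \<le> c" if "h \<in> carrier G" "v \<in> V" for n h v
      using \<theta>_mod[of n "F n (h \<otimes>\<^bsub>G\<^esub> v)" "F n h"] V(3)[OF F that] e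
      by (simp add: F'_def) (smt (verit, best) pos_divide_le_eq)
    then show "\<exists>V. openin T V \<and> \<one>\<^bsub>G\<^esub> \<in> V \<and>
        (\<forall>f\<in>range F'. \<forall>h\<in>carrier G. \<forall>v\<in>V. \<bar>f (h \<otimes>\<^bsub>G\<^esub> v) - f h\<bar> \<le> c)"
      using V by (intro exI[of _ V]) auto
  qed
  have F'G: "F' n \<in> group_funs G T" for n
    using equi_uniform_mono[OF equi, of "{F' n}"] \<theta>01
    by (auto simp: uniform_funs_def bounded_funs_def F'_def intro!: exI[of _ 1])
  have comp: "\<psi> v (F' n) = \<theta> n (\<psi> v (F n))" if "v \<in> topspace U" for v n
    using ambit_compose[OF \<psi>(1)[OF that], of "F n" "\<theta> n"] F'G[of n] F[of n] \<Phi>(1) \<theta>c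
    by (auto simp: F'_def[abs_def])
  show False
  proof (rule ambit_sequence_separation[where q = "\<lambda>n. \<psi> (w n)" and F = F'])
    show "\<psi> (w n) \<in> ambit_points G T" for n
      by (rule \<psi>(1)[OF wU])
    show "convergent (\<lambda>n. \<psi> (w n) f)" if "f \<in> group_funs G T" for f
      using lim[OF \<psi>(2)[OF that]] by (auto simp: convergent_def)
    show "0 \<le> F' n h \<and> F' n h \<le> 1" for n h
      using \<theta>01 by (simp add: F'_def)
    show "\<psi> (w n) (F' n) = 1" for n
      using large[of n] e by (simp add: comp[OF wU] \<theta>_def)
    show "(\<lambda>n. \<psi> (w n) (F' j)) \<longlonglongrightarrow> 0" for j
      using lim[OF \<psi>(2)[OF F'G[of j]]] by (simp add: comp[OF u] \<theta>_def)
  qed (use T equi in auto)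
qed

section \<open>Orbit maps\<close>

lemma cfun_separates_closed:
  assumes X: "compact_space X" "Hausdorff_space X" and C: "closedin X C" and y: "y \<in> topspace X" "y \<notin> C"
  obtains f where "f \<in> cfun X" "\<And>x. x \<in> C \<Longrightarrow> f x = 0" "f y = 1"
proof -
  have "normal_space X"
    using X compact_Hausdorff_or_regular_imp_normal_space by blast
  moreover have "closedin X {y}"
    using X y by (simp add: closedin_Hausdorff_singleton)
  moreover have "disjnt C {y}"
    using y by simp
  ultimately obtain f where "continuous_map X euclideanreal f" "f ` C \<subseteq> {0}" "f ` {y} \<subseteq> {1}"
    using C Urysohn_lemma_alt[of X C "{y}" 0 1] by metis
  then show ?thesis
    using that[of f] by (auto simp: cfun_def image_subset_iff)
qed

lemma cfun_separates:
  assumes X: "compact_space X" "Hausdorff_space X" and xy: "x \<in> topspace X" "y \<in> topspace X"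
    and eq: "\<And>f. f \<in> cfun X \<Longrightarrow> f x = f y"
  shows "x = y"
proof (rule ccontr)
  assume "x \<noteq> y"
  moreover have "closedin X {x}"
    using X xy by (simp add: closedin_Hausdorff_singleton)
  ultimately obtain f where f: "f \<in> cfun X" "f x = 0" "f y = 1"
    using cfun_separates_closed[OF X, of "{x}" y] xy by (metis singletonD singletonI)
  then show False
    using eq[OF f(1)] by simp
qed

text \<open>By Urysohn, the sets where a continuous function is positive form a base of
  \<open>X\<close>.\<close>

lemma continuous_map_by_cfun:
  assumes X: "compact_space X" "Hausdorff_space X" and \<phi>: "\<And>z. z \<in> topspace Z \<Longrightarrow> \<phi> z \<in> topspace X"
    and c: "\<And>f. f \<in> cfun X \<Longrightarrow> (\<lambda>z. f (\<phi> z)) \<in> cfun Z"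
  shows "continuous_map Z X \<phi>"
  unfolding continuous_map_eq_topcontinuous_at topcontinuous_at_def
proof (intro ballI conjI allI impI)
  fix z assume z: "z \<in> topspace Z"
  fix W assume W: "openin X W \<and> \<phi> z \<in> W"
  obtain f where f: "f \<in> cfun X" "\<And>x. x \<in> topspace X - W \<Longrightarrow> f x = 0" "f (\<phi> z) = 1"
    using cfun_separates_closed[OF X, of "topspace X - W" "\<phi> z"] W \<phi>[OF z] by auto
  let ?N = "{w \<in> topspace Z. 0 < f (\<phi> w)}"
  have "openin Z ?N"
    using openin_level[OF c[OF f(1)]] .
  moreover have "\<phi> w \<in> W" if "w \<in> ?N" for w
    using that f(2)[of "\<phi> w"] \<phi>[of w] by auto
  ultimately show "\<exists>U. openin Z U \<and> z \<in> U \<and> (\<forall>y\<in>U. \<phi> y \<in> W)"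
    using z f(3) by (intro exI[of _ ?N]) auto
qed (use \<phi> in auto)

lemma cfun_compose: "continuous_map Z X \<phi> \<Longrightarrow> f \<in> cfun X \<Longrightarrow> (\<lambda>z. f (\<phi> z)) \<in> cfun Z"
  using continuous_map_compose[of Z X \<phi> euclideanreal f] by (simp add: cfun_def o_def)

text \<open>The limit of \<open>\<xi> h\<close> as \<open>h\<close> tends to \<open>q\<close>, found
  by compactness. \<open>\<xi>\<close> itself need not be continuous, only its composites with the
  functions in \<open>B\<close>; for coset representatives these are the \<open>H\<close>-invariant
  functions alone.\<close>

lemma ambit_point:
  assumes X: "compact_space X" and \<xi>: "\<And>h. h \<in> carrier G \<Longrightarrow> \<xi> h \<in> topspace X"
    and B: "\<And>f. f \<in> B \<Longrightarrow> f \<in> cfun X" "\<And>f. f \<in> B \<Longrightarrow> (\<lambda>h. f (\<xi> h)) \<in> group_funs G T"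
    and q: "q \<in> ambit_points G T"
  obtains x where "x \<in> topspace X" "\<And>f. f \<in> B \<Longrightarrow> f x = q (\<lambda>h. f (\<xi> h))"
proof -
  define C where "C f e = {x \<in> topspace X. \<bar>f x - q (\<lambda>h. f (\<xi> h))\<bar> \<le> e}" for f and e :: real
  \<comment> \<open>Including the whole space keeps the point of the intersection inside
    \<open>X\<close> even when \<open>B\<close> is empty.\<close>
  define \<U> where "\<U> = insert (topspace X) {C f e |f e. f \<in> B \<and> e > 0}"
  have closed: "closedin X (C f e)" if "f \<in> B" for f e
  proof -
    have "C f e = {x \<in> topspace X. f x \<in> cball (q (\<lambda>h. f (\<xi> h))) e}"
      by (auto simp: C_def dist_real_def)
    then show ?thesis
      using closedin_continuous_map_preimage[of X euclideanreal f "cball (q (\<lambda>h. f (\<xi> h))) e"] B(1)[OF that]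
      by (simp add: cfun_def)
  qed
  have fip: "\<Inter>\<F> \<noteq> {}" if \<F>: "finite \<F>" "\<F> \<subseteq> \<U>" for \<F>
  proof -
    let ?I = "{(f, e). f \<in> B \<and> e > (0::real)}"
    have "\<F> - {topspace X} \<subseteq> (\<lambda>(f, e). C f e) ` ?I"
      using \<F>(2) by (auto simp: \<U>_def)
    then obtain P where P: "P \<subseteq> ?I" "finite P" "\<F> - {topspace X} = (\<lambda>(f, e). C f e) ` P"
      using finite_subset_image[of "\<F> - {topspace X}" "\<lambda>(f, e). C f e" ?I] \<F>(1) by auto
    define e0 where "e0 = Min (insert 1 (snd ` P))"
    have e0: "e0 > 0" "\<And>f e. (f, e) \<in> P \<Longrightarrow> e0 \<le> e"
      using P(1,2) unfolding e0_def by (auto intro!: Min_le) force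
    have "finite ((\<lambda>(f, e). (\<lambda>h. f (\<xi> h))) ` P)" "(\<lambda>(f, e). (\<lambda>h. f (\<xi> h))) ` P \<subseteq> group_funs G T"
      using P(1,2) B(2) by auto
    then obtain h where h: "h \<in> carrier G"
      "\<And>F. F \<in> (\<lambda>(f, e). (\<lambda>h. f (\<xi> h))) ` P \<Longrightarrow> \<bar>F h - q F\<bar> < e0"
      using ambit_approx[OF q _ _ e0(1)] by metis
    have "\<xi> h \<in> C f e" if "(f, e) \<in> P" for f e
    proof -
      have "\<bar>f (\<xi> h) - q (\<lambda>h. f (\<xi> h))\<bar> < e0"
        using h(2)[of "\<lambda>h. f (\<xi> h)"] that by force
      then show ?thesis
        using e0(2)[OF that] \<xi>[OF h(1)] by (simp add: C_def)
    qed
    then have "\<xi> h \<in> \<Inter>\<F>"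
      using P(3) \<xi>[OF h(1)] by (metis (no_types, lifting) Diff_iff InterI imageE singletonD surj_pair case_prod_conv)
    then show ?thesis
      by blast
  qed
  have "\<forall>C\<in>\<U>. closedin X C"
    using closed by (auto simp: \<U>_def)
  then have "\<Inter>\<U> \<noteq> {}"
    using X fip unfolding compact_space_fip by blast
  then obtain x where x: "x \<in> \<Inter>\<U>"
    by blast
  have "f x = q (\<lambda>h. f (\<xi> h))" if f: "f \<in> B" for f
  proof -
    have "\<bar>f x - q (\<lambda>h. f (\<xi> h))\<bar> \<le> e" if "e > 0" for e
      using x f that by (auto simp: \<U>_def C_def)
    then show ?thesis
      by (rule real_eq_by_dist)
  qed
  then show ?thesis
    using x that by (auto simp: \<U>_def)
qed

text \<open>To be used with \<open>H\<close> as the group and the universal minimal flow of the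
  large group as \<open>X\<close>, which is therefore only a flow here.\<close>

locale metrizable_universal =
  fixes G :: "('g, 'm) monoid_scheme" and T :: "'g topology"
    and U :: "'u topology" and b :: "'u \<Rightarrow> 'g \<Rightarrow> 'u" and \<psi> :: "'u \<Rightarrow> ('g \<Rightarrow> real) \<Rightarrow> real"
    and X :: "'x topology" and a :: "'x \<Rightarrow> 'g \<Rightarrow> 'x"
  assumes G: "topological_group G T" and U: "minimal_flow G T U b" and metr: "metrizable_space U"
    and \<psi>: "\<And>u. u \<in> topspace U \<Longrightarrow> \<psi> u \<in> ambit_points G T"
      "\<And>F. F \<in> group_funs G T \<Longrightarrow> (\<lambda>u. \<psi> u F) \<in> cfun U"
      "\<And>u g F. u \<in> topspace U \<Longrightarrow> g \<in> carrier G \<Longrightarrow> F \<in> group_funs G T \<Longrightarrow>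
         \<psi> (b u g) F = \<psi> u (\<lambda>h. F (h \<otimes>\<^bsub>G\<^esub> g))"
    and X: "flow G T X a"
begin

lemma grp: "group G" and T: "topspace T = carrier G"
  using G by (auto simp: topological_group_def)

sublocale group G by (rule grp)

lemma comp: "compact_space X" "Hausdorff_space X"
  using X by (auto simp: flow_def)

lemma Uflow: "flow G T U b"
  using U by (simp add: minimal_flow_def)

lemma Ucomp: "compact_space U" "Hausdorff_space U" "topspace U \<noteq> {}"
  using Uflow by (auto simp: flow_def)

lemma aX: "action G (topspace X) a" and bU: "action G (topspace U) b"
  using action_flow X Uflow T by blast+

lemma orbit_group_fun: "f \<in> cfun X \<Longrightarrow> x \<in> topspace X \<Longrightarrow> (\<lambda>h. f (a x h)) \<in> group_funs G T"
  by (rule orbit_fun[OF aX T cfun_uniform[OF X T grp]])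

text \<open>The extension of the orbit map \<open>h \<mapsto> a x h\<close> to the greatest ambit,
  composed with \<open>\<psi>\<close>. Continuous functions determine the value. The restriction to
  \<open>topspace U\<close> places the map in the product space.\<close>

definition orbit_map :: "'x \<Rightarrow> 'u \<Rightarrow> 'x" where
  "orbit_map x = (\<lambda>u\<in>topspace U. SOME y. y \<in> topspace X \<and> (\<forall>f\<in>cfun X. f y = \<psi> u (\<lambda>h. f (a x h))))"

lemma orbit_map:
  assumes "x \<in> topspace X" "u \<in> topspace U"
  shows "orbit_map x u \<in> topspace X" "\<And>f. f \<in> cfun X \<Longrightarrow> f (orbit_map x u) = \<psi> u (\<lambda>h. f (a x h))"
proof -
  obtain y where "y \<in> topspace X" "\<And>f. f \<in> cfun X \<Longrightarrow> f y = \<psi> u (\<lambda>h. f (a x h))"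
  proof (rule ambit_point[where \<xi> = "a x" and B = "cfun X" and q = "\<psi> u" and X = X and G = G and T = T])
    show "a x h \<in> topspace X" if "h \<in> carrier G" for h
      using action_in[OF aX assms(1) that] .
    show "(\<lambda>h. f (a x h)) \<in> group_funs G T" if "f \<in> cfun X" for f
      using orbit_group_fun[OF that assms(1)] .
  qed (use comp(1) \<psi>(1)[OF assms(2)] in blast)+
  then have ex: "\<exists>y. y \<in> topspace X \<and> (\<forall>f\<in>cfun X. f y = \<psi> u (\<lambda>h. f (a x h)))"
    by blast
  have eq: "orbit_map x u = (SOME y. y \<in> topspace X \<and> (\<forall>f\<in>cfun X. f y = \<psi> u (\<lambda>h. f (a x h))))"
    unfolding orbit_map_def restrict_def by (simp only: assms(2) if_True)
  have *: "orbit_map x u \<in> topspace X \<and> (\<forall>f\<in>cfun X. f (orbit_map x u) = \<psi> u (\<lambda>h. f (a x h)))"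
    unfolding eq by (rule someI_ex[OF ex])
  show "orbit_map x u \<in> topspace X"
    using * ..
  show "f (orbit_map x u) = \<psi> u (\<lambda>h. f (a x h))" if "f \<in> cfun X" for f
    using * that by blast
qed

abbreviation maps_top :: "('u \<Rightarrow> 'x) topology" where
  "maps_top \<equiv> product_topology (\<lambda>_. X) (topspace U)"

text \<open>The closure is taken for compactness: nothing makes \<open>orbit_map x\<close> depend
  continuously on \<open>x\<close>.\<close>

definition orbit_maps :: "('u \<Rightarrow> 'x) set" where
  "orbit_maps = maps_top closure_of (orbit_map ` topspace X)"

lemma orbit_map_in:
  assumes "x \<in> topspace X"
  shows "orbit_map x \<in> orbit_maps"
proof -
  have "orbit_map y \<in> topspace maps_top" if "y \<in> topspace X" for y
    unfolding topspace_product_topology PiE_iff using orbit_map(1)[OF that] by (simp add: orbit_map_def)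
  then show ?thesis
    unfolding orbit_maps_def using assms by (intro closure_of_subset[THEN subsetD]) auto
qed

lemma orbit_maps_in: "\<phi> \<in> orbit_maps \<Longrightarrow> u \<in> topspace U \<Longrightarrow> \<phi> u \<in> topspace X"
  using closure_of_subset_topspace[of maps_top] unfolding orbit_maps_def by fastforce

lemma eval_maps: "f \<in> cfun X \<Longrightarrow> u \<in> topspace U \<Longrightarrow> (\<lambda>\<phi>. f (\<phi> u)) \<in> cfun maps_top"
  by (rule cfun_compose[OF continuous_map_product_projection])

text \<open>Equivariance is a closed condition, so it is checked on the maps
  \<open>orbit_map x\<close>, where it is the equivariance of \<open>\<psi>\<close> tested by
  continuous functions.\<close>

lemma orbit_maps_act:
  assumes \<phi>: "\<phi> \<in> orbit_maps" and u: "u \<in> topspace U" and g: "g \<in> carrier G"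
  shows "\<phi> (b u g) = a (\<phi> u) g"
proof (rule cfun_separates[OF comp])
  have bu: "b u g \<in> topspace U"
    by (rule action_in[OF bU u g])
  show "\<phi> (b u g) \<in> topspace X" "a (\<phi> u) g \<in> topspace X"
    using bu u g \<phi> orbit_maps_in action_in[OF aX] by auto
  fix f assume f: "f \<in> cfun X"
  have fg: "(\<lambda>x. f (a x g)) \<in> cfun X"
    by (rule cfun_compose[OF flow_act_continuous[OF X T g] f])
  have "\<bar>f (\<phi> (b u g)) - f (a (\<phi> u) g)\<bar> \<le> 0"
  proof (rule closure_le[OF cfun_abs_diff[OF eval_maps[OF f bu] eval_maps[OF fg u]] _ \<phi>[unfolded orbit_maps_def]])
    fix s assume "s \<in> orbit_map ` topspace X"
    then obtain x where x: "x \<in> topspace X" "s = orbit_map x"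
      by blast
    have "f (orbit_map x (b u g)) = \<psi> u (\<lambda>h. f (a x (h \<otimes>\<^bsub>G\<^esub> g)))"
      using orbit_map(2)[OF x(1) bu f] \<psi>(3)[OF u g orbit_group_fun[OF f x(1)]] by simp
    also have "\<dots> = \<psi> u (\<lambda>h. f (a (a x h) g))"
      by (rule state_cong[OF ambit_state[OF G \<psi>(1)[OF u]]
            translate_fun[OF G action_group[OF grp] orbit_group_fun[OF f x(1)] g] orbit_group_fun[OF fg x(1)]])
        (simp add: action_mult[OF aX x(1) _ g])
    also have "\<dots> = f (a (orbit_map x u) g)"
      using orbit_map(2)[OF x(1) u fg] by simp
    finally show "\<bar>f (s (b u g)) - f (a (s u) g)\<bar> \<le> 0"
      by (simp add: x(2))
  qed
  then show "f (\<phi> (b u g)) = f (a (\<phi> u) g)"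
    by simp
qed

text \<open>All orbit functions of \<open>f\<close> form one equi-uniform family, so
  \<open>ambit_equicontinuous\<close> gives a neighbourhood valid for every starting point; the
  non-strict bound then passes to the pointwise closure.\<close>

lemma orbit_maps_equicontinuous:
  assumes f: "f \<in> cfun X" and u: "u \<in> topspace U" and e: "e > 0"
  obtains N where "openin U N" "u \<in> N" "\<And>w \<phi>. w \<in> N \<Longrightarrow> \<phi> \<in> orbit_maps \<Longrightarrow> \<bar>f (\<phi> w) - f (\<phi> u)\<bar> \<le> e"
proof -
  let ?\<Phi> = "{\<lambda>h. k (a x h) |k x. k \<in> {f} \<and> x \<in> topspace X}"
  have "f \<in> uniform_funs G T (topspace X) a"
    by (rule cfun_uniform[OF X T grp f])
  then have "equi_uniform G T (carrier G) (\<otimes>\<^bsub>G\<^esub>) ?\<Phi>"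
    by (intro equi_uniform_orbit[OF aX T]) (simp add: uniform_funs_def)
  moreover have "?\<Phi> \<subseteq> group_funs G T"
    using orbit_group_fun[OF f] by auto
  ultimately obtain N where N: "openin U N" "u \<in> N" "\<forall>w\<in>N. \<forall>F\<in>?\<Phi>. \<bar>\<psi> w F - \<psi> u F\<bar> < e"
    using ambit_equicontinuous[OF G metr \<psi>(1,2) _ _ u e, of ?\<Phi>] by blast
  have "\<bar>f (\<phi> w) - f (\<phi> u)\<bar> \<le> e" if w: "w \<in> N" and \<phi>: "\<phi> \<in> orbit_maps" for w \<phi>
  proof -
    have wU: "w \<in> topspace U"
      using openin_subset[OF N(1)] w by auto
    show ?thesis
    proof (rule closure_le[OF cfun_abs_diff[OF eval_maps[OF f wU] eval_maps[OF f u]] _ \<phi>[unfolded orbit_maps_def]])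
      fix s assume "s \<in> orbit_map ` topspace X"
      then obtain x where x: "x \<in> topspace X" "s = orbit_map x"
        by blast
      have "(\<lambda>h. f (a x h)) \<in> ?\<Phi>"
        using x by auto
      then have "\<bar>\<psi> w (\<lambda>h. f (a x h)) - \<psi> u (\<lambda>h. f (a x h))\<bar> < e"
        using N(3) w by blast
      then show "\<bar>f (s w) - f (s u)\<bar> \<le> e"
        using orbit_map(2)[OF x(1) wU f] orbit_map(2)[OF x(1) u f] by (simp add: x(2))
    qed
  qed
  then show ?thesis
    using that N(1,2) by blast
qed

definition maps_space :: "('u \<Rightarrow> 'x) topology" where
  "maps_space = subtopology maps_top orbit_maps"

lemma topspace_maps: "topspace maps_space = orbit_maps"
  using closure_of_subset_topspace[of maps_top "orbit_map ` topspace X"]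
  by (auto simp: maps_space_def orbit_maps_def)

lemma maps_compact: "compact_space maps_space"
proof -
  have "compact_space maps_top"
    using comp by (simp add: compact_space_product_topology)
  then show ?thesis
    unfolding maps_space_def orbit_maps_def
    by (intro compact_space_subtopology closedin_compact_space) auto
qed

lemma eval_maps_space: "f \<in> cfun X \<Longrightarrow> u \<in> topspace U \<Longrightarrow> (\<lambda>\<phi>. f (\<phi> u)) \<in> cfun maps_space"
  using eval_maps[of f u] by (auto simp: cfun_def maps_space_def intro: continuous_map_from_subtopology)

text \<open>The topology on maps is only pointwise. Equicontinuity bounds the change of the argument
  uniformly in the map, and the rest is evaluation at the fixed point \<open>u\<close>.\<close>

lemma eval_joint_cfun:
  assumes f: "f \<in> cfun X"
  shows "(\<lambda>z. f (fst z (snd z))) \<in> cfun (prod_topology maps_space U)"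
  unfolding cfun_def mem_Collect_eq
proof (rule continuous_map_realI)
  fix z and e :: real assume z: "z \<in> topspace (prod_topology maps_space U)" and e: "e > 0"
  obtain \<phi> u where \<phi>u: "z = (\<phi>, u)" "\<phi> \<in> orbit_maps" "u \<in> topspace U"
    using z by (cases z) (auto simp: topspace_maps)
  obtain N where N: "openin U N" "u \<in> N" "\<And>w \<phi>. w \<in> N \<Longrightarrow> \<phi> \<in> orbit_maps \<Longrightarrow> \<bar>f (\<phi> w) - f (\<phi> u)\<bar> \<le> e / 2"
    using orbit_maps_equicontinuous[OF f \<phi>u(3), of "e / 2"] e by auto
  define M where "M = {\<sigma> \<in> topspace maps_space. \<bar>f (\<sigma> u) - f (\<phi> u)\<bar> < e / 2}"
  have M: "openin maps_space M"
    unfolding M_def using \<phi>u e by (intro cfun_nbhd[OF eval_maps_space[OF f]]) (auto simp: topspace_maps)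
  have "\<bar>f (\<sigma> w) - f (\<phi> u)\<bar> < e" if "\<sigma> \<in> M" "w \<in> N" for \<sigma> w
  proof -
    have "\<bar>f (\<sigma> u) - f (\<phi> u)\<bar> < e / 2" "\<bar>f (\<sigma> w) - f (\<sigma> u)\<bar> \<le> e / 2"
      using that N(3)[OF that(2), of \<sigma>] by (auto simp: M_def topspace_maps)
    then show ?thesis
      by linarith
  qed
  moreover have "openin (prod_topology maps_space U) (M \<times> N)"
    using M N(1) by (simp add: openin_prod_Times_iff)
  moreover have "z \<in> M \<times> N"
    using \<phi>u N(2) e by (simp add: M_def topspace_maps)
  ultimately show "\<exists>W. openin (prod_topology maps_space U) W \<and> z \<in> W \<and>
      (\<forall>y\<in>W. \<bar>f (fst y (snd y)) - f (fst z (snd z))\<bar> < e)"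
    using \<phi>u(1) by (intro exI[of _ "M \<times> N"]) auto
qed

lemma eval_joint: "continuous_map (prod_topology maps_space U) X (\<lambda>z. fst z (snd z))"
  by (rule continuous_map_by_cfun[OF comp _ eval_joint_cfun]) (auto simp: topspace_maps orbit_maps_in)

lemma orbit_maps_cfun:
  assumes "\<phi> \<in> orbit_maps" "f \<in> cfun X"
  shows "(\<lambda>u. f (\<phi> u)) \<in> cfun U"
proof -
  have "continuous_map U (prod_topology maps_space U) (\<lambda>u. (\<phi>, u))"
    using assms(1) by (simp add: continuous_map_pairwise o_def topspace_maps)
  from cfun_compose[OF this eval_joint_cfun[OF assms(2)]] show ?thesis
    by simp
qed

lemma orbit_maps_continuous: "\<phi> \<in> orbit_maps \<Longrightarrow> continuous_map U X \<phi>"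
  by (rule continuous_map_by_cfun[OF comp orbit_maps_in orbit_maps_cfun])

text \<open>The union of the minimal subflows, by \<open>orbit_maps_image\<close> and
  \<open>periodic_iff\<close>. In this form it is the image of a compact space under evaluation,
  hence closed.\<close>

definition periodic_points :: "'x set" where
  "periodic_points = {\<phi> u |\<phi> u. \<phi> \<in> orbit_maps \<and> u \<in> topspace U}"

lemma closedin_periodic: "closedin X periodic_points"
proof -
  have "compact_space (prod_topology maps_space U)"
    using maps_compact Ucomp by (simp add: compact_space_prod_topology)
  then have "compactin X ((\<lambda>z. fst z (snd z)) ` topspace (prod_topology maps_space U))"
    using image_compactin[OF _ eval_joint] by (simp add: compact_space_def)
  moreover have "(\<lambda>z. fst z (snd z)) ` topspace (prod_topology maps_space U) = periodic_points"
    by (force simp: periodic_points_def topspace_maps)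
  ultimately show ?thesis
    using compactin_imp_closedin[OF comp(2)] by simp
qed

lemma periodic_nonempty: "periodic_points \<noteq> {}"
proof -
  obtain x u where "x \<in> topspace X" "u \<in> topspace U"
    using X Ucomp(3) unfolding flow_def by blast
  then show ?thesis
    using orbit_map_in by (auto simp: periodic_points_def)
qed

text \<open>The image of \<open>U\<close> is compact, and orbits are dense in it because they are
  dense in \<open>U\<close>.\<close>

lemma orbit_maps_image:
  assumes \<phi>: "\<phi> \<in> orbit_maps" and u: "u \<in> topspace U"
  shows "X closure_of (a (\<phi> u) ` carrier G) = \<phi> ` topspace U"
proof
  have orb: "a (\<phi> u) ` carrier G = \<phi> ` (b u ` carrier G)"
    using orbit_maps_act[OF \<phi> u] by force
  have "compactin X (\<phi> ` topspace U)"
    using image_compactin[OF _ orbit_maps_continuous[OF \<phi>]] Ucomp(1) by (simp add: compact_space_def)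
  then have "closedin X (\<phi> ` topspace U)"
    by (rule compactin_imp_closedin[OF comp(2)])
  then show "X closure_of (a (\<phi> u) ` carrier G) \<subseteq> \<phi> ` topspace U"
    unfolding orb using action_in[OF bU u] by (intro closure_of_minimal) auto
  have "topspace U = U closure_of (b u ` carrier G)"
    using U u by (simp add: minimal_flow_def)
  then show "\<phi> ` topspace U \<subseteq> X closure_of (a (\<phi> u) ` carrier G)"
    unfolding orb using continuous_map_image_closure_subset[OF orbit_maps_continuous[OF \<phi>]] by metis
qed

text \<open>A function vanishing on the orbit closure of \<open>x\<close> has zero orbit function,
  hence value 0 at \<open>orbit_map x u\<close>; so it cannot separate that point from the
  closure.\<close>

lemma orbit_map_closure:
  assumes "x \<in> topspace X" "u \<in> topspace U"
  shows "orbit_map x u \<in> X closure_of (a x ` carrier G)"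
proof (rule ccontr)
  assume "orbit_map x u \<notin> X closure_of (a x ` carrier G)"
  then obtain f where f: "f \<in> cfun X" "\<And>y. y \<in> X closure_of (a x ` carrier G) \<Longrightarrow> f y = 0" "f (orbit_map x u) = 1"
    by (rule cfun_separates_closed[OF comp closedin_closure_of orbit_map(1)[OF assms]]) blast
  have "a x ` carrier G \<subseteq> X closure_of (a x ` carrier G)"
    using action_in[OF aX assms(1)] by (intro closure_of_subset) auto
  then have "f (a x h) = 0" if "h \<in> carrier G" for h
    using f(2) that by blast
  then have "\<psi> u (\<lambda>h. f (a x h)) = \<psi> u (\<lambda>_. 0)"
    by (intro state_cong[OF ambit_state[OF G \<psi>(1)[OF assms(2)]] orbit_group_fun[OF f(1) assms(1)]
          fun_space_const[OF fun_space_uniform[OF T grp]]]) simp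
  then show False
    using orbit_map(2)[OF assms f(1)] f(3) state_const[OF ambit_state[OF G \<psi>(1)[OF assms(2)]]] by simp
qed

text \<open>A description by orbit closures alone, without \<open>U\<close>, so that it can be
  translated by elements of the large group. For the converse, \<open>orbit_map x u\<close> lies in
  the orbit closure of \<open>x\<close>; if that closure is minimal, it is the image of
  \<open>orbit_map x\<close> and contains \<open>x\<close>.\<close>

lemma periodic_iff:
  assumes "x \<in> topspace X"
  shows "x \<in> periodic_points \<longleftrightarrow>
    (\<forall>y\<in>X closure_of (a x ` carrier G). X closure_of (a y ` carrier G) = X closure_of (a x ` carrier G))"
proof
  assume "x \<in> periodic_points"
  then obtain \<phi> u where "\<phi> \<in> orbit_maps" "u \<in> topspace U" "x = \<phi> u"
    by (auto simp: periodic_points_def)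
  then show "\<forall>y\<in>X closure_of (a x ` carrier G). X closure_of (a y ` carrier G) = X closure_of (a x ` carrier G)"
    using orbit_maps_image by auto
next
  assume *: "\<forall>y\<in>X closure_of (a x ` carrier G). X closure_of (a y ` carrier G) = X closure_of (a x ` carrier G)"
  obtain u where u: "u \<in> topspace U"
    using Ucomp(3) by blast
  have "X closure_of (a x ` carrier G) = orbit_map x ` topspace U"
    using * orbit_map_closure[OF assms u] orbit_maps_image[OF orbit_map_in[OF assms] u] by simp
  moreover have "x \<in> X closure_of (a x ` carrier G)"
  proof (rule closure_of_subset[THEN subsetD])
    show "a x ` carrier G \<subseteq> topspace X"
      using action_in[OF aX assms] by auto
    show "x \<in> a x ` carrier G"
      using action_one[OF aX assms] by (metis imageI one_closed)
  qed
  ultimately show "x \<in> periodic_points"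
    using orbit_map_in[OF assms] by (auto simp: periodic_points_def)
qed

end

section \<open>Conditional expectation onto the invariant functions\<close>

lemma state_subspace: "state D V I \<Longrightarrow> W \<subseteq> V \<Longrightarrow> fun_space W \<Longrightarrow> state D W I"
  unfolding state_def by blast

lemma invariant_state_subspace:
  "invariant_state G D a V I \<Longrightarrow> W \<subseteq> V \<Longrightarrow> fun_space W \<Longrightarrow> invariant_state G D a W I"
  unfolding invariant_state_def using state_subspace by blast

text \<open>Lifts a state through a map from \<open>D\<close>, with \<open>j\<close> as pull-back of
  functions. The condition \<open>supp\<close> says that \<open>\<kappa>\<close> lives on the image
  of that map; it makes the transported partial functional positive, after which
  \<open>invariant_extension\<close> applies.\<close>

lemma state_extension:
  assumes G: "topological_group G T" and a: "action G D a"
    and n: "invariant_state G (carrier G) (\<otimes>\<^bsub>G\<^esub>) (group_funs G T) n"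
    and \<kappa>: "state E W \<kappa>"
    and j: "\<And>f. f \<in> W \<Longrightarrow> j f \<in> uniform_funs G T D a"
    and pt: "\<And>z. z \<in> D \<Longrightarrow> state E W (\<lambda>f. j f z)"
    and supp: "\<And>f. f \<in> W \<Longrightarrow> (\<And>z. z \<in> D \<Longrightarrow> 0 \<le> j f z) \<Longrightarrow> 0 \<le> \<kappa> f"
    and inv: "\<And>f g. f \<in> W \<Longrightarrow> g \<in> carrier G \<Longrightarrow>
      \<exists>f'\<in>W. \<kappa> f' = \<kappa> f \<and> (\<forall>z\<in>D. j f (a z g) = j f' z)"
  obtains I where "invariant_state G D a (uniform_funs G T D a) I" "\<And>f. f \<in> W \<Longrightarrow> I (j f) = \<kappa> f"
proof -
  let ?V = "uniform_funs G T D a"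
  have V: "fun_space ?V"
    using G by (intro fun_space_uniform) (auto simp: topological_group_def)
  note W = state_space[OF \<kappa>]
  define L where "L = {(p, \<kappa> f) |p f. f \<in> W \<and> p \<in> ?V \<and> (\<forall>z\<in>D. p z = j f z)}"
  have LI: "(p, c) \<in> L" if "f \<in> W" "p \<in> ?V" "\<And>z. z \<in> D \<Longrightarrow> p z = j f z" "c = \<kappa> f" for p f c
    using that by (auto simp: L_def)
  have LE: "\<exists>f. c = \<kappa> f \<and> f \<in> W \<and> p \<in> ?V \<and> (\<forall>z\<in>D. p z = j f z)" if "(p, c) \<in> L" for p c
    using that by (auto simp: L_def)
  have pg: "positive_graph D L"
    unfolding positive_graph_def
  proof (intro conjI allI impI)
    fix p c q d assume "(p, c) \<in> L" "(q, d) \<in> L"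
    then obtain f g where "c = \<kappa> f" "f \<in> W" "p \<in> ?V" "\<forall>z\<in>D. p z = j f z"
      "d = \<kappa> g" "g \<in> W" "q \<in> ?V" "\<forall>z\<in>D. q z = j g z"
      using LE by meson
    then show "(\<lambda>x. p x + q x, c + d) \<in> L"
      by (intro LI[of "\<lambda>x. f x + g x"]) (auto simp: state_add[OF pt] state_add[OF \<kappa>] intro: fun_space_add[OF W] fun_space_add[OF V])
  next
    fix t p c assume "(p, c) \<in> L"
    then obtain f where "c = \<kappa> f" "f \<in> W" "p \<in> ?V" "\<forall>z\<in>D. p z = j f z"
      using LE by meson
    then show "(\<lambda>x. t * p x, t * c) \<in> L"
      by (intro LI[of "\<lambda>x. t * f x"]) (auto simp: state_scale[OF pt] state_scale[OF \<kappa>] intro: fun_space_scale[OF W] fun_space_scale[OF V])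
  next
    show "(\<lambda>_. 1, 1) \<in> L"
      by (intro LI[of "\<lambda>_. 1"]) (auto simp: state_one[OF pt] state_one[OF \<kappa>] intro: fun_space_const[OF W] fun_space_const[OF V])
  next
    fix p c assume "(p, c) \<in> L" "\<forall>x\<in>D. 0 \<le> p x"
    moreover from this obtain f where "c = \<kappa> f" "f \<in> W" "\<forall>z\<in>D. p z = j f z"
      using LE by meson
    ultimately show "0 \<le> c"
      using supp[of f] by simp
  qed
  have sub: "L \<subseteq> ?V \<times> UNIV"
    by (auto simp: L_def)
  have inv_L: "(\<lambda>x. p (a x g), c) \<in> L" if pc: "(p, c) \<in> L" and g: "g \<in> carrier G" for p c g
  proof -
    obtain f where f: "c = \<kappa> f" "f \<in> W" "p \<in> ?V" "\<forall>z\<in>D. p z = j f z"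
      using LE[OF pc] by blast
    obtain f' where f': "f' \<in> W" "\<kappa> f' = \<kappa> f" "\<forall>z\<in>D. j f (a z g) = j f' z"
      using inv[OF f(2) g] by blast
    show ?thesis
      using f f' action_in[OF a _ g] by (intro LI[OF f'(1)] translate_fun[OF G a _ g]) auto
  qed
  obtain I where I: "invariant_state G D a ?V I" "\<And>p c. (p, c) \<in> L \<Longrightarrow> I p = c"
    by (rule invariant_extension[OF G a n pg sub inv_L]) blast+
  have "I (j f) = \<kappa> f" if "f \<in> W" for f
    by (rule I(2)[OF LI[OF that j[OF that] refl refl]])
  then show ?thesis
    using that I(1) by blast
qed

text \<open>For fixed \<open>c\<close> the functional \<open>k \<mapsto> \<nu> (c \<otimes> k)\<close> is, up to normalization, an invariant state on \<open>U\<close>,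
  hence a multiple of \<open>m\<close>.\<close>

lemma invariant_state_product:
  assumes \<nu>: "invariant_state G (F \<times> topspace U) (\<lambda>z g. (fst z, b (snd z) g)) V \<nu>"
    and uniq: "\<And>J k. invariant_state G (topspace U) b (cfun U) J \<Longrightarrow> k \<in> cfun U \<Longrightarrow> J k = m k"
    and tens: "\<And>k. k \<in> cfun U \<Longrightarrow> (\<lambda>z. c (fst z) * k (snd z)) \<in> V"
    and act: "\<And>k g. k \<in> cfun U \<Longrightarrow> g \<in> carrier G \<Longrightarrow> (\<lambda>u. k (b u g)) \<in> cfun U"
    and comp: "compact_space U" and c: "\<And>\<phi>. \<phi> \<in> F \<Longrightarrow> 0 \<le> c \<phi>" and k: "k \<in> cfun U"
  shows "\<nu> (\<lambda>z. c (fst z) * k (snd z)) = \<nu> (\<lambda>z. c (fst z)) * m k"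
proof -
  have st: "state (F \<times> topspace U) V \<nu>"
    using \<nu> by (simp add: invariant_state_def)
  have cV: "(\<lambda>z. c (fst z)) \<in> V"
    using tens[OF fun_space_const[OF fun_space_cfun, of 1]] by simp
  define s where "s = \<nu> (\<lambda>z. c (fst z))"
  have s0: "0 \<le> s"
    unfolding s_def using c by (intro state_nonneg[OF st cV]) auto
  show ?thesis
  proof (cases "s = 0")
    \<comment> \<open>Normalization is impossible, but \<open>c\<close> times \<open>k\<close> lies
      between the multiples \<open>- B\<close> and \<open>B\<close> of \<open>c\<close>, so both
      sides vanish.\<close>
    case True
    obtain B where B: "B > 0" "\<And>u. u \<in> topspace U \<Longrightarrow> \<bar>k u\<bar> \<le> B"
      using cfun_bounded[OF comp k] by blast
    note sc = fun_space_scale[OF state_space[OF st] cV]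
    have bound: "\<bar>c (fst z) * k (snd z)\<bar> \<le> B * c (fst z)" if "z \<in> F \<times> topspace U" for z
    proof -
      have "c (fst z) * \<bar>k (snd z)\<bar> \<le> c (fst z) * B"
        using that c B(2) by (intro mult_left_mono) auto
      then show ?thesis
        using that c by (auto simp: abs_mult mult.commute)
    qed
    have b': "- B * c (fst z) \<le> c (fst z) * k (snd z)" "c (fst z) * k (snd z) \<le> B * c (fst z)"
      if "z \<in> F \<times> topspace U" for z
      using bound[OF that] by (simp_all add: abs_le_iff minus_le_iff)
    have "\<nu> (\<lambda>z. c (fst z) * k (snd z)) \<le> \<nu> (\<lambda>z. B * c (fst z))"
      by (rule state_mono[OF st tens[OF k] sc b'(2)])
    moreover have "\<nu> (\<lambda>z. - B * c (fst z)) \<le> \<nu> (\<lambda>z. c (fst z) * k (snd z))"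
      by (rule state_mono[OF st sc tens[OF k] b'(1)])
    ultimately show ?thesis
      using True unfolding state_scale[OF st cV] by (simp add: s_def)
  next
    case False
    define J where "J f = \<nu> (\<lambda>z. c (fst z) * f (snd z)) / s" for f
    have "state (topspace U) (cfun U) J"
      unfolding state_def
    proof (intro conjI ballI allI impI fun_space_cfun)
      fix f g assume "f \<in> cfun U" "g \<in> cfun U"
      then show "J (\<lambda>x. f x + g x) = J f + J g"
        using state_add[OF st tens tens, of f g] by (simp add: J_def distrib_left add_divide_distrib)
    next
      fix r f assume "f \<in> cfun U"
      then show "J (\<lambda>x. r * f x) = r * J f"
        using state_scale[OF st tens, of f r] by (simp add: J_def mult.left_commute)
    next
      fix f assume "f \<in> cfun U" "\<forall>x\<in>topspace U. 0 \<le> f x"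
      then show "0 \<le> J f"
        unfolding J_def using c s0 by (intro divide_nonneg_nonneg state_nonneg[OF st tens]) auto
    next
      show "J (\<lambda>_. 1) = 1"
        using False by (simp add: J_def s_def)
    qed
    moreover have "J (\<lambda>x. f (b x g)) = J f" if "g \<in> carrier G" "f \<in> cfun U" for g f
      using invariant_stateD[OF \<nu> that(1) tens[OF that(2)]] by (simp add: J_def)
    ultimately have "J k = m k"
      using k by (intro uniq) (auto simp: invariant_state_def)
    then show ?thesis
      using False by (simp add: J_def s_def field_simps)
  qed
qed

section \<open>Averages over the minimal subflows\<close>

locale ergodic_universal = metrizable_universal G T U b \<psi> X a
  for G :: "('g, 'm) monoid_scheme" and T :: "'g topology"
    and U :: "'u topology" and b :: "'u \<Rightarrow> 'g \<Rightarrow> 'u" and \<psi> :: "'u \<Rightarrow> ('g \<Rightarrow> real) \<Rightarrow> real"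
    and X :: "'x topology" and a :: "'x \<Rightarrow> 'g \<Rightarrow> 'x" +
  fixes m :: "('u \<Rightarrow> real) \<Rightarrow> real" and n :: "('g \<Rightarrow> real) \<Rightarrow> real"
  assumes m: "invariant_state G (topspace U) b (cfun U) m"
    and m_unique: "\<And>J k. invariant_state G (topspace U) b (cfun U) J \<Longrightarrow> k \<in> cfun U \<Longrightarrow> J k = m k"
    and n: "invariant_state G (carrier G) (\<otimes>\<^bsub>G\<^esub>) (group_funs G T) n"
    and all_periodic: "periodic_points = topspace X"
begin

lemma m_state: "state (topspace U) (cfun U) m"
  using m by (simp add: invariant_state_def)

lemma point_rep:
  assumes "x \<in> topspace X"
  obtains \<phi> u where "\<phi> \<in> orbit_maps" "u \<in> topspace U" "x = \<phi> u"
  using assms all_periodic unfolding periodic_points_def by blast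

lemma translate_X: "f \<in> cfun X \<Longrightarrow> g \<in> carrier G \<Longrightarrow> (\<lambda>x. f (a x g)) \<in> cfun X"
  by (rule cfun_compose[OF flow_act_continuous[OF X T]])

lemma translate_U: "k \<in> cfun U \<Longrightarrow> g \<in> carrier G \<Longrightarrow> (\<lambda>u. k (b u g)) \<in> cfun U"
  by (rule cfun_compose[OF flow_act_continuous[OF Uflow T]])

text \<open>Unique ergodicity passes from \<open>U\<close> to its image under \<open>\<phi>\<close>:
  an invariant state supported there lifts along \<open>\<phi>\<close> to an invariant state on
  \<open>U\<close>, since the group has an invariant mean, and the lift must be
  \<open>m\<close>.\<close>

lemma fibre_state_unique:
  assumes J: "invariant_state G (topspace X) a (cfun X) J" and \<phi>: "\<phi> \<in> orbit_maps"
    and supp: "\<And>f. f \<in> cfun X \<Longrightarrow> (\<And>u. u \<in> topspace U \<Longrightarrow> 0 \<le> f (\<phi> u)) \<Longrightarrow> 0 \<le> J f"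
    and f: "f \<in> cfun X"
  shows "J f = m (\<lambda>u. f (\<phi> u))"
proof -
  have st: "state (topspace X) (cfun X) J"
    using J by (simp add: invariant_state_def)
  obtain I where I: "invariant_state G (topspace U) b (uniform_funs G T (topspace U) b) I"
    "\<And>f. f \<in> cfun X \<Longrightarrow> I (\<lambda>u. f (\<phi> u)) = J f"
  proof (rule state_extension[OF G bU n st, of "\<lambda>f u. f (\<phi> u)"])
    show "(\<lambda>u. f (\<phi> u)) \<in> uniform_funs G T (topspace U) b" if "f \<in> cfun X" for f
      by (rule cfun_uniform[OF Uflow T grp orbit_maps_cfun[OF \<phi> that]])
    show "\<exists>f'\<in>cfun X. J f' = J f \<and> (\<forall>u\<in>topspace U. f (\<phi> (b u g)) = f' (\<phi> u))"
      if "f \<in> cfun X" "g \<in> carrier G" for f g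
      using translate_X[OF that] invariant_stateD[OF J that(2,1)] orbit_maps_act[OF \<phi> _ that(2)]
      by (intro bexI[of _ "\<lambda>x. f (a x g)"]) auto
    show "state (topspace X) (cfun X) (\<lambda>f. f (\<phi> u))" if "u \<in> topspace U" for u
      by (rule state_point[OF orbit_maps_in[OF \<phi> that] fun_space_cfun])
  qed (use supp in auto)
  have "cfun U \<subseteq> uniform_funs G T (topspace U) b"
    using cfun_uniform[OF Uflow T grp] by blast
  then have "invariant_state G (topspace U) b (cfun U) I"
    using invariant_state_subspace[OF I(1) _ fun_space_cfun] by blast
  from m_unique[OF this orbit_maps_cfun[OF \<phi> f]] I(2)[OF f] show ?thesis
    by simp
qed

lemma push_state:
  assumes \<phi>: "\<phi> \<in> orbit_maps"
  shows "invariant_state G (topspace X) a (cfun X) (\<lambda>f. m (\<lambda>u. f (\<phi> u)))"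
  unfolding invariant_state_def
proof (intro conjI ballI)
  show "state (topspace X) (cfun X) (\<lambda>f. m (\<lambda>u. f (\<phi> u)))"
    using orbit_maps_cfun[OF \<phi>] orbit_maps_in[OF \<phi>] by (intro state_pullback[OF m_state fun_space_cfun])
  fix g f assume g: "g \<in> carrier G" and f: "f \<in> cfun X"
  have "m (\<lambda>u. f (a (\<phi> u) g)) = m (\<lambda>u. f (\<phi> (b u g)))"
    using orbit_maps_act[OF \<phi> _ g]
    by (intro state_cong[OF m_state orbit_maps_cfun[OF \<phi> translate_X[OF f g]] translate_U[OF orbit_maps_cfun[OF \<phi> f] g]]) auto
  then show "m (\<lambda>u. f (a (\<phi> u) g)) = m (\<lambda>u. f (\<phi> u))"
    using invariant_stateD[OF m g orbit_maps_cfun[OF \<phi> f]] by simp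
qed

text \<open>The average of \<open>f\<close> over the minimal subflow through \<open>x\<close>,
  computed with some orbit map passing through \<open>x\<close>. By \<open>expect_eq\<close> the
  choice is irrelevant.\<close>

definition expect :: "('x \<Rightarrow> real) \<Rightarrow> 'x \<Rightarrow> real" where
  "expect f x = m (\<lambda>u. f ((SOME \<phi>. \<phi> \<in> orbit_maps \<and> x \<in> \<phi> ` topspace U) u))"

text \<open>Two orbit maps through one point have the same image, the orbit closure of that point,
  and \<open>fibre_state_unique\<close> identifies the two push-forwards of
  \<open>m\<close>.\<close>

lemma expect_eq:
  assumes \<phi>: "\<phi> \<in> orbit_maps" and u: "u \<in> topspace U" and f: "f \<in> cfun X"
  shows "expect f (\<phi> u) = m (\<lambda>v. f (\<phi> v))"
proof -
  define \<phi>' where "\<phi>' = (SOME \<phi>'. \<phi>' \<in> orbit_maps \<and> \<phi> u \<in> \<phi>' ` topspace U)"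
  have "\<exists>\<phi>'. \<phi>' \<in> orbit_maps \<and> \<phi> u \<in> \<phi>' ` topspace U"
    using \<phi> u by blast
  then have \<phi>': "\<phi>' \<in> orbit_maps" "\<phi> u \<in> \<phi>' ` topspace U"
    unfolding \<phi>'_def by (metis (mono_tags, lifting) someI_ex)+
  then obtain w where w: "w \<in> topspace U" "\<phi> u = \<phi>' w"
    by blast
  have "\<phi> ` topspace U = \<phi>' ` topspace U"
    using orbit_maps_image[OF \<phi> u] orbit_maps_image[OF \<phi>'(1) w(1)] w(2) by simp
  then have im: "\<exists>v'\<in>topspace U. \<phi>' v = \<phi> v'" if "v \<in> topspace U" for v
    using that by (metis imageE imageI)
  have "m (\<lambda>v. f (\<phi>' v)) = m (\<lambda>v. f (\<phi> v))"
  proof (rule fibre_state_unique[OF push_state[OF \<phi>'(1)] \<phi> _ f])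
    fix k assume k: "k \<in> cfun X" "\<And>u. u \<in> topspace U \<Longrightarrow> 0 \<le> k (\<phi> u)"
    have "0 \<le> k (\<phi>' v)" if "v \<in> topspace U" for v
      using im[OF that] k(2) by force
    then show "0 \<le> m (\<lambda>v. k (\<phi>' v))"
      by (rule state_nonneg[OF m_state orbit_maps_cfun[OF \<phi>'(1) k(1)]])
  qed
  then show ?thesis
    by (simp add: expect_def \<phi>'_def)
qed

text \<open>Characterizes \<open>expect\<close> by support and invariance, without orbit maps; this
  is the form needed to compare averages at \<open>x\<close> and at a translate of
  \<open>x\<close>.\<close>

lemma expect_unique:
  assumes J: "invariant_state G (topspace X) a (cfun X) J" and x: "x \<in> topspace X"
    and supp: "\<And>f. f \<in> cfun X \<Longrightarrow> (\<And>y. y \<in> X closure_of (a x ` carrier G) \<Longrightarrow> 0 \<le> f y) \<Longrightarrow> 0 \<le> J f"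
    and f: "f \<in> cfun X"
  shows "J f = expect f x"
proof -
  obtain \<phi> u where \<phi>: "\<phi> \<in> orbit_maps" "u \<in> topspace U" "x = \<phi> u"
    using point_rep[OF x] .
  have "J f = m (\<lambda>v. f (\<phi> v))"
    using supp orbit_maps_image[OF \<phi>(1,2)] \<phi>(3) by (intro fibre_state_unique[OF J \<phi>(1) _ f]) auto
  then show ?thesis
    using expect_eq[OF \<phi>(1,2) f] \<phi>(3) by simp
qed

lemma expect_state:
  assumes x: "x \<in> topspace X"
  shows "state (topspace X) (cfun X) (\<lambda>f. expect f x)"
    and "\<And>f. f \<in> cfun X \<Longrightarrow> (\<And>y. y \<in> X closure_of (a x ` carrier G) \<Longrightarrow> 0 \<le> f y) \<Longrightarrow> 0 \<le> expect f x"
    and "invariant_state G (topspace X) a (cfun X) (\<lambda>f. expect f x)"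
proof -
  obtain \<phi> u where \<phi>: "\<phi> \<in> orbit_maps" "u \<in> topspace U" "x = \<phi> u"
    using point_rep[OF x] .
  have eq: "expect f x = m (\<lambda>v. f (\<phi> v))" if "f \<in> cfun X" for f
    using expect_eq[OF \<phi>(1,2) that] \<phi>(3) by simp
  have st: "state (topspace X) (cfun X) (\<lambda>f. m (\<lambda>u. f (\<phi> u)))"
    using push_state[OF \<phi>(1)] by (simp add: invariant_state_def)
  then show *: "state (topspace X) (cfun X) (\<lambda>f. expect f x)"
    unfolding state_def
    by (simp add: eq fun_space_add[OF fun_space_cfun] fun_space_scale[OF fun_space_cfun] fun_space_const[OF fun_space_cfun])
  show "0 \<le> expect f x" if "f \<in> cfun X" "\<And>y. y \<in> X closure_of (a x ` carrier G) \<Longrightarrow> 0 \<le> f y" for f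
    unfolding eq[OF that(1)]
    using that orbit_maps_image[OF \<phi>(1,2)] \<phi>(3) by (intro state_nonneg[OF m_state orbit_maps_cfun[OF \<phi>(1)]]) auto
  show "invariant_state G (topspace X) a (cfun X) (\<lambda>f. expect f x)"
    using * push_state[OF \<phi>(1)] by (simp add: invariant_state_def eq translate_X)
qed

lemma expect_act:
  assumes x: "x \<in> topspace X" and g: "g \<in> carrier G" and f: "f \<in> cfun X"
  shows "expect f (a x g) = expect f x"
proof -
  obtain \<phi> u where \<phi>: "\<phi> \<in> orbit_maps" "u \<in> topspace U" "x = \<phi> u"
    using point_rep[OF x] .
  then show ?thesis
    using expect_eq[OF \<phi>(1,2) f] expect_eq[OF \<phi>(1) action_in[OF bU \<phi>(2) g] f] orbit_maps_act[OF \<phi>(1,2) g] by simp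
qed

text \<open>By joint continuity and the tube lemma over the compact space \<open>U\<close>,
  pointwise closeness near \<open>\<phi>\<close> is uniform closeness after composition with
  \<open>f\<close>.\<close>

lemma maps_uniform_nbhd:
  assumes f: "f \<in> cfun X" and \<phi>: "\<phi> \<in> orbit_maps" and e: "e > 0"
  obtains W where "openin maps_space W" "\<phi> \<in> W"
    "\<And>\<sigma> u. \<sigma> \<in> W \<Longrightarrow> u \<in> topspace U \<Longrightarrow> \<bar>f (\<sigma> u) - f (\<phi> u)\<bar> < e"
proof -
  let ?P = "prod_topology maps_space U"
  have "(\<lambda>z. f (\<phi> (snd z))) \<in> cfun ?P"
    by (rule cfun_compose[OF continuous_map_snd orbit_maps_cfun[OF \<phi> f]])
  then have c: "(\<lambda>z. \<bar>f (fst z (snd z)) - f (\<phi> (snd z))\<bar>) \<in> cfun ?P"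
    by (rule cfun_abs_diff[OF eval_joint_cfun[OF f]])
  let ?N = "{z \<in> topspace ?P. \<bar>f (fst z (snd z)) - f (\<phi> (snd z))\<bar> < e}"
  have N: "openin ?P ?N"
    using openin_continuous_map_preimage[of ?P euclideanreal _ "{..<e}"] c by (simp add: cfun_def)
  have cU: "compactin U (topspace U)"
    using Ucomp(1) by (simp add: compact_space_def)
  have "\<phi> \<in> topspace maps_space" "{\<phi>} \<times> topspace U \<subseteq> ?N"
    using \<phi> e by (auto simp: topspace_maps)
  from tube_lemma_right[OF N cU this]
  obtain W V where WV: "openin maps_space W" "\<phi> \<in> W" "topspace U \<subseteq> V" "W \<times> V \<subseteq> ?N"
    by (elim exE conjE)
  have "\<bar>f (\<sigma> u) - f (\<phi> u)\<bar> < e" if "\<sigma> \<in> W" "u \<in> topspace U" for \<sigma> u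
  proof -
    have "(\<sigma>, u) \<in> ?N"
      using WV(3,4) that by blast
    then show ?thesis
      by simp
  qed
  then show ?thesis
    using that WV by blast
qed

text \<open>The average depends continuously on the orbit map. It descends to \<open>X\<close>
  because evaluation is onto when all points are periodic, and a continuous map from a compact space
  onto a Hausdorff space is a quotient map.\<close>

lemma expect_cfun:
  assumes f: "f \<in> cfun X"
  shows "expect f \<in> cfun X"
proof -
  let ?P = "prod_topology maps_space U"
  have "continuous_map maps_space euclideanreal (\<lambda>\<phi>. m (\<lambda>u. f (\<phi> u)))"
  proof (rule continuous_map_realI)
    fix \<phi> and e :: real assume \<phi>: "\<phi> \<in> topspace maps_space" and e: "e > 0"
    then obtain W where W: "openin maps_space W" "\<phi> \<in> W"
      "\<And>\<sigma> u. \<sigma> \<in> W \<Longrightarrow> u \<in> topspace U \<Longrightarrow> \<bar>f (\<sigma> u) - f (\<phi> u)\<bar> < e / 2"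
      using maps_uniform_nbhd[OF f, of \<phi> "e / 2"] by (auto simp: topspace_maps)
    have "\<bar>m (\<lambda>u. f (\<sigma> u)) - m (\<lambda>u. f (\<phi> u))\<bar> < e" if \<sigma>: "\<sigma> \<in> W" for \<sigma>
    proof -
      have "\<sigma> \<in> orbit_maps"
        using \<sigma> openin_subset[OF W(1)] by (auto simp: topspace_maps)
      then have "\<bar>m (\<lambda>u. f (\<sigma> u)) - m (\<lambda>u. f (\<phi> u))\<bar> \<le> e / 2"
        using \<phi> f W(3)[OF \<sigma>]
        by (intro state_dist_le[OF m_state] orbit_maps_cfun) (auto simp: topspace_maps intro: less_imp_le)
      then show ?thesis
        using e by linarith
    qed
    then show "\<exists>W. openin maps_space W \<and> \<phi> \<in> W \<and> (\<forall>\<sigma>\<in>W. \<bar>m (\<lambda>u. f (\<sigma> u)) - m (\<lambda>u. f (\<phi> u))\<bar> < e)"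
      using W by blast
  qed
  then have "continuous_map ?P euclideanreal (\<lambda>z. m (\<lambda>u. f (fst z u)))"
    using continuous_map_compose[OF continuous_map_fst] by (force simp: o_def)
  then have "continuous_map ?P euclideanreal (expect f \<circ> (\<lambda>z. fst z (snd z)))"
    by (rule continuous_map_eq) (auto simp: topspace_maps expect_eq[OF _ _ f])
  moreover have "quotient_map ?P X (\<lambda>z. fst z (snd z))"
  proof (rule continuous_imp_quotient_map[OF eval_joint _ comp(2)])
    show "compact_space ?P"
      using maps_compact Ucomp by (simp add: compact_space_prod_topology)
    show "(\<lambda>z. fst z (snd z)) ` topspace ?P = topspace X"
      unfolding all_periodic[symmetric] by (force simp: periodic_points_def topspace_maps)
  qed
  ultimately show ?thesis
    unfolding cfun_def by (simp add: continuous_compose_quotient_map)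
qed

text \<open>Compactness of \<open>maps_space\<close> leaves finitely many orbit maps up to
  \<open>e\<close>. The selection \<open>r\<close> is arbitrary, with no continuity.\<close>

lemma finite_net:
  assumes f: "f \<in> cfun X" and e: "e > 0"
  obtains r where "finite (r ` orbit_maps)" "r ` orbit_maps \<subseteq> orbit_maps"
    "\<And>\<phi> u. \<phi> \<in> orbit_maps \<Longrightarrow> u \<in> topspace U \<Longrightarrow> \<bar>f (\<phi> u) - f (r \<phi> u)\<bar> \<le> e"
proof -
  have "\<exists>W. openin maps_space W \<and> \<phi> \<in> W \<and> (\<forall>\<sigma>\<in>W. \<forall>u\<in>topspace U. \<bar>f (\<sigma> u) - f (\<phi> u)\<bar> < e)"
    if "\<phi> \<in> orbit_maps" for \<phi>
    by (rule maps_uniform_nbhd[OF f that e]) blast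
  then obtain W where W: "\<And>\<phi>. \<phi> \<in> orbit_maps \<Longrightarrow> openin maps_space (W \<phi>)" "\<And>\<phi>. \<phi> \<in> orbit_maps \<Longrightarrow> \<phi> \<in> W \<phi>"
    "\<And>\<phi> \<sigma> u. \<phi> \<in> orbit_maps \<Longrightarrow> \<sigma> \<in> W \<phi> \<Longrightarrow> u \<in> topspace U \<Longrightarrow> \<bar>f (\<sigma> u) - f (\<phi> u)\<bar> < e"
    by metis
  have cm: "compactin maps_space orbit_maps"
    using maps_compact topspace_maps by (metis compact_space_def)
  have "\<exists>\<F>. finite \<F> \<and> \<F> \<subseteq> W ` orbit_maps \<and> orbit_maps \<subseteq> \<Union>\<F>"
    by (rule compactinD[OF cm]) (use W(1,2) in auto)
  then obtain \<F> where \<F>: "finite \<F>" "\<F> \<subseteq> W ` orbit_maps" "orbit_maps \<subseteq> \<Union>\<F>"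
    by (elim exE conjE)
  then obtain R where R: "finite R" "R \<subseteq> orbit_maps" "\<F> = W ` R"
    by (meson finite_subset_image)
  have "\<exists>\<sigma>\<in>R. \<phi> \<in> W \<sigma>" if "\<phi> \<in> orbit_maps" for \<phi>
    using \<F>(3) R(3) that by blast
  then obtain r where r: "\<And>\<phi>. \<phi> \<in> orbit_maps \<Longrightarrow> r \<phi> \<in> R \<and> \<phi> \<in> W (r \<phi>)"
    by metis
  show ?thesis
  proof
    show "finite (r ` orbit_maps)"
      using r R(1) by (intro finite_subset[OF _ R(1)]) auto
    show "r ` orbit_maps \<subseteq> orbit_maps"
      using r R(2) by auto
    show "\<bar>f (\<phi> u) - f (r \<phi> u)\<bar> \<le> e" if "\<phi> \<in> orbit_maps" "u \<in> topspace U" for \<phi> u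
      using W(3)[of "r \<phi>" \<phi> u] r[OF that(1)] R(2) that by (auto intro: less_imp_le)
  qed
qed

abbreviation prod_act :: "('u \<Rightarrow> 'x) \<times> 'u \<Rightarrow> 'g \<Rightarrow> ('u \<Rightarrow> 'x) \<times> 'u" where
  "prod_act \<equiv> \<lambda>z g. (fst z, b (snd z) g)"

abbreviation prod_funs :: "(('u \<Rightarrow> 'x) \<times> 'u \<Rightarrow> real) set" where
  "prod_funs \<equiv> uniform_funs G T (orbit_maps \<times> topspace U) prod_act"

lemma tensor_funs:
  assumes c: "c \<in> bounded_funs orbit_maps" and k: "k \<in> cfun U"
  shows "(\<lambda>z. c (fst z) * k (snd z)) \<in> prod_funs"
proof -
  obtain B where B: "\<And>\<phi>. \<phi> \<in> orbit_maps \<Longrightarrow> \<bar>c \<phi>\<bar> \<le> B"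
    using c by (auto simp: bounded_funs_def)
  obtain C where C: "\<And>u. u \<in> topspace U \<Longrightarrow> \<bar>k u\<bar> \<le> C"
    using cfun_bounded[OF Ucomp(1) k] by blast
  show ?thesis
  proof (rule uniform_funs_transfer[OF cfun_uniform[OF Uflow T grp k] T, where C = B and B = "B * C"])
    fix z assume z: "z \<in> orbit_maps \<times> topspace U"
    show "\<bar>c (fst z) * k (snd z)\<bar> \<le> B * C"
      unfolding abs_mult using z B[of "fst z"] C[of "snd z"]
      by (intro mult_mono) (auto intro: order_trans[OF abs_ge_zero])
    have "\<bar>c (fst z) * k (b (snd z) v) - c (fst z) * k (snd z)\<bar> \<le> B * \<bar>k (b (snd z) v) - k (snd z)\<bar>" for v
      unfolding right_diff_distrib[symmetric] abs_mult using z B[of "fst z"] by (intro mult_right_mono) auto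
    then show "\<exists>u\<in>topspace U. \<forall>v\<in>carrier G.
        \<bar>c (fst (prod_act z v)) * k (snd (prod_act z v)) - c (fst z) * k (snd z)\<bar> \<le> B * \<bar>k (b u v) - k u\<bar>"
      using z by (intro bexI[of _ "snd z"]) auto
  qed
qed

lemma eval_prod_funs:
  assumes f: "f \<in> cfun X"
  shows "(\<lambda>z. f (fst z (snd z))) \<in> prod_funs"
proof -
  obtain B where B: "\<And>x. x \<in> topspace X \<Longrightarrow> \<bar>f x\<bar> \<le> B"
    using cfun_bounded[OF comp(1) f] by blast
  show ?thesis
  proof (rule uniform_funs_transfer[OF cfun_uniform[OF X T grp f] T, where C = 1 and B = B])
    fix z assume z: "z \<in> orbit_maps \<times> topspace U"
    then have x: "fst z (snd z) \<in> topspace X"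
      using orbit_maps_in by auto
    then show "\<bar>f (fst z (snd z))\<bar> \<le> B"
      by (rule B)
    show "\<exists>x\<in>topspace X. \<forall>v\<in>carrier G.
        \<bar>f (fst (prod_act z v) (snd (prod_act z v))) - f (fst z (snd z))\<bar> \<le> 1 * \<bar>f (a x v) - f x\<bar>"
      using x z orbit_maps_act by (intro bexI[of _ "fst z (snd z)"]) auto
  qed
qed

text \<open>A substitute for disintegration. Lift \<open>\<mu>\<close> along evaluation to a state
  \<open>\<nu>\<close> on pairs of an orbit map and a point of \<open>U\<close>. Approximate
  \<open>f (\<phi> u)\<close> by finitely many products of an indicator in \<open>\<phi>\<close> and
  a function of \<open>u\<close>; on each product \<open>\<nu>\<close> integrates the second factor
  by \<open>m\<close>, which is the effect of \<open>expect\<close>.\<close>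

lemma state_expect:
  assumes \<mu>: "invariant_state G (topspace X) a (cfun X) \<mu>" and f: "f \<in> cfun X"
  shows "\<mu> (expect f) = \<mu> f"
proof -
  let ?D = "orbit_maps \<times> topspace U"
  have actD: "action G ?D prod_act"
    using bU by (auto simp: action_def)
  have st\<mu>: "state (topspace X) (cfun X) \<mu>"
    using \<mu> by (simp add: invariant_state_def)
  obtain \<nu> where \<nu>: "invariant_state G ?D prod_act prod_funs \<nu>"
    "\<And>f. f \<in> cfun X \<Longrightarrow> \<nu> (\<lambda>z. f (fst z (snd z))) = \<mu> f"
  proof (rule state_extension[OF G actD n st\<mu>, of "\<lambda>f z. f (fst z (snd z))"])
    show "(\<lambda>z. f (fst z (snd z))) \<in> prod_funs" if "f \<in> cfun X" for f
      by (rule eval_prod_funs[OF that])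
    show "0 \<le> \<mu> f" if "f \<in> cfun X" "\<And>z. z \<in> ?D \<Longrightarrow> 0 \<le> f (fst z (snd z))" for f
    proof (rule state_nonneg[OF st\<mu> that(1)])
      fix x assume "x \<in> topspace X"
      then obtain \<phi> u where "\<phi> \<in> orbit_maps" "u \<in> topspace U" "x = \<phi> u"
        by (rule point_rep)
      then show "0 \<le> f x"
        using that(2)[of "(\<phi>, u)"] by simp
    qed
    show "\<exists>f'\<in>cfun X. \<mu> f' = \<mu> f \<and> (\<forall>z\<in>?D. f (fst (prod_act z g) (snd (prod_act z g))) = f' (fst z (snd z)))"
      if "f \<in> cfun X" "g \<in> carrier G" for f g
      using translate_X[OF that] invariant_stateD[OF \<mu> that(2,1)] orbit_maps_act[OF _ _ that(2)]
      by (intro bexI[of _ "\<lambda>x. f (a x g)"]) auto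
    show "state (topspace X) (cfun X) (\<lambda>f. f (fst z (snd z)))" if "z \<in> ?D" for z
      using that orbit_maps_in by (intro state_point fun_space_cfun) auto
  qed auto
  have st: "state ?D prod_funs \<nu>"
    using \<nu> by (simp add: invariant_state_def)
  note SV = state_space[OF st]
  have split: "\<nu> (\<lambda>z. c (fst z) * k (snd z)) = \<nu> (\<lambda>z. c (fst z)) * m k"
    if "c \<in> bounded_funs orbit_maps" "\<And>\<phi>. 0 \<le> c \<phi>" "k \<in> cfun U" for c k
    using that m_unique tensor_funs translate_U Ucomp(1)
    by (intro invariant_state_product[OF \<nu>(1)]) auto
  have first: "(\<lambda>z. c (fst z)) \<in> prod_funs" if "c \<in> bounded_funs orbit_maps" for c
    using tensor_funs[OF that fun_space_const[OF fun_space_cfun, of 1]] by simp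
  obtain B where B: "\<And>x. x \<in> topspace X \<Longrightarrow> \<bar>f x\<bar> \<le> B"
    using cfun_bounded[OF comp(1) f] by blast
  define t where "t \<phi> = m (\<lambda>u. f (\<phi> u))" for \<phi>
  have tB: "\<bar>t \<phi>\<bar> \<le> B" if "\<phi> \<in> orbit_maps" for \<phi>
    using state_dist_le[OF m_state orbit_maps_cfun[OF that f] fun_space_const[OF fun_space_cfun, of 0]]
      B orbit_maps_in[OF that] state_const[OF m_state] by (simp add: t_def)
  have tb: "t \<in> bounded_funs orbit_maps"
    using tB by (auto simp: bounded_funs_def)
  have "\<bar>\<mu> (expect f) - \<mu> f\<bar> \<le> e" if "e > 0" for e
  proof -
    have e2: "e / 2 > 0"
      using that by simp
    obtain r where r: "finite (r ` orbit_maps)" "r ` orbit_maps \<subseteq> orbit_maps"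
      "\<And>\<phi> u. \<phi> \<in> orbit_maps \<Longrightarrow> u \<in> topspace U \<Longrightarrow> \<bar>f (\<phi> u) - f (r \<phi> u)\<bar> \<le> e / 2"
      by (rule finite_net[OF f e2]) blast
    let ?R = "r ` orbit_maps"
    \<comment> \<open>Indicators of the cells of the net; for each orbit map exactly one of them is
      1.\<close>
    define c where "c \<zeta> \<phi> = (if r \<phi> = \<zeta> then 1 else 0 :: real)" for \<zeta> \<phi>
    have cb: "c \<zeta> \<in> bounded_funs orbit_maps" "\<And>\<phi>. 0 \<le> c \<zeta> \<phi>" for \<zeta>
      by (auto simp: c_def bounded_funs_def intro!: exI[of _ 1])
    have sum_c: "(\<Sum>\<zeta>\<in>?R. c \<zeta> \<phi> * h \<zeta>) = h (r \<phi>)" if "\<phi> \<in> orbit_maps" for \<phi> and h :: "('u \<Rightarrow> 'x) \<Rightarrow> real"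
    proof -
      have "(\<Sum>\<zeta>\<in>?R. c \<zeta> \<phi> * h \<zeta>) = (\<Sum>\<zeta>\<in>?R. if r \<phi> = \<zeta> then h \<zeta> else 0)"
        by (rule sum.cong) (auto simp: c_def)
      then show ?thesis
        using r(1) that by simp
    qed
    have ten: "(\<lambda>z. c \<zeta> (fst z) * f (\<zeta> (snd z))) \<in> prod_funs" if "\<zeta> \<in> ?R" for \<zeta>
      using tensor_funs[OF cb(1) orbit_maps_cfun[OF _ f]] r(2) that by blast
    have ct: "(\<lambda>z. c \<zeta> (fst z) * t \<zeta>) \<in> prod_funs" for \<zeta>
      using tensor_funs[OF cb(1) fun_space_const[OF fun_space_cfun]] .
    \<comment> \<open>\<open>p\<close> is evaluation with each orbit map replaced by its net
      representative, and \<open>s\<close> is \<open>p\<close> averaged over \<open>U\<close>. They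
      differ by at most \<open>e / 2\<close> from evaluation of \<open>f\<close> and from
      \<open>t\<close>, and \<open>\<nu>\<close> gives both the same value.\<close>
    define p where "p z = (\<Sum>\<zeta>\<in>?R. c \<zeta> (fst z) * f (\<zeta> (snd z)))" for z
    define s where "s z = (\<Sum>\<zeta>\<in>?R. c \<zeta> (fst z) * t \<zeta>)" for z :: "('u \<Rightarrow> 'x) \<times> 'u"
    have pV: "p \<in> prod_funs" and sV: "s \<in> prod_funs"
      unfolding p_def[abs_def] s_def[abs_def] by (intro fun_space_sum[OF SV] ten ct; assumption)+
    have "\<nu> p = (\<Sum>\<zeta>\<in>?R. \<nu> (\<lambda>z. c \<zeta> (fst z) * f (\<zeta> (snd z))))"
      unfolding p_def[abs_def] by (rule state_sum[OF st ten])
    also have "\<dots> = (\<Sum>\<zeta>\<in>?R. \<nu> (\<lambda>z. c \<zeta> (fst z)) * t \<zeta>)"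
    proof (rule sum.cong[OF refl])
      fix \<zeta> assume "\<zeta> \<in> ?R"
      then show "\<nu> (\<lambda>z. c \<zeta> (fst z) * f (\<zeta> (snd z))) = \<nu> (\<lambda>z. c \<zeta> (fst z)) * t \<zeta>"
        unfolding t_def using r(2) by (intro split cb orbit_maps_cfun[OF _ f]) auto
    qed
    also have "\<dots> = (\<Sum>\<zeta>\<in>?R. \<nu> (\<lambda>z. c \<zeta> (fst z) * t \<zeta>))"
      using state_scale[OF st first[OF cb(1)]] by (simp add: mult.commute)
    also have "\<dots> = \<nu> s"
      unfolding s_def[abs_def] by (rule state_sum[OF st ct, symmetric])
    finally have ps: "\<nu> p = \<nu> s" .
    have "\<bar>\<nu> (\<lambda>z. f (fst z (snd z))) - \<nu> p\<bar> \<le> e / 2"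
      using r(3) by (intro state_dist_le[OF st eval_prod_funs[OF f] pV]) (auto simp: p_def sum_c[where h = "\<lambda>\<zeta>. f (\<zeta> _)"])
    moreover have "\<bar>\<nu> (\<lambda>z. t (fst z)) - \<nu> s\<bar> \<le> e / 2"
    proof (rule state_dist_le[OF st first[OF tb] sV])
      fix z assume z: "z \<in> ?D"
      then have "\<bar>t (fst z) - t (r (fst z))\<bar> \<le> e / 2"
        unfolding t_def using r(2,3) by (intro state_dist_le[OF m_state] orbit_maps_cfun[OF _ f]) auto
      then show "\<bar>t (fst z) - s z\<bar> \<le> e / 2"
        using z by (auto simp: s_def sum_c)
    qed
    moreover have "\<nu> (\<lambda>z. t (fst z)) = \<nu> (\<lambda>z. expect f (fst z (snd z)))"
      by (rule state_cong[OF st first[OF tb] eval_prod_funs[OF expect_cfun[OF f]]])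
        (auto simp: t_def expect_eq[OF _ _ f])
    ultimately have "\<bar>\<nu> (\<lambda>z. expect f (fst z (snd z))) - \<nu> (\<lambda>z. f (fst z (snd z)))\<bar> \<le> e"
      using ps by linarith
    then show ?thesis
      by (simp add: \<nu>(2)[OF f] \<nu>(2)[OF expect_cfun[OF f]])
  qed
  then show ?thesis
    by (rule real_eq_by_dist)
qed

end

section \<open>Subgroups and quotients\<close>

lemma topological_group_subgroup:
  assumes G: "topological_group G T" and H: "subgroup H G"
  shows "topological_group (G\<lparr>carrier := H\<rparr>) (subtopology T H)"
proof -
  interpret group G using G by (simp add: topological_group_def)
  interpret subgroup H G by fact
  have T: "topspace T = carrier G"
    using G by (simp add: topological_group_def)
  have m: "continuous_map (prod_topology T T) T (\<lambda>(x, y). x \<otimes>\<^bsub>G\<^esub> y)" and i: "continuous_map T T (\<lambda>x. inv\<^bsub>G\<^esub> x)"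
    using G by (auto simp: topological_group_def)
  have tH: "topspace (subtopology T H) = H"
    using T subset by auto
  have "continuous_map (prod_topology (subtopology T H) (subtopology T H)) (subtopology T H) (\<lambda>(x, y). x \<otimes>\<^bsub>G\<^esub> y)"
    unfolding continuous_map_in_subtopology
  proof
    show "continuous_map (prod_topology (subtopology T H) (subtopology T H)) T (\<lambda>(x, y). x \<otimes>\<^bsub>G\<^esub> y)"
      using m by (simp add: subtopology_Times[symmetric] continuous_map_from_subtopology)
  qed (use tH in auto)
  moreover have "continuous_map (subtopology T H) (subtopology T H) (\<lambda>x. inv\<^bsub>G\<lparr>carrier := H\<rparr>\<^esub> x)"
  proof (rule continuous_map_eq)
    show "continuous_map (subtopology T H) (subtopology T H) (\<lambda>x. inv\<^bsub>G\<^esub> x)"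
      using i tH by (auto simp: continuous_map_in_subtopology continuous_map_from_subtopology)
  qed (use tH H in \<open>simp add: m_inv_consistent\<close>)
  ultimately show ?thesis
    using subgroup_imp_group[OF H] tH by (simp add: topological_group_def)
qed

text \<open>The preimage of the image of \<open>A\<close> is \<open>H A\<close>, a union of
  translates of \<open>A\<close>.\<close>

lemma coset_open_image:
  assumes G: "topological_group G T" and H: "subgroup H G" and A: "openin T A"
  shows "openin (coset_topology G T H) ((\<lambda>x. H #>\<^bsub>G\<^esub> x) ` A)"
proof -
  interpret group G using G by (simp add: topological_group_def)
  interpret subgroup H G by fact
  have T: "topspace T = carrier G"
    using G by (simp add: topological_group_def)
  have m: "continuous_map (prod_topology T T) T (\<lambda>(x, y). x \<otimes>\<^bsub>G\<^esub> y)"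
    using G by (auto simp: topological_group_def)
  have AG: "A \<subseteq> carrier G"
    using openin_subset[OF A] T by simp
  have "{x \<in> topspace T. H #>\<^bsub>G\<^esub> x \<in> (\<lambda>x. H #>\<^bsub>G\<^esub> x) ` A} = (\<Union>h\<in>H. {x \<in> topspace T. inv\<^bsub>G\<^esub> h \<otimes>\<^bsub>G\<^esub> x \<in> A})"
  proof (intro equalityI subsetI)
    fix x assume "x \<in> {x \<in> topspace T. H #>\<^bsub>G\<^esub> x \<in> (\<lambda>x. H #>\<^bsub>G\<^esub> x) ` A}"
    then obtain y where y: "x \<in> carrier G" "y \<in> A" "H #>\<^bsub>G\<^esub> x = H #>\<^bsub>G\<^esub> y"
      using T by auto
    then have "x \<in> H #>\<^bsub>G\<^esub> y"
      using rcos_self[OF y(1) H] by simp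
    then obtain h where "h \<in> H" "x = h \<otimes>\<^bsub>G\<^esub> y"
      by (auto simp: r_coset_def)
    then show "x \<in> (\<Union>h\<in>H. {x \<in> topspace T. inv\<^bsub>G\<^esub> h \<otimes>\<^bsub>G\<^esub> x \<in> A})"
      using y AG T by (auto simp: m_assoc[symmetric] intro!: bexI[of _ h])
  next
    fix x assume "x \<in> (\<Union>h\<in>H. {x \<in> topspace T. inv\<^bsub>G\<^esub> h \<otimes>\<^bsub>G\<^esub> x \<in> A})"
    then obtain h where h: "h \<in> H" "x \<in> carrier G" "inv\<^bsub>G\<^esub> h \<otimes>\<^bsub>G\<^esub> x \<in> A"
      using T by auto
    then have "inv\<^bsub>G\<^esub> h \<otimes>\<^bsub>G\<^esub> x \<in> H #>\<^bsub>G\<^esub> x"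
      by (auto simp: r_coset_def)
    then have "H #>\<^bsub>G\<^esub> x = H #>\<^bsub>G\<^esub> (inv\<^bsub>G\<^esub> h \<otimes>\<^bsub>G\<^esub> x)"
      using h H by (intro repr_independence)
    then show "x \<in> {x \<in> topspace T. H #>\<^bsub>G\<^esub> x \<in> (\<lambda>x. H #>\<^bsub>G\<^esub> x) ` A}"
      using h T by blast
  qed
  moreover have "openin T {x \<in> topspace T. inv\<^bsub>G\<^esub> h \<otimes>\<^bsub>G\<^esub> x \<in> A}" if "h \<in> H" for h
  proof -
    have "continuous_map T T (\<lambda>x. inv\<^bsub>G\<^esub> h \<otimes>\<^bsub>G\<^esub> x)"
      using continuous_map_compose[OF _ m, of T "\<lambda>x. (inv\<^bsub>G\<^esub> h, x)"] that T
      by (simp add: continuous_map_pairwise o_def)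
    then show ?thesis
      using A by (rule openin_continuous_map_preimage)
  qed
  ultimately show ?thesis
    using AG by (auto simp: openin_coset_topology carrier_FactGroup)
qed

text \<open>A product of quotient maps need not be a quotient map, so multiplication is treated with
  the openness of the projection: open boxes in \<open>G\<close> are pushed forward. For inversion
  the quotient property suffices.\<close>

lemma topological_group_quotient:
  assumes G: "topological_group G T" and H: "H \<lhd> G"
  shows "topological_group (G Mod H) (coset_topology G T H)"
proof -
  interpret normal H G by fact
  let ?Q = "coset_topology G T H" and ?p = "\<lambda>x. H #>\<^bsub>G\<^esub> x"
  have T: "topspace T = carrier G"
    using G by (simp add: topological_group_def)
  have m: "continuous_map (prod_topology T T) T (\<lambda>(x, y). x \<otimes>\<^bsub>G\<^esub> y)" and i: "continuous_map T T (\<lambda>x. inv\<^bsub>G\<^esub> x)"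
    using G by (auto simp: topological_group_def)
  have q: "quotient_map T ?Q ?p"
    by (rule quotient_map_coset_topology[OF T])
  have tQ: "topspace ?Q = carrier (G Mod H)"
    using quotient_imp_surjective_map[OF q] T by (simp add: carrier_FactGroup)
  have p: "continuous_map T ?Q ?p"
    using q by (rule quotient_imp_continuous_map)
  have sub: "subgroup H G"
    by (rule subgroup_axioms)
  have "continuous_map (prod_topology ?Q ?Q) ?Q (\<lambda>(x, y). x <#>\<^bsub>G\<^esub> y)"
    unfolding continuous_map
  proof (intro conjI allI impI)
    show "(\<lambda>(x, y). x <#>\<^bsub>G\<^esub> y) ` topspace (prod_topology ?Q ?Q) \<subseteq> topspace ?Q"
      by (auto simp: tQ carrier_FactGroup rcos_sum)
    fix W assume W: "openin ?Q W"
    let ?S = "{z \<in> topspace (prod_topology ?Q ?Q). (case z of (x, y) \<Rightarrow> x <#>\<^bsub>G\<^esub> y) \<in> W}"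
    let ?M = "{z \<in> topspace (prod_topology T T). ?p (fst z \<otimes>\<^bsub>G\<^esub> snd z) \<in> W}"
    have M: "openin (prod_topology T T) ?M"
      using openin_continuous_map_preimage[OF continuous_map_compose[OF m p] W] by (simp add: o_def case_prod_unfold)
    show "openin (prod_topology ?Q ?Q) ?S"
      unfolding openin_prod_topology_alt
    proof (intro allI impI)
      fix k l assume kl: "(k, l) \<in> ?S"
      then obtain x y where xy: "x \<in> carrier G" "y \<in> carrier G" "k = ?p x" "l = ?p y"
        by (auto simp: tQ carrier_FactGroup)
      then have "(x, y) \<in> ?M"
        using kl T by (simp add: rcos_sum)
      then have "\<exists>A B. openin T A \<and> openin T B \<and> x \<in> A \<and> y \<in> B \<and> A \<times> B \<subseteq> ?M"
        using M[unfolded openin_prod_topology_alt, rule_format, of x y] by simp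
      then obtain A B where AB: "openin T A" "openin T B" "x \<in> A" "y \<in> B" "A \<times> B \<subseteq> ?M"
        by (elim exE conjE)
      have "?p ` A \<times> ?p ` B \<subseteq> ?S"
      proof (rule subsetI)
        fix z assume "z \<in> ?p ` A \<times> ?p ` B"
        then obtain u v where uv: "u \<in> A" "v \<in> B" "z = (?p u, ?p v)"
          by auto
        have "u \<in> carrier G" "v \<in> carrier G"
          using uv openin_subset[OF AB(1)] openin_subset[OF AB(2)] T by auto
        moreover have "(u, v) \<in> ?M"
          using AB(5) uv by blast
        ultimately show "z \<in> ?S"
          by (simp add: uv tQ carrier_FactGroup rcos_sum)
      qed
      then show "\<exists>U V. openin ?Q U \<and> openin ?Q V \<and> k \<in> U \<and> l \<in> V \<and> U \<times> V \<subseteq> ?S"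
        using coset_open_image[OF G sub AB(1)] coset_open_image[OF G sub AB(2)] AB(3,4) xy(3,4) by blast
    qed
  qed
  moreover have "continuous_map ?Q ?Q (\<lambda>x. inv\<^bsub>G Mod H\<^esub> x)"
  proof (rule continuous_compose_quotient_map[OF q])
    show "continuous_map T ?Q ((\<lambda>x. inv\<^bsub>G Mod H\<^esub> x) \<circ> ?p)"
      by (rule continuous_map_eq[OF continuous_map_compose[OF i p]])
        (auto simp: T inv_FactGroup carrier_FactGroup rcos_inv)
  qed
  ultimately show ?thesis
    using factorgroup_is_group tQ by (simp add: topological_group_def)
qed

lemma unique_state_UMF:
  fixes G :: "('g, 'm) monoid_scheme" and T :: "'g topology"
  assumes G: "topological_group G T" and ue: "uniquely_ergodic G T"
  obtains m n where "invariant_state G (topspace (fst (UMF G T))) (snd (UMF G T)) (cfun (fst (UMF G T))) m"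
    "\<And>J f. invariant_state G (topspace (fst (UMF G T))) (snd (UMF G T)) (cfun (fst (UMF G T))) J \<Longrightarrow>
      f \<in> cfun (fst (UMF G T)) \<Longrightarrow> J f = m f"
    "invariant_state G (carrier G) (\<otimes>\<^bsub>G\<^esub>) (group_funs G T) n"
proof -
  have T: "topspace T = carrier G"
    using G by (simp add: topological_group_def)
  note U = is_universal_minimal_flow_UMF[OF G]
  then have fl: "flow G T (fst (UMF G T)) (snd (UMF G T))"
    by (simp add: is_universal_minimal_flow_def minimal_flow_def)
  obtain m where m: "invariant_state G (topspace (fst (UMF G T))) (snd (UMF G T)) (cfun (fst (UMF G T))) m"
    "\<forall>J. invariant_state G (topspace (fst (UMF G T))) (snd (UMF G T)) (cfun (fst (UMF G T))) J \<longrightarrow>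
      (\<forall>f\<in>cfun (fst (UMF G T)). J f = m f)"
    using ue unfolding uniquely_ergodic_def unique_invariant_measure_iff[OF fl T] by blast
  obtain n where "invariant_state G (carrier G) (\<otimes>\<^bsub>G\<^esub>) (group_funs G T) n"
    using invariant_mean_exists[OF G U m(1)] .
  then show ?thesis
    using that m by blast
qed

section \<open>The extension\<close>

locale group_extension =
  fixes G :: "('g, 'm) monoid_scheme" and T :: "'g topology" and H :: "'g set"
    and X :: "'x topology" and a :: "'x \<Rightarrow> 'g \<Rightarrow> 'x"
  assumes G: "topological_group G T" and H: "H \<lhd> G" and X: "minimal_flow G T X a"
begin

sublocale normal H G by (rule H)

abbreviation "p x \<equiv> H #>\<^bsub>G\<^esub> x"
abbreviation "K \<equiv> G Mod H"
abbreviation "TK \<equiv> coset_topology G T H"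

lemma T: "topspace T = carrier G"
  using G by (simp add: topological_group_def)

lemma Xflow: "flow G T X a"
  using X by (simp add: minimal_flow_def)

lemma comp: "compact_space X" "Hausdorff_space X" "topspace X \<noteq> {}"
  using Xflow by (auto simp: flow_def)

lemma act: "action G (topspace X) a"
  by (rule action_flow[OF Xflow T])

lemma subflow: "flow (G\<lparr>carrier := H\<rparr>) (subtopology T H) X a"
  unfolding flow_def
proof (intro conjI ballI comp)
  have "continuous_map (prod_topology X T) X (\<lambda>(x, g). a x g)"
    using Xflow by (simp add: flow_def)
  then show "continuous_map (prod_topology X (subtopology T H)) X (\<lambda>(x, g). a x g)"
    unfolding prod_topology_subtopology(2) by (rule continuous_map_from_subtopology)
  fix x assume "x \<in> topspace X"
  then show "a x \<one>\<^bsub>G\<lparr>carrier := H\<rparr>\<^esub> = x"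
    "\<And>g h. g \<in> carrier (G\<lparr>carrier := H\<rparr>) \<Longrightarrow> h \<in> carrier (G\<lparr>carrier := H\<rparr>) \<Longrightarrow>
      a (a x g) h = a x (g \<otimes>\<^bsub>G\<lparr>carrier := H\<rparr>\<^esub> h)"
    using action_one[OF act] action_mult[OF act] by auto
qed

lemma translate: "f \<in> cfun X \<Longrightarrow> g \<in> carrier G \<Longrightarrow> (\<lambda>x. f (a x g)) \<in> cfun X"
  by (rule cfun_compose[OF flow_act_continuous[OF Xflow T]])

lemma act_swap:
  assumes "x \<in> topspace X" "g \<in> carrier G" "h \<in> H"
  shows "a (a x g) h = a (a x (g \<otimes>\<^bsub>G\<^esub> h \<otimes>\<^bsub>G\<^esub> inv\<^bsub>G\<^esub> g)) g"
    and "a (a x h) g = a (a x g) (inv\<^bsub>G\<^esub> g \<otimes>\<^bsub>G\<^esub> h \<otimes>\<^bsub>G\<^esub> g)"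
proof -
  have *: "g \<otimes>\<^bsub>G\<^esub> h \<otimes>\<^bsub>G\<^esub> inv\<^bsub>G\<^esub> g \<in> carrier G" "inv\<^bsub>G\<^esub> g \<otimes>\<^bsub>G\<^esub> h \<otimes>\<^bsub>G\<^esub> g \<in> carrier G" "h \<in> carrier G"
    using assms by auto
  show "a (a x g) h = a (a x (g \<otimes>\<^bsub>G\<^esub> h \<otimes>\<^bsub>G\<^esub> inv\<^bsub>G\<^esub> g)) g"
    using assms * by (simp add: action_mult[OF act] m_assoc)
  show "a (a x h) g = a (a x g) (inv\<^bsub>G\<^esub> g \<otimes>\<^bsub>G\<^esub> h \<otimes>\<^bsub>G\<^esub> g)"
    using assms * by (simp add: action_mult[OF act] m_assoc[symmetric])
qed

text \<open>By normality \<open>g H = H g\<close>, so translation by \<open>g\<close> carries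
  \<open>H\<close>-orbits to \<open>H\<close>-orbits; it is a homeomorphism and respects
  closures.\<close>

lemma closure_translate:
  assumes x: "x \<in> topspace X" and g: "g \<in> carrier G"
  shows "X closure_of (a (a x g) ` H) = (\<lambda>y. a y g) ` (X closure_of (a x ` H))"
proof -
  have "homeomorphic_maps X X (\<lambda>y. a y g) (\<lambda>y. a y (inv\<^bsub>G\<^esub> g))"
    using g flow_act_continuous[OF Xflow T] action_mult[OF act] action_one[OF act]
    by (simp add: homeomorphic_maps_def)
  then have hm: "homeomorphic_map X X (\<lambda>y. a y g)"
    using homeomorphic_map_maps by blast
  have sub: "a x ` H \<subseteq> topspace X"
    using action_in[OF act x] by auto
  have "a (a x g) ` H = (\<lambda>y. a y g) ` (a x ` H)"
  proof (intro equalityI subsetI)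
    fix y assume "y \<in> a (a x g) ` H"
    then show "y \<in> (\<lambda>y. a y g) ` (a x ` H)"
      using act_swap(1)[OF x g] inv_op_closed2[OF g] by blast
  next
    fix y assume "y \<in> (\<lambda>y. a y g) ` (a x ` H)"
    then show "y \<in> a (a x g) ` H"
      using act_swap(2)[OF x g] inv_op_closed1[OF g] by blast
  qed
  then show ?thesis
    using homeomorphic_map_closure_of[OF hm sub] by simp
qed

definition invariant_funs :: "('x \<Rightarrow> real) set" where
  "invariant_funs = {f \<in> cfun X. \<forall>x\<in>topspace X. \<forall>h\<in>H. f (a x h) = f x}"

lemma fun_space_invariant: "fun_space invariant_funs"
  using fun_space_cfun[of X] unfolding fun_space_def invariant_funs_def by simp

lemma invariant_cfun: "f \<in> invariant_funs \<Longrightarrow> f \<in> cfun X"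
  by (simp add: invariant_funs_def)

lemma translate_invariant:
  assumes f: "f \<in> invariant_funs" and g: "g \<in> carrier G"
  shows "(\<lambda>x. f (a x g)) \<in> invariant_funs"
proof -
  have "f (a (a x h) g) = f (a x g)" if x: "x \<in> topspace X" and h: "h \<in> H" for x h
    using f inv_op_closed1[OF g h] action_in[OF act x g] act_swap(2)[OF x g h] by (simp add: invariant_funs_def)
  then show ?thesis
    using translate[OF invariant_cfun[OF f] g] by (simp add: invariant_funs_def)
qed

text \<open>An \<open>H\<close>-invariant function is constant on the image of a coset under an orbit map, so any
  choice of representatives will do.\<close>

definition base :: 'x where "base = (SOME x. x \<in> topspace X)"

definition rep :: "'g set \<Rightarrow> 'x" where "rep k = a base (SOME g. g \<in> carrier G \<and> k = p g)"

lemma base: "base \<in> topspace X"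
  unfolding base_def using comp(3) by (metis ex_in_conv someI_ex)

lemma carrier_K: "k \<in> carrier K \<Longrightarrow> \<exists>g. g \<in> carrier G \<and> k = p g"
  by (auto simp: carrier_FactGroup)

lemma rep_in: "k \<in> carrier K \<Longrightarrow> rep k \<in> topspace X"
  unfolding rep_def using someI_ex[OF carrier_K] action_in[OF act base] by blast

lemma invariant_rep:
  assumes f: "f \<in> invariant_funs" and g: "g \<in> carrier G"
  shows "f (rep (p g)) = f (a base g)"
proof -
  define r where "r = (SOME r. r \<in> carrier G \<and> p g = p r)"
  have "\<exists>r. r \<in> carrier G \<and> p g = p r"
    using g by blast
  then have r: "r \<in> carrier G" "p g = p r"
    unfolding r_def by (metis (mono_tags, lifting) someI_ex)+
  then have "r \<in> p g"
    using rcos_self[OF r(1) subgroup_axioms] by simp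
  then obtain h where h: "h \<in> H" "r = h \<otimes>\<^bsub>G\<^esub> g"
    by (auto simp: r_coset_def)
  have "f (a base r) = f (a (a base h) g)"
    using h g by (simp add: action_mult[OF act base])
  \<comment> \<open>The translate of \<open>f\<close> by \<open>g\<close> is again
    \<open>H\<close>-invariant by normality, so it does not see \<open>h\<close>.\<close>
  also have "\<dots> = f (a base g)"
    using translate_invariant[OF f g] h(1) base by (simp add: invariant_funs_def)
  finally show ?thesis
    by (simp add: rep_def r_def)
qed

text \<open>\<open>rep\<close> is not equivariant, being a choice; it becomes so after composition
  with an invariant function.\<close>

lemma invariant_rep_mult:
  assumes f: "f \<in> invariant_funs" and k: "k \<in> carrier K" and g: "g \<in> carrier G"
  shows "f (rep (k <#>\<^bsub>G\<^esub> p g)) = f (a (rep k) g)"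
proof -
  obtain r where r: "r \<in> carrier G" "k = p r"
    using carrier_K[OF k] by blast
  have "f (rep (k <#>\<^bsub>G\<^esub> p g)) = f (a base (r \<otimes>\<^bsub>G\<^esub> g))"
    using invariant_rep[OF f, of "r \<otimes>\<^bsub>G\<^esub> g"] r g by (simp add: rcos_sum)
  also have "\<dots> = f (a (a base r) g)"
    using r g by (simp add: action_mult[OF act base])
  also have "\<dots> = f (a (rep k) g)"
    using invariant_rep[OF translate_invariant[OF f g] r(1)] r(2) by simp
  finally show ?thesis .
qed

text \<open>A neighbourhood for \<open>f\<close> in \<open>G\<close> projects to a neighbourhood in
  \<open>K\<close>, as the projection is open.\<close>

lemma invariant_group_fun:
  assumes f: "f \<in> invariant_funs"
  shows "(\<lambda>k. f (rep k)) \<in> group_funs K TK"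
proof -
  have fc: "f \<in> cfun X"
    by (rule invariant_cfun[OF f])
  obtain B where B: "\<And>x. x \<in> topspace X \<Longrightarrow> \<bar>f x\<bar> \<le> B"
    using cfun_bounded[OF comp(1) fc] by blast
  show ?thesis
  proof (rule uniform_funsI[OF B[OF rep_in]])
    fix e :: real assume e: "e > 0"
    obtain V where V: "openin T V" "\<one>\<^bsub>G\<^esub> \<in> V" "\<And>x v. x \<in> topspace X \<Longrightarrow> v \<in> V \<Longrightarrow> \<bar>f (a x v) - f x\<bar> \<le> e"
      by (rule uniform_funsD[OF cfun_uniform[OF Xflow T is_group fc] e]) blast
    have "\<bar>f (rep (k <#>\<^bsub>G\<^esub> p v)) - f (rep k)\<bar> \<le> e" if k: "k \<in> carrier K" and v: "v \<in> V" for k v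
    proof -
      have "v \<in> carrier G"
        using openin_subset[OF V(1)] T v by auto
      then show ?thesis
        using V(3)[OF rep_in[OF k] v] by (simp add: invariant_rep_mult[OF f k])
    qed
    moreover have "openin TK (p ` V)"
      by (rule coset_open_image[OF G subgroup_axioms V(1)])
    moreover have "\<one>\<^bsub>K\<^esub> \<in> p ` V"
      using V(2) coset_mult_one[OF subset] by (simp add: image_iff) metis
    ultimately show "\<exists>W. openin TK W \<and> \<one>\<^bsub>K\<^esub> \<in> W \<and>
        (\<forall>k\<in>carrier K. \<forall>w\<in>W. \<bar>f (rep (k \<otimes>\<^bsub>K\<^esub> w)) - f (rep k)\<bar> \<le> e)"
      by (intro exI[of _ "p ` V"]) auto
  qed
qed

lemma invariant_state_exists:
  assumes n: "invariant_state K (carrier K) (\<otimes>\<^bsub>K\<^esub>) (group_funs K TK) n"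
  shows "invariant_state G (topspace X) a invariant_funs (\<lambda>f. n (\<lambda>k. f (rep k)))"
  unfolding invariant_state_def
proof (intro conjI ballI)
  have st: "state (carrier K) (group_funs K TK) n"
    using n by (simp add: invariant_state_def)
  show "state (topspace X) invariant_funs (\<lambda>f. n (\<lambda>k. f (rep k)))"
    by (rule state_pullback[where k = rep, OF st fun_space_invariant invariant_group_fun rep_in])
  fix g f assume g: "g \<in> carrier G" and f: "f \<in> invariant_funs"
  have pg: "p g \<in> carrier K"
    using g by (auto simp: carrier_FactGroup)
  have KG: "topological_group K TK"
    by (rule topological_group_quotient[OF G H])
  have "n (\<lambda>k. f (a (rep k) g)) = n (\<lambda>k. f (rep (k \<otimes>\<^bsub>K\<^esub> p g)))"
    using invariant_rep_mult[OF f _ g] factorgroup_is_group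
    by (intro state_cong[OF st] invariant_group_fun translate_invariant f g
        translate_fun[OF KG action_group invariant_group_fun[OF f] pg]) auto
  also have "\<dots> = n (\<lambda>k. f (rep k))"
    by (rule invariant_stateD[OF n pg invariant_group_fun[OF f]])
  finally show "n (\<lambda>k. f (a (rep k) g)) = n (\<lambda>k. f (rep k))" .
qed

text \<open>No quotient flow of \<open>X\<close> by \<open>H\<close> is formed. Invariant functions
  are carried to the universal minimal flow \<open>W\<close> of \<open>K\<close> by
  \<open>j\<close>, and any invariant state on them extends along \<open>j\<close> to an invariant
  state on \<open>W\<close>, hence is determined by \<open>m\<close>.\<close>

lemma invariant_state_unique:
  assumes W: "is_universal_minimal_flow K TK W b"
    and m: "\<And>J k. invariant_state K (topspace W) b (cfun W) J \<Longrightarrow> k \<in> cfun W \<Longrightarrow> J k = m k"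
    and n: "invariant_state K (carrier K) (\<otimes>\<^bsub>K\<^esub>) (group_funs K TK) n"
    and I: "invariant_state G (topspace X) a invariant_funs I"
    and J: "invariant_state G (topspace X) a invariant_funs J" and f: "f \<in> invariant_funs"
  shows "I f = J f"
proof -
  have KG: "topological_group K TK"
    by (rule topological_group_quotient[OF G H])
  have TK: "topspace TK = carrier K" and Kgrp: "group K"
    using KG by (auto simp: topological_group_def)
  have fl: "flow K TK W b"
    using W by (simp add: is_universal_minimal_flow_def minimal_flow_def)
  have aW: "action K (topspace W) b"
    by (rule action_flow[OF fl TK])
  have cW: "cfun W \<subseteq> uniform_funs K TK (topspace W) b"
    using cfun_uniform[OF fl TK Kgrp] by blast
  obtain \<psi> where \<psi>: "\<And>w. w \<in> topspace W \<Longrightarrow> \<psi> w \<in> ambit_points K TK"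
    "\<And>F. F \<in> group_funs K TK \<Longrightarrow> (\<lambda>w. \<psi> w F) \<in> cfun W"
    "\<And>w k F. w \<in> topspace W \<Longrightarrow> k \<in> carrier K \<Longrightarrow> F \<in> group_funs K TK \<Longrightarrow>
      \<psi> (b w k) F = \<psi> w (\<lambda>l. F (l \<otimes>\<^bsub>K\<^esub> k))"
    using universal_ambit_map[OF KG W] by blast
  note st\<psi> = ambit_state[OF KG \<psi>(1)]
  \<comment> \<open>\<open>j f w\<close> is the value of \<open>f\<close> at a limit point of the
    representatives \<open>rep k\<close> along the ambit point \<open>\<psi> w\<close>.\<close>
  define j where "j f w = \<psi> w (\<lambda>k. f (rep k))" for f w
  have jW: "j f \<in> cfun W" if "f \<in> invariant_funs" for f
    unfolding j_def[abs_def] by (rule \<psi>(2)[OF invariant_group_fun[OF that]])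
  have j_act: "j f (b w (p g)) = j (\<lambda>x. f (a x g)) w"
    if "f \<in> invariant_funs" "w \<in> topspace W" "g \<in> carrier G" for f w g
  proof -
    have pg: "p g \<in> carrier K"
      using that(3) by (auto simp: carrier_FactGroup)
    have "j f (b w (p g)) = \<psi> w (\<lambda>k. f (rep (k \<otimes>\<^bsub>K\<^esub> p g)))"
      unfolding j_def by (rule \<psi>(3)[OF that(2) pg invariant_group_fun[OF that(1)]])
    also have "\<dots> = j (\<lambda>x. f (a x g)) w"
      unfolding j_def using invariant_rep_mult[OF that(1) _ that(3)] Kgrp
      by (intro state_cong[OF st\<psi>[OF that(2)]] invariant_group_fun translate_invariant that
          translate_fun[OF KG action_group invariant_group_fun[OF that(1)] pg]) auto
    finally show ?thesis .
  qed
  \<comment> \<open>This is where minimality of \<open>X\<close> enters: positivity of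
    \<open>j f\<close> on the \<open>K\<close>-orbit of one \<open>w\<close> is positivity of
    \<open>f\<close> on the \<open>G\<close>-orbit of a point \<open>y\<close>, which is
    dense.\<close>
  have nonneg: "0 \<le> f x" if f: "f \<in> invariant_funs" and pos: "\<And>w. w \<in> topspace W \<Longrightarrow> 0 \<le> j f w" and x: "x \<in> topspace X" for f x
  proof -
    obtain w where w: "w \<in> topspace W"
      using fl unfolding flow_def by blast
    obtain y where y: "y \<in> topspace X" "\<And>f. f \<in> invariant_funs \<Longrightarrow> f y = \<psi> w (\<lambda>k. f (rep k))"
    proof (rule ambit_point[where \<xi> = rep and B = invariant_funs and q = "\<psi> w" and X = X and G = K and T = TK])
    qed (use comp(1) rep_in invariant_cfun invariant_group_fun \<psi>(1)[OF w] in blast)+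
    have "0 \<le> f (a y g)" if g: "g \<in> carrier G" for g
    proof -
      have "p g \<in> carrier K"
        using g by (auto simp: carrier_FactGroup)
      then have "0 \<le> j f (b w (p g))"
        using pos action_in[OF aW w] by blast
      also have "\<dots> = f (a y g)"
        using y(2)[OF translate_invariant[OF f g]] j_act[OF f w g] by (simp add: j_def)
      finally show ?thesis .
    qed
    moreover have "(\<lambda>x. -1 * f x) \<in> cfun X"
      by (rule fun_space_scale[OF fun_space_cfun invariant_cfun[OF f]])
    moreover have "x \<in> X closure_of (a y ` carrier G)"
      using X y(1) x by (simp add: minimal_flow_def)
    ultimately show ?thesis
      using closure_le[of "\<lambda>x. -1 * f x" X "a y ` carrier G" 0 x] by auto
  qed
  have eq: "J f = m (j f)" if J: "invariant_state G (topspace X) a invariant_funs J" and f: "f \<in> invariant_funs" for J f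
  proof -
    have stJ: "state (topspace X) invariant_funs J"
      using J by (simp add: invariant_state_def)
    obtain I where I: "invariant_state K (topspace W) b (uniform_funs K TK (topspace W) b) I"
      "\<And>f. f \<in> invariant_funs \<Longrightarrow> I (j f) = J f"
    proof (rule state_extension[OF KG aW n stJ, of j])
      show "j f \<in> uniform_funs K TK (topspace W) b" if "f \<in> invariant_funs" for f
        using jW[OF that] cW by blast
      show "state (topspace X) invariant_funs (\<lambda>f. j f w)" if "w \<in> topspace W" for w
        unfolding j_def
        by (rule state_pullback[where k = rep, OF st\<psi>[OF that] fun_space_invariant invariant_group_fun rep_in])
      show "0 \<le> J f" if "f \<in> invariant_funs" "\<And>w. w \<in> topspace W \<Longrightarrow> 0 \<le> j f w" for f
        by (rule state_nonneg[OF stJ that(1) nonneg[OF that]])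
      show "\<exists>f'\<in>invariant_funs. J f' = J f \<and> (\<forall>w\<in>topspace W. j f (b w k) = j f' w)"
        if f: "f \<in> invariant_funs" and k: "k \<in> carrier K" for f k
      proof -
        obtain g where g: "g \<in> carrier G" "k = p g"
          using carrier_K[OF k] by blast
        then show ?thesis
          using translate_invariant[OF f g(1)] invariant_stateD[OF J g(1) f] j_act[OF f _ g(1)]
          by (intro bexI[of _ "\<lambda>x. f (a x g)"]) auto
      qed
    qed auto
    have "invariant_state K (topspace W) b (cfun W) I"
      by (rule invariant_state_subspace[OF I(1) cW fun_space_cfun])
    from m[OF this jW[OF f]] I(2)[OF f] show ?thesis
      by simp
  qed
  show ?thesis
    using eq[OF I f] eq[OF J f] by simp
qed

end

section \<open>Every point lies in a minimal subflow of the normal subgroup\<close>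

locale metrizable_extension = group_extension G T H X a +
  fibre: metrizable_universal "G\<lparr>carrier := H\<rparr>" "subtopology T H" U b \<psi> X a
  for G :: "('g, 'm) monoid_scheme" and T :: "'g topology" and H :: "'g set"
    and X :: "'x topology" and a :: "'x \<Rightarrow> 'g \<Rightarrow> 'x"
    and U :: "'u topology" and b :: "'u \<Rightarrow> 'g \<Rightarrow> 'u" and \<psi> :: "'u \<Rightarrow> ('g \<Rightarrow> real) \<Rightarrow> real"
begin

text \<open>Both sides of the criterion \<open>periodic_iff\<close> are \<open>H\<close>-orbit
  closures, and \<open>closure_translate\<close> moves these by \<open>g\<close>.\<close>

lemma periodic_translate:
  assumes x: "x \<in> fibre.periodic_points" and g: "g \<in> carrier G"
  shows "a x g \<in> fibre.periodic_points"
proof -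
  have xX: "x \<in> topspace X"
    using closedin_subset[OF fibre.closedin_periodic] x by blast
  have *: "X closure_of (a y ` H) = X closure_of (a x ` H)" if "y \<in> X closure_of (a x ` H)" for y
    using x that fibre.periodic_iff[OF xX] by simp
  have "X closure_of (a y ` H) = X closure_of (a (a x g) ` H)" if y: "y \<in> X closure_of (a (a x g) ` H)" for y
  proof -
    obtain z where z: "z \<in> X closure_of (a x ` H)" "y = a z g"
      using y closure_translate[OF xX g] by blast
    then have "z \<in> topspace X"
      using closure_of_subset_topspace by fast
    then show ?thesis
      using closure_translate[OF _ g] xX * z by simp
  qed
  then show ?thesis
    using fibre.periodic_iff[OF action_in[OF act xX g]] by simp
qed

lemma all_periodic: "fibre.periodic_points = topspace X"
proof
  show "fibre.periodic_points \<subseteq> topspace X"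
    by (rule closedin_subset[OF fibre.closedin_periodic])
  obtain x where x: "x \<in> fibre.periodic_points"
    using fibre.periodic_nonempty by blast
  then have "x \<in> topspace X"
    using closedin_subset[OF fibre.closedin_periodic] by blast
  then have "X closure_of (a x ` carrier G) = topspace X"
    using X by (simp add: minimal_flow_def)
  moreover have "X closure_of (a x ` carrier G) \<subseteq> fibre.periodic_points"
    using periodic_translate[OF x] by (intro closure_of_minimal fibre.closedin_periodic) auto
  ultimately show "topspace X \<subseteq> fibre.periodic_points"
    by simp
qed

end

section \<open>Fibre averages and the action of the large group\<close>

locale ergodic_extension = group_extension G T H X a +
  fibre: ergodic_universal "G\<lparr>carrier := H\<rparr>" "subtopology T H" U b \<psi> X a m n
  for G :: "('g, 'm) monoid_scheme" and T :: "'g topology" and H :: "'g set"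
    and X :: "'x topology" and a :: "'x \<Rightarrow> 'g \<Rightarrow> 'x"
    and U :: "'u topology" and b :: "'u \<Rightarrow> 'g \<Rightarrow> 'u" and \<psi> :: "'u \<Rightarrow> ('g \<Rightarrow> real) \<Rightarrow> real" and m n
begin

lemma expect_invariant: "f \<in> cfun X \<Longrightarrow> fibre.expect f \<in> invariant_funs"
  using fibre.expect_cfun fibre.expect_act by (simp add: invariant_funs_def)

text \<open>Averaging the translate of \<open>f\<close> over the subflow of \<open>x\<close> is an
  \<open>H\<close>-invariant state, by normality, and it is supported on the subflow of
  \<open>a x g\<close>; \<open>expect_unique\<close> leaves only one such state.\<close>

lemma expect_translate:
  assumes x: "x \<in> topspace X" and g: "g \<in> carrier G" and f: "f \<in> cfun X"
  shows "fibre.expect (\<lambda>y. f (a y g)) x = fibre.expect f (a x g)"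
proof (rule fibre.expect_unique[OF _ action_in[OF act x g] _ f])
  let ?J = "\<lambda>f. fibre.expect (\<lambda>y. f (a y g)) x"
  note st = fibre.expect_state(1)[OF x]
  show "invariant_state (G\<lparr>carrier := H\<rparr>) (topspace X) a (cfun X) ?J"
    unfolding invariant_state_def
  proof (intro conjI ballI)
    show "state (topspace X) (cfun X) ?J"
      by (rule state_pullback[where k = "\<lambda>y. a y g", OF st fun_space_cfun translate action_in[OF act _ g]])
        (use g in auto)
    fix h k assume h: "h \<in> carrier (G\<lparr>carrier := H\<rparr>)" and k: "k \<in> cfun X"
    let ?h = "g \<otimes>\<^bsub>G\<^esub> h \<otimes>\<^bsub>G\<^esub> inv\<^bsub>G\<^esub> g"
    have hH: "h \<in> H"
      using h by simp
    have h': "?h \<in> H" "?h \<in> carrier G" "h \<in> carrier G"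
      using inv_op_closed2[OF g hH] hH by auto
    have "fibre.expect (\<lambda>y. k (a (a y g) h)) x = fibre.expect (\<lambda>y. k (a (a y ?h) g)) x"
      using translate[OF translate[OF k h'(3)] g] translate[OF translate[OF k g] h'(2)] act_swap(1)[OF _ g hH]
      by (intro state_cong[OF st]) auto
    also have "\<dots> = fibre.expect (\<lambda>y. k (a y g)) x"
      using invariant_stateD[OF fibre.expect_state(3)[OF x] _ translate[OF k g]] h'(1) by simp
    finally show "fibre.expect (\<lambda>y. k (a (a y g) h)) x = fibre.expect (\<lambda>y. k (a y g)) x" .
  qed
  fix k assume k: "k \<in> cfun X"
    and pos: "\<And>y. y \<in> X closure_of (a (a x g) ` carrier (G\<lparr>carrier := H\<rparr>)) \<Longrightarrow> 0 \<le> k y"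
  have "0 \<le> k (a y g)" if "y \<in> X closure_of (a x ` H)" for y
    using pos closure_translate[OF x g] that by simp
  then show "0 \<le> fibre.expect (\<lambda>y. k (a y g)) x"
    by (intro fibre.expect_state(2)[OF x translate[OF k g]]) simp
qed

lemma state_expect:
  assumes \<mu>: "invariant_state G (topspace X) a (cfun X) \<mu>" and f: "f \<in> cfun X"
  shows "\<mu> (fibre.expect f) = \<mu> f"
proof (rule fibre.state_expect[OF _ f])
  show "invariant_state (G\<lparr>carrier := H\<rparr>) (topspace X) a (cfun X) \<mu>"
    using \<mu> by (auto simp: invariant_state_def)
qed

text \<open>The existence half: the average commutes with \<open>G\<close>, so a state on the
  invariant functions composed with it stays \<open>G\<close>-invariant.\<close>

lemma invariant_state_lift:
  assumes I: "invariant_state G (topspace X) a invariant_funs I"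
  shows "invariant_state G (topspace X) a (cfun X) (\<lambda>f. I (fibre.expect f))"
proof -
  have st: "state (topspace X) invariant_funs I"
    using I by (simp add: invariant_state_def)
  note ei = expect_invariant
  have "state (topspace X) (cfun X) (\<lambda>f. I (fibre.expect f))"
    by (rule state_compose[OF st fun_space_cfun ei fibre.expect_state(1)])
  moreover have "I (fibre.expect (\<lambda>x. f (a x g))) = I (fibre.expect f)" if g: "g \<in> carrier G" and f: "f \<in> cfun X" for g f
  proof -
    have "I (fibre.expect (\<lambda>x. f (a x g))) = I (\<lambda>x. fibre.expect f (a x g))"
      by (rule state_cong[OF st ei[OF translate[OF f g]] translate_invariant[OF ei[OF f] g]])
        (rule expect_translate[OF _ g f])
    also have "\<dots> = I (fibre.expect f)"
      by (rule invariant_stateD[OF I g ei[OF f]])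
    finally show ?thesis .
  qed
  ultimately show ?thesis
    by (simp add: invariant_state_def)
qed

end

theorem theorem1p2:
  fixes G :: "('g, 'm) monoid_scheme" and T :: "'g topology" and H :: "'g set"
  assumes "polish_group G T"
    and "H \<lhd> G" and "closedin T H"
    and "metrizable_space (fst (UMF (G\<lparr>carrier := H\<rparr>) (subtopology T H)))"
    and "metrizable_space (fst (UMF (G Mod H) (coset_topology G T H)))"
    and "uniquely_ergodic (G\<lparr>carrier := H\<rparr>) (subtopology T H)"
    and "uniquely_ergodic (G Mod H) (coset_topology G T H)"
  shows "uniquely_ergodic G T"
proof -
  have G: "topological_group G T"
    using assms(1) by (simp add: polish_group_def)
  then have T: "topspace T = carrier G"
    by (simp add: topological_group_def)
  let ?H = "G\<lparr>carrier := H\<rparr>" and ?TH = "subtopology T H"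
    and ?K = "G Mod H" and ?TK = "coset_topology G T H"
  have HG: "topological_group ?H ?TH"
    using topological_group_subgroup[OF G] assms(2) by (simp add: normal_def)
  have K: "topological_group ?K ?TK"
    by (rule topological_group_quotient[OF G assms(2)])
  let ?X = "fst (UMF G T)" and ?a = "snd (UMF G T)"
  let ?U = "fst (UMF ?H ?TH)" and ?b = "snd (UMF ?H ?TH)"
  have X: "minimal_flow G T ?X ?a" and U: "minimal_flow ?H ?TH ?U ?b"
    using is_universal_minimal_flow_UMF[OF G] is_universal_minimal_flow_UMF[OF HG]
    by (auto simp: is_universal_minimal_flow_def)
  obtain m n where mn: "invariant_state ?H (topspace ?U) ?b (cfun ?U) m"
    "\<And>J k. invariant_state ?H (topspace ?U) ?b (cfun ?U) J \<Longrightarrow> k \<in> cfun ?U \<Longrightarrow> J k = m k"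
    "invariant_state ?H (carrier ?H) (\<otimes>\<^bsub>?H\<^esub>) (group_funs ?H ?TH) n"
    using unique_state_UMF[OF HG assms(6)] by metis
  obtain mK nK where K_state:
    "\<And>J k. invariant_state ?K (topspace (fst (UMF ?K ?TK))) (snd (UMF ?K ?TK)) (cfun (fst (UMF ?K ?TK))) J \<Longrightarrow>
      k \<in> cfun (fst (UMF ?K ?TK)) \<Longrightarrow> J k = mK k"
    "invariant_state ?K (carrier ?K) (\<otimes>\<^bsub>?K\<^esub>) (group_funs ?K ?TK) nK"
    using unique_state_UMF[OF K assms(7)] by metis
  obtain \<psi> where \<psi>: "\<And>u. u \<in> topspace ?U \<Longrightarrow> \<psi> u \<in> ambit_points ?H ?TH"
    "\<And>F. F \<in> group_funs ?H ?TH \<Longrightarrow> (\<lambda>u. \<psi> u F) \<in> cfun ?U"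
    "\<And>u h F. u \<in> topspace ?U \<Longrightarrow> h \<in> carrier ?H \<Longrightarrow> F \<in> group_funs ?H ?TH \<Longrightarrow>
      \<psi> (?b u h) F = \<psi> u (\<lambda>k. F (k \<otimes>\<^bsub>?H\<^esub> h))"
    using universal_ambit_map[OF HG is_universal_minimal_flow_UMF[OF HG]] by metis
  interpret group_extension G T H ?X ?a
    by (rule group_extension.intro[OF G assms(2) X])
  have fibre: "metrizable_universal ?H ?TH ?U ?b \<psi> ?X ?a"
  proof (rule metrizable_universal.intro)
    show "\<psi> u \<in> ambit_points ?H ?TH" if "u \<in> topspace ?U" for u
      using \<psi>(1)[OF that] .
    show "(\<lambda>u. \<psi> u F) \<in> cfun ?U" if "F \<in> group_funs ?H ?TH" for F
      using \<psi>(2)[OF that] .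
    show "\<psi> (?b u h) F = \<psi> u (\<lambda>k. F (k \<otimes>\<^bsub>?H\<^esub> h))"
      if "u \<in> topspace ?U" "h \<in> carrier ?H" "F \<in> group_funs ?H ?TH" for u h F
      using \<psi>(3)[OF that] .
  qed (rule HG U assms(4) subflow)+
  \<comment> \<open>This comes before \<open>ergodic_extension\<close> because it supplies
    \<open>all_periodic\<close>, an assumption of the latter.\<close>
  interpret metrizable_extension G T H ?X ?a ?U ?b \<psi>
    by (rule metrizable_extension.intro[OF group_extension_axioms fibre])
  interpret ergodic_extension G T H ?X ?a ?U ?b \<psi> m n
  proof (rule ergodic_extension.intro[OF group_extension_axioms ergodic_universal.intro[OF fibre ergodic_universal_axioms.intro]])
    show "J k = m k" if "invariant_state ?H (topspace ?U) ?b (cfun ?U) J" "k \<in> cfun ?U" for J k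
      using mn(2)[OF that] .
  qed (rule mn(1) mn(3) all_periodic)+
  let ?I = "\<lambda>f. nK (\<lambda>k. f (rep k))"
  have I: "invariant_state G (topspace ?X) ?a invariant_funs ?I"
    by (rule invariant_state_exists[OF K_state(2)])
  \<comment> \<open>\<open>J\<close> factors through \<open>expect\<close>, and on the invariant
    functions it must agree with \<open>?I\<close>. The lift of \<open>?I\<close> itself provides
    the state that exists.\<close>
  have "J f = ?I (fibre.expect f)"
    if J: "invariant_state G (topspace ?X) ?a (cfun ?X) J" and f: "f \<in> cfun ?X" for J f
  proof -
    have JB: "invariant_state G (topspace ?X) ?a invariant_funs J"
      using invariant_cfun by (intro invariant_state_subspace[OF J _ fun_space_invariant]) blast
    have "J f = J (fibre.expect f)"
      by (rule state_expect[OF J f, symmetric])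
    also have "\<dots> = ?I (fibre.expect f)"
    proof (rule invariant_state_unique[OF is_universal_minimal_flow_UMF[OF K] _ K_state(2) JB I expect_invariant[OF f]])
      show "J k = mK k"
        if "invariant_state ?K (topspace (fst (UMF ?K ?TK))) (snd (UMF ?K ?TK)) (cfun (fst (UMF ?K ?TK))) J"
          "k \<in> cfun (fst (UMF ?K ?TK))" for J k
        using K_state(1)[OF that] .
    qed
    finally show ?thesis .
  qed
  then show ?thesis
    unfolding uniquely_ergodic_def unique_invariant_measure_iff[OF Xflow T]
    using invariant_state_lift[OF I] by blast
qed

end
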